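(* Let $X$ be a finite connected CW complex of dimension $d\ge 1$ and let $r\colon X_d\to\mathbb{R}_{+}$, $b\mapsto r_b$, be a positive function on the set of $d$-cells. With respect to the modified inner product $\langle\ ,\ \rangle_R$ on $C_d(X;\mathbb{R})$, the orthogonal projection $C_d(X;\mathbb{R})\to Z_d(X;\mathbb{R})$ is given by $$\frac{1}{\Delta}\sum_{T} w_T\,\bar T,$$ where the sum is over all spanning trees $T$ of $X$, and $\Delta=\sum_T w_T$.
   Context: Notation. $X_k$ is the set of $k$-cells of $X$, $X^{(k)}$ its $k$-skeleton, $C_k(X;A)=H_k(X^{(k)},X^{(k-1)};A)$ the cellular chain group (free $A$-module on $X_k$), $\partial$ the cellular boundary, $Z_k(X;A)$ the $k$-cycles, $B_k(X;A)$ the $k$-boundaries; all homology is cellular, and $\beta_k$ denotes the $k$-th Betti number. The standard inner product $\langle\ ,\ \rangle$ on $C_k(X;\mathbb{R})$ is the one for which $X_k$ is an orthonormal basis. $R\colon C_d(X;\mathbb{R})\to C_d(X;\mathbb{R})$ is the linear map with $R(b)=r_b b$ for $b\in X_d$, and the modified inner product is $\langle x,y\rangle_R=\langle Rx,y\rangle$ on $C_d(X;\mathbb{R})$. Spanning tree. A spanning tree for $X$ is a subcomplex $T\subset X$ such that $H_d(T;\mathbb{Z})=0$, $\beta_{d-1}(T)=\beta_{d-1}(X)$, and $X^{(d-1)}\subset T$. $T_d$ denotes the set of $d$-cells of $T$. The map $\bar T$. For a spanning tree $T$, the linear map $\bar T\colon C_d(X;\mathbb{R})\to Z_d(X;\mathbb{R})$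 is defined on $d$-cells by: $\bar T(b)=0$ if $b\in T_d$; if $b\notin T_d$, then $H_d(T\cup b;\mathbb{Z})=Z_d(T\cup b;\mathbb{Z})\subset C_d(X;\mathbb{R})$ is infinite cyclic, and with a generator $c$ and $t_b=\langle c,b\rangle\neq 0$ one sets $\bar T(b)=c/t_b$ (independent of the choice of $c$). Weights. $\theta_T$ is the order of the torsion subgroup of $H_{d-1}(T;\mathbb{Z})$, and $w_T=\theta_T^2\prod_{b\in T_d} r_b^{-1}$. *)

theory Defs
  imports "HOL-Homology.Homology"
begin

definition disk :: "nat \<Rightarrow> (nat \<Rightarrow> real) topology" where
  "disk k = subtopology (Euclidean_space k) {x. (\<Sum>i<k. (x i)\<^sup>2) \<le> 1}"

definition disk_interior :: "nat \<Rightarrow> (nat \<Rightarrow> real) set" where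
  "disk_interior k = {x \<in> topspace (Euclidean_space k). (\<Sum>i<k. (x i)\<^sup>2) < 1}"

definition disk_boundary :: "nat \<Rightarrow> (nat \<Rightarrow> real) set" where
  "disk_boundary k = {x \<in> topspace (Euclidean_space k). (\<Sum>i<k. (x i)\<^sup>2) = 1}"

text \<open>The cells of all dimensions are indexed by one set; the characteristic map of a cell
  \<open>b\<close> is a map from the disk of dimension \<open>cell_dim W b\<close>.\<close>

record ('a, 'i) cw =
  cw_space :: "'a topology"
  cells :: "'i set"
  cell_dim :: "'i \<Rightarrow> nat"
  char_map :: "'i \<Rightarrow> (nat \<Rightarrow> real) \<Rightarrow> 'a"

definition open_cell :: "('a, 'i) cw \<Rightarrow> 'i \<Rightarrow> 'a set" where
  "open_cell W b = char_map W b ` disk_interior (cell_dim W b)"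

text \<open>Dimensions of cells and skeleta are integers from here on, so that the empty skeleton of
  dimension \<open>-1\<close> needs no special treatment.\<close>

definition kcells :: "('a, 'i) cw \<Rightarrow> int \<Rightarrow> 'i set" where
  "kcells W k = {b \<in> cells W. int (cell_dim W b) = k}"

definition skeleton :: "('a, 'i) cw \<Rightarrow> int \<Rightarrow> 'a set" where
  "skeleton W k = (\<Union>b \<in> {b \<in> cells W. int (cell_dim W b) \<le> k}. open_cell W b)"

text \<open>Since there are finitely many cells and the space is Hausdorff, closure-finiteness and the
  weak topology are automatic: the space is a finite union of the compact, hence closed,
  images of the characteristic maps.\<close>

definition finite_cw_complex :: "('a, 'i) cw \<Rightarrow> bool" where
  "finite_cw_complex W \<longleftrightarrow>
     Hausdorff_space (cw_space W) \<and>
     finite (cells W) \<and>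
     disjoint_family_on (open_cell W) (cells W) \<and>
     (\<Union>b \<in> cells W. open_cell W b) = topspace (cw_space W) \<and>
     (\<forall>b \<in> cells W.
        continuous_map (disk (cell_dim W b)) (cw_space W) (char_map W b) \<and>
        embedding_map (subtopology (disk (cell_dim W b)) (disk_interior (cell_dim W b)))
          (cw_space W) (char_map W b) \<and>
        char_map W b ` disk_boundary (cell_dim W b) \<subseteq> skeleton W (int (cell_dim W b) - 1))"

definition has_cw_dimension :: "('a, 'i) cw \<Rightarrow> nat \<Rightarrow> bool" where
  "has_cw_dimension W d \<longleftrightarrow>
     (\<exists>b \<in> cells W. cell_dim W b = d) \<and> (\<forall>b \<in> cells W. cell_dim W b \<le> d)"

definition subcomplex :: "('a, 'i) cw \<Rightarrow> 'a set \<Rightarrow> bool" where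
  "subcomplex W T \<longleftrightarrow>
     closedin (cw_space W) T \<and> (\<exists>B \<subseteq> cells W. T = (\<Union>b \<in> B. open_cell W b))"

definition restrict_cw :: "('a, 'i) cw \<Rightarrow> 'a set \<Rightarrow> ('a, 'i) cw" where
  "restrict_cw W T =
     W\<lparr>cw_space := subtopology (cw_space W) T, cells := {b \<in> cells W. open_cell W b \<subseteq> T}\<rparr>"

text \<open>As everywhere in the homology library, abelian groups are written multiplicatively.\<close>

definition Z_independent :: "('g, 'm) monoid_scheme \<Rightarrow> 'g set \<Rightarrow> bool" where
  "Z_independent G S \<longleftrightarrow>
     finite S \<and> S \<subseteq> carrier G \<and>
     (\<forall>n :: 'g \<Rightarrow> int. finprod G (\<lambda>s. s [^]\<^bsub>G\<^esub> n s) S = \<one>\<^bsub>G\<^esub> \<longrightarrow> (\<forall>s \<in> S. n s = 0))"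

definition abelian_rank :: "('g, 'm) monoid_scheme \<Rightarrow> nat" where
  "abelian_rank G = Sup (card ` {S. Z_independent G S})"

definition torsion :: "('g, 'm) monoid_scheme \<Rightarrow> 'g set" where
  "torsion G = {x \<in> carrier G. \<exists>n :: nat. 0 < n \<and> x [^]\<^bsub>G\<^esub> n = \<one>\<^bsub>G\<^esub>}"

definition is_generator :: "('g, 'm) monoid_scheme \<Rightarrow> 'g \<Rightarrow> bool" where
  "is_generator G g \<longleftrightarrow> g \<in> carrier G \<and> carrier G = range (\<lambda>n :: int. g [^]\<^bsub>G\<^esub> n)"

definition cell_chain_group :: "('a, 'i) cw \<Rightarrow> int \<Rightarrow> 'a chain set monoid" where
  "cell_chain_group W k =
     relative_homology_group k (subtopology (cw_space W) (skeleton W k)) (skeleton W (k - 1))"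

text \<open>The connecting homomorphism of the triple of consecutive skeleta.\<close>

definition cell_boundary :: "('a, 'i) cw \<Rightarrow> int \<Rightarrow> 'a chain set \<Rightarrow> 'a chain set" where
  "cell_boundary W k =
     hom_relboundary k (subtopology (cw_space W) (skeleton W k)) (skeleton W (k - 1))
       (skeleton W (k - 2))"

lemma cell_boundary_hom:
  "cell_boundary W k \<in> hom (cell_chain_group W k) (cell_chain_group W (k - 1))"
proof -
  have "skeleton W (k - 1) \<subseteq> skeleton W k"
    by (force simp: skeleton_def)
  then have "subtopology (subtopology (cw_space W) (skeleton W k)) (skeleton W (k - 1))
           = subtopology (cw_space W) (skeleton W (k - 1))"
    by (simp add: subtopology_subtopology Int_absorb1)
  then show ?thesis
    using group_homomorphism_hom_relboundary [of k "subtopology (cw_space W) (skeleton W k)" "skeleton W (k - 1)"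
        "skeleton W (k - 2)"]
    by (simp add: cell_boundary_def cell_chain_group_def)
qed

definition cell_cycle_group :: "('a, 'i) cw \<Rightarrow> int \<Rightarrow> 'a chain set monoid" where
  "cell_cycle_group W k =
     subgroup_generated (cell_chain_group W k)
       (kernel (cell_chain_group W k) (cell_chain_group W (k - 1)) (cell_boundary W k))"

definition cell_boundaries :: "('a, 'i) cw \<Rightarrow> int \<Rightarrow> 'a chain set set" where
  "cell_boundaries W k = cell_boundary W (k + 1) ` carrier (cell_chain_group W (k + 1))"

definition cell_homology_group :: "('a, 'i) cw \<Rightarrow> int \<Rightarrow> 'a chain set set monoid" where
  "cell_homology_group W k = cell_cycle_group W k Mod cell_boundaries W k"

definition betti :: "('a, 'i) cw \<Rightarrow> int \<Rightarrow> nat" where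
  "betti W k = abelian_rank (cell_homology_group W k)"

text \<open>An arbitrary orientation of each standard disk is fixed once and for all.\<close>

definition disk_class :: "nat \<Rightarrow> (nat \<Rightarrow> real) chain set" where
  "disk_class k =
     (SOME g. is_generator (relative_homology_group (int k) (disk k) (disk_boundary k)) g)"

definition cell_class :: "('a, 'i) cw \<Rightarrow> 'i \<Rightarrow> 'a chain set" where
  "cell_class W b =
     (let k = cell_dim W b in
      hom_induced (int k) (disk k) (disk_boundary k)
        (subtopology (cw_space W) (skeleton W (int k))) (skeleton W (int k - 1))
        (char_map W b) (disk_class k))"

text \<open>The classes of the \<open>k\<close>-cells form a basis of the free abelian group of cellular
  \<open>k\<close>-chains, so the description below is uniquely satisfied.\<close>

definition cell_coords :: "('a, 'i) cw \<Rightarrow> int \<Rightarrow> 'a chain set \<Rightarrow> 'i \<Rightarrow> int" where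
  "cell_coords W k z =
     (THE n. (\<forall>b. b \<notin> kcells W k \<longrightarrow> n b = 0) \<and>
        z = finprod (cell_chain_group W k)
              (\<lambda>b. cell_class W b [^]\<^bsub>cell_chain_group W k\<^esub> n b) (kcells W k))"

text \<open>Real chains are elements of the free real vector space on the cells: functions on the cells,
  extended by zero to the whole index type.\<close>

definition real_chains :: "('a, 'i) cw \<Rightarrow> int \<Rightarrow> ('i \<Rightarrow> real) set" where
  "real_chains W k = {x. \<forall>b. b \<notin> kcells W k \<longrightarrow> x b = 0}"

definition real_boundary :: "('a, 'i) cw \<Rightarrow> int \<Rightarrow> ('i \<Rightarrow> real) \<Rightarrow> 'i \<Rightarrow> real" where
  "real_boundary W k x =
     (\<lambda>a. \<Sum>b \<in> kcells W k.
        x b * real_of_int (cell_coords W (k - 1) (cell_boundary W k (cell_class W b)) a))"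

definition real_cycles :: "('a, 'i) cw \<Rightarrow> int \<Rightarrow> ('i \<Rightarrow> real) set" where
  "real_cycles W k = {x \<in> real_chains W k. real_boundary W k x = (\<lambda>_. 0)}"

definition std_inner :: "('a, 'i) cw \<Rightarrow> int \<Rightarrow> ('i \<Rightarrow> real) \<Rightarrow> ('i \<Rightarrow> real) \<Rightarrow> real" where
  "std_inner W k x y = (\<Sum>b \<in> kcells W k. x b * y b)"

definition R_map :: "('i \<Rightarrow> real) \<Rightarrow> ('i \<Rightarrow> real) \<Rightarrow> 'i \<Rightarrow> real" where
  "R_map r x = (\<lambda>b. r b * x b)"

definition mod_inner ::
    "('a, 'i) cw \<Rightarrow> int \<Rightarrow> ('i \<Rightarrow> real) \<Rightarrow> ('i \<Rightarrow> real) \<Rightarrow> ('i \<Rightarrow> real) \<Rightarrow> real" where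
  "mod_inner W k r x y = std_inner W k (R_map r x) y"

definition is_orthogonal_projection ::
    "(('i \<Rightarrow> real) \<Rightarrow> ('i \<Rightarrow> real) \<Rightarrow> real) \<Rightarrow> ('i \<Rightarrow> real) set \<Rightarrow> ('i \<Rightarrow> real) set
      \<Rightarrow> (('i \<Rightarrow> real) \<Rightarrow> 'i \<Rightarrow> real) \<Rightarrow> bool" where
  "is_orthogonal_projection ip V U P \<longleftrightarrow>
     (\<forall>x \<in> V. P x \<in> U \<and> (\<forall>z \<in> U. ip (\<lambda>b. x b - P x b) z = 0))"

definition spanning_tree :: "('a, 'i) cw \<Rightarrow> nat \<Rightarrow> 'a set \<Rightarrow> bool" where
  "spanning_tree W d T \<longleftrightarrow>
     subcomplex W T \<and>
     trivial_group (cell_homology_group (restrict_cw W T) (int d)) \<and>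
     betti (restrict_cw W T) (int d - 1) = betti W (int d - 1) \<and>
     skeleton W (int d - 1) \<subseteq> T"

text \<open>If \<open>T\<close> is a spanning tree and \<open>b\<close> a \<open>d\<close>-cell outside it, the group of \<open>d\<close>-cycles of
  \<open>T \<union> b\<close> is infinite cyclic and \<open>x b \<noteq> 0\<close>; replacing the generator \<open>c\<close> by its inverse does not
  change \<open>x a / x b\<close>.\<close>

definition tree_map_cell :: "('a, 'i) cw \<Rightarrow> nat \<Rightarrow> 'a set \<Rightarrow> 'i \<Rightarrow> 'i \<Rightarrow> real" where
  "tree_map_cell W d T b =
     (if b \<in> kcells (restrict_cw W T) (int d) then (\<lambda>_. 0)
      else
        (let Tb = restrict_cw W (T \<union> open_cell W b);
             c = (SOME c. is_generator (cell_cycle_group Tb (int d)) c);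
             x = (\<lambda>a. real_of_int (cell_coords Tb (int d) c a))
         in (\<lambda>a. x a / x b)))"

definition tree_map :: "('a, 'i) cw \<Rightarrow> nat \<Rightarrow> 'a set \<Rightarrow> ('i \<Rightarrow> real) \<Rightarrow> 'i \<Rightarrow> real" where
  "tree_map W d T x = (\<lambda>a. \<Sum>b \<in> kcells W (int d). x b * tree_map_cell W d T b a)"

definition tree_theta :: "('a, 'i) cw \<Rightarrow> nat \<Rightarrow> 'a set \<Rightarrow> nat" where
  "tree_theta W d T = card (torsion (cell_homology_group (restrict_cw W T) (int d - 1)))"

definition tree_weight :: "('a, 'i) cw \<Rightarrow> nat \<Rightarrow> ('i \<Rightarrow> real) \<Rightarrow> 'a set \<Rightarrow> real" where
  "tree_weight W d r T =
     (real (tree_theta W d T))\<^sup>2 * (\<Prod>b \<in> kcells (restrict_cw W T) (int d). inverse (r b))"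

definition total_weight :: "('a, 'i) cw \<Rightarrow> nat \<Rightarrow> ('i \<Rightarrow> real) \<Rightarrow> real" where
  "total_weight W d r = (\<Sum>T | spanning_tree W d T. tree_weight W d r T)"

end

theory Submission
  imports Defs "HOL-Analysis.Kronecker_Approximation_Theorem"
begin

text \<open>
  The statement is linear algebra over the integers once the cellular chain groups are known to
  be free on the cells. That is the topological input (\<open>attached_class_basis\<close>): if a Hausdorff
  space arises from a closed subspace \<open>Y\<close> by attaching finitely many \<open>k\<close>-cells, its \<open>k\<close>-th
  homology relative to \<open>Y\<close> is free on the classes of these cells. For one cell this is a
  deformation and an excision (\<open>iso_characteristic_map\<close>). For several cells, the projection to
  the homology relative to the complement of one cell reads off the coefficient at that cell and
  kills the classes of the others; this gives independence, and the exact sequence of a triple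
  gives generation by induction on the number of cells.

  Write \<open>Z\<close> for the group of \<open>(d-1)\<close>-cycles and \<open>g b\<close> for the boundary of the \<open>d\<close>-cell \<open>b\<close>.
  Taking coordinates embeds \<open>Z\<close> in a group of integer vectors. A subcomplex \<open>T\<close> that contains the
  \<open>(d-1)\<close>-skeleton is determined by its set \<open>S\<close> of \<open>d\<close>-cells, its \<open>d\<close>-cycles are the integral
  relations among the \<open>g b\<close> with \<open>b \<in> S\<close>, and its \<open>(d-1)\<close>-st homology is the quotient of \<open>Z\<close>
  by the span of these \<open>g b\<close>. So \<open>T\<close> is a spanning tree if and only if \<open>S\<close> is a basis: the
  \<open>g b\<close> with \<open>b \<in> S\<close> are independent, and every boundary has a positive multiple in their span
  (\<open>spanning_tree_iff\<close>; the Betti number condition is the second half, by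
  \<open>abelian_rank_FactGroup_eq_iff\<close>). For \<open>b \<notin> S\<close> the relations supported on \<open>S\<close> and \<open>b\<close> are the
  multiples of a single circuit \<open>c\<close> with \<open>c b \<noteq> 0\<close>, and the tree map sends \<open>b\<close> to \<open>c / c b\<close>.

  Let \<open>P\<close> be the weighted mean of the tree maps. Each tree map has values in the real cycles and
  fixes every real cycle \<open>z\<close>: the difference between \<open>z\<close> and its image is a real cycle supported
  on \<open>S\<close>, and there are none except \<open>0\<close>, because a homogeneous integral system with a
  non-zero real solution has a non-zero integral one. Hence \<open>P\<close> also has both properties, and it is
  the orthogonal projection as soon as it is self-adjoint, that is, \<open>r a * P b a\<close> is symmetric in
  the cells \<open>a\<close> and \<open>b\<close>, where \<open>P b a\<close> is the coefficient of \<open>P b\<close> at \<open>a\<close>.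

  The symmetry holds term by term. A basis \<open>S\<close> contributes to \<open>P b a\<close> with \<open>a \<noteq> b\<close> only if
  \<open>a \<in> S\<close>, \<open>b \<notin> S\<close> and its circuit \<open>c\<close> at \<open>b\<close> has \<open>c a \<noteq> 0\<close>. Then exchanging \<open>a\<close> for \<open>b\<close>
  gives a basis \<open>S'\<close> with the same circuit \<open>c\<close> at \<open>a\<close> (\<open>basis_exchange\<close>). As \<open>g b\<close> has order
  \<open>\<bar>c b\<bar>\<close> modulo the span of \<open>S\<close>, adding \<open>b\<close> to \<open>S\<close> divides the order of the torsion by
  \<open>\<bar>c b\<bar>\<close> (\<open>theta_insert\<close>); adding \<open>a\<close> to \<open>S'\<close> leads to the same set and divides by \<open>\<bar>c a\<bar>\<close>.
  Hence the torsion orders satisfy \<open>\<theta> S * \<bar>c a\<bar> = \<theta> S' * \<bar>c b\<bar>\<close>, and the squares in the weights turn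
  the coefficient \<open>c a / c b\<close> into \<open>c b / c a\<close>, while the factors \<open>inverse (r a)\<close> and
  \<open>inverse (r b)\<close> are exchanged. Finally, the total weight is positive because a maximal
  independent set is a basis and all torsion orders are finite.
\<close>

section \<open>Integral combinations in abelian groups\<close>

definition supported :: "'i set \<Rightarrow> ('i \<Rightarrow> 'r::zero) \<Rightarrow> bool" where
  "supported S x \<longleftrightarrow> (\<forall>b. b \<notin> S \<longrightarrow> x b = 0)"

definition lincomb :: "('g, 'm) monoid_scheme \<Rightarrow> ('i \<Rightarrow> 'g) \<Rightarrow> 'i set \<Rightarrow> ('i \<Rightarrow> int) \<Rightarrow> 'g" where
  "lincomb G g I n = finprod G (\<lambda>b. g b [^]\<^bsub>G\<^esub> n b) I"

context comm_group
begin

lemma lincomb_closed [simp]: "g \<in> I \<rightarrow> carrier G \<Longrightarrow> lincomb G g I n \<in> carrier G"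
  unfolding lincomb_def by (rule finprod_closed) auto

lemma lincomb_cong:
  assumes "g \<in> I \<rightarrow> carrier G" "\<And>b. b \<in> I \<Longrightarrow> n b = m b"
  shows "lincomb G g I n = lincomb G g I m"
  unfolding lincomb_def by (rule finprod_cong') (use assms in auto)

lemma lincomb_cong_gens:
  assumes "g \<in> I \<rightarrow> carrier G" "\<And>b. b \<in> I \<Longrightarrow> h b = g b"
  shows "lincomb G h I n = lincomb G g I n"
  unfolding lincomb_def by (rule finprod_cong') (use assms in auto)

lemma lincomb_add:
  assumes "g \<in> I \<rightarrow> carrier G"
  shows "lincomb G g I (\<lambda>b. n b + m b) = lincomb G g I n \<otimes> lincomb G g I m"
proof -
  have "lincomb G g I (\<lambda>b. n b + m b) = (\<Otimes>b\<in>I. g b [^] n b \<otimes> g b [^] m b)"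
    unfolding lincomb_def by (rule finprod_cong') (use assms in \<open>auto simp: int_pow_mult Pi_iff\<close>)
  also have "\<dots> = lincomb G g I n \<otimes> lincomb G g I m"
    unfolding lincomb_def by (rule finprod_multf) (use assms in auto)
  finally show ?thesis .
qed

lemma lincomb_zero [simp]: "lincomb G g I (\<lambda>b. 0) = \<one>"
  by (simp add: lincomb_def)

lemma lincomb_uminus:
  assumes "g \<in> I \<rightarrow> carrier G"
  shows "lincomb G g I (\<lambda>b. - n b) = inv (lincomb G g I n)"
proof (rule sym, rule inv_equality)
  show "lincomb G g I (\<lambda>b. - n b) \<otimes> lincomb G g I n = \<one>"
    using assms by (simp flip: lincomb_add)
qed (use assms in auto)

lemma lincomb_diff:
  assumes "g \<in> I \<rightarrow> carrier G"
  shows "lincomb G g I (\<lambda>b. n b - m b) = lincomb G g I n \<otimes> inv (lincomb G g I m)"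
  using lincomb_add [OF assms, of n "\<lambda>b. - m b"] by (simp add: lincomb_uminus [OF assms])

lemma lincomb_restrict:
  assumes "finite I" "J \<subseteq> I" "g \<in> I \<rightarrow> carrier G" "\<And>b. b \<in> I - J \<Longrightarrow> n b = 0"
  shows "lincomb G g I n = lincomb G g J n"
  unfolding lincomb_def
  by (rule finprod_mono_neutral_cong_right) (use assms in \<open>auto simp: Pi_iff\<close>)

lemma lincomb_insert:
  assumes "finite I" "g \<in> insert b I \<rightarrow> carrier G" "b \<notin> I"
  shows "lincomb G g (insert b I) n = g b [^] n b \<otimes> lincomb G g I n"
  unfolding lincomb_def by (rule finprod_insert) (use assms in \<open>auto simp: Pi_iff\<close>)

lemma lincomb_single:
  assumes "finite I" "g \<in> I \<rightarrow> carrier G" "b \<in> I"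
  shows "lincomb G g I (\<lambda>a. if a = b then m else 0) = g b [^] m"
proof -
  have "lincomb G g I (\<lambda>a. if a = b then m else 0) = lincomb G g {b} (\<lambda>a. if a = b then m else 0)"
    by (rule lincomb_restrict) (use assms in auto)
  also have "\<dots> = g b [^] m"
    using assms by (simp add: lincomb_def Pi_iff)
  finally show ?thesis .
qed

lemma lincomb_power:
  assumes "finite I" "g \<in> I \<rightarrow> carrier G"
  shows "lincomb G g I (\<lambda>b. k * n b) = lincomb G g I n [^] k"
  using assms
proof (induction I rule: finite_induct)
  case empty
  then show ?case by (simp add: lincomb_def)
next
  case (insert a I)
  then have "lincomb G g (insert a I) (\<lambda>b. k * n b) = g a [^] (k * n a) \<otimes> lincomb G g I n [^] k"
    by (subst lincomb_insert) auto
  also have "\<dots> = (g a [^] n a \<otimes> lincomb G g I n) [^] k"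
    using insert.prems by (subst int_pow_distrib) (auto simp: int_pow_pow mult.commute Pi_iff)
  also have "\<dots> = lincomb G g (insert a I) n [^] k"
    using insert by (subst lincomb_insert) auto
  finally show ?case .
qed

end

lemma hom_lincomb:
  assumes "comm_group G" "comm_group H" "h \<in> hom G H" "finite I" "g \<in> I \<rightarrow> carrier G"
  shows "h (lincomb G g I n) = lincomb H (\<lambda>b. h (g b)) I n"
proof -
  interpret G: comm_group G by fact
  interpret H: comm_group H by fact
  interpret h: group_hom G H h
    by (simp add: assms group_hom_axioms_def group_hom_def)
  show ?thesis
    using assms(4,5)
  proof (induction I rule: finite_induct)
    case empty
    then show ?case by (simp add: lincomb_def)
  next
    case (insert a I)
    moreover have "(\<lambda>b. h (g b)) \<in> insert a I \<rightarrow> carrier H"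
      using insert.prems by (auto intro: h.hom_closed)
    ultimately show ?case
      by (simp add: G.lincomb_insert H.lincomb_insert h.hom_int_pow Pi_iff)
  qed
qed

section \<open>Integral solutions of linear systems\<close>

text \<open>Gaussian elimination without division: a vector with a non-zero entry in column \<open>a\<close> serves as
  pivot, and cross-multiplying clears that column from the other vectors. This bounds the rank of
  every subquotient of a group of integer vectors.\<close>

lemma integer_relation:
  fixes v :: "'s \<Rightarrow> 'b \<Rightarrow> int"
  assumes "finite B" "finite S" "card B < card S"
  shows "\<exists>n. (\<exists>s\<in>S. n s \<noteq> 0) \<and> (\<forall>a\<in>B. (\<Sum>s\<in>S. n s * v s a) = 0)"
  using assms
proof (induction B arbitrary: S v rule: finite_induct)
  case empty
  then obtain s where "s \<in> S" by fastforce
  then show ?case by (intro exI [of _ "\<lambda>_. 1"]) auto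
next
  case (insert a B)
  show ?case
  proof (cases "\<forall>s\<in>S. v s a = 0")
    case True
    moreover have "card B < card S"
      using insert by simp
    ultimately show ?thesis
      using insert.IH [OF insert.prems(1), of v] by auto
  next
    case False
    then obtain s0 where s0: "s0 \<in> S" "v s0 a \<noteq> 0" by blast
    let ?S = "S - {s0}"
    have "card B < card ?S"
      using insert s0 by simp
    then obtain m where m: "\<exists>s\<in>?S. m s \<noteq> 0"
      and mB: "\<And>x. x \<in> B \<Longrightarrow> (\<Sum>s\<in>?S. m s * (v s0 a * v s x - v s a * v s0 x)) = 0"
      using insert.IH [of ?S "\<lambda>s x. v s0 a * v s x - v s a * v s0 x"] insert.prems by auto
    \<comment> \<open>The coefficient at the pivot is chosen so that column \<open>a\<close> cancels.\<close>
    define n where "n s = (if s = s0 then - (\<Sum>s\<in>?S. m s * v s a) else v s0 a * m s)" for s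
    have sum: "(\<Sum>s\<in>S. n s * v s x) = (\<Sum>s\<in>?S. m s * (v s0 a * v s x - v s a * v s0 x))" for x
    proof -
      have "(\<Sum>s\<in>S. n s * v s x) = n s0 * v s0 x + (\<Sum>s\<in>?S. n s * v s x)"
        using s0 insert.prems by (simp add: sum.remove)
      also have "(\<Sum>s\<in>?S. n s * v s x) = (\<Sum>s\<in>?S. v s0 a * m s * v s x)"
        by (rule sum.cong) (auto simp: n_def)
      also have "n s0 * v s0 x = - (\<Sum>s\<in>?S. m s * v s a * v s0 x)"
        by (simp add: n_def sum_distrib_right)
      finally show ?thesis
        by (simp add: algebra_simps sum_subtractf)
    qed
    show ?thesis
    proof (intro exI conjI ballI)
      show "\<exists>s\<in>S. n s \<noteq> 0"
        using m s0 by (auto simp: n_def)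
      show "(\<Sum>s\<in>S. n s * v s x) = 0" if "x \<in> insert a B" for x
        using that mB unfolding sum by (auto simp: mult.commute)
    qed
  qed
qed

text \<open>Simultaneous Dirichlet approximation replaces elimination over the rationals: if an integer
  multiple of a real solution is close enough to an integer vector, then the system maps
  that vector to integers of absolute value less than \<open>1\<close>, hence to \<open>0\<close>.\<close>

lemma integer_solution_of_real_solution:
  fixes D :: "'s \<Rightarrow> 'b \<Rightarrow> int" and x :: "'s \<Rightarrow> real"
  assumes S: "finite S" and F: "finite F" and b0: "b0 \<in> S" "x b0 \<noteq> 0"
    and sol: "\<And>a. a \<in> F \<Longrightarrow> (\<Sum>b\<in>S. x b * D b a) = 0"
  shows "\<exists>n. n b0 \<noteq> 0 \<and> (\<forall>a\<in>F. (\<Sum>b\<in>S. n b * D b a) = 0)"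
proof -
  define y where "y b = x b / x b0" for b
  have y0: "y b0 = 1"
    using b0 by (simp add: y_def)
  have soly: "(\<Sum>b\<in>S. y b * D b a) = 0" if "a \<in> F" for a
    using sol [OF that] by (simp add: y_def flip: sum_divide_distrib)
  \<comment> \<open>With an error of at most \<open>1 / N\<close> in each entry, every equation is off by less than \<open>1\<close>.\<close>
  define N where "N = Suc (nat (\<Sum>b\<in>S. \<Sum>a\<in>F. \<bar>D b a\<bar>))"
  obtain f where f: "bij_betw f {..<card S} S"
    using ex_bij_betw_nat_finite [OF S] by (auto simp: atLeast0LessThan)
  have "N > 0"
    by (simp add: N_def)
  from Dirichlet_approx_simult [OF this, of "card S" "\<lambda>i. y (f i)"]
  obtain q p where q: "0 < q" and p: "\<And>i. i < card S \<Longrightarrow> \<bar>of_int q * y (f i) - of_int (p i)\<bar> < 1 / N"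
    by blast
  \<comment> \<open>Since \<open>y b0 = 1\<close>, the entry of \<open>n\<close> at \<open>b0\<close> is the positive denominator \<open>q\<close>.\<close>
  define n where "n b = p (inv_into {..<card S} f b)" for b
  have n: "\<bar>q * y b - n b\<bar> < 1 / N" if "b \<in> S" for b
  proof -
    have "inv_into {..<card S} f b \<in> {..<card S}" "f (inv_into {..<card S} f b) = b"
      using f that inv_into_into [of b f "{..<card S}"] f_inv_into_f [of b f "{..<card S}"] by (auto simp: bij_betw_def)
    then show ?thesis
      using p [of "inv_into {..<card S} f b"] by (simp add: n_def)
  qed
  have "\<bar>real_of_int (q - n b0)\<bar> < 1"
  proof -
    have "1 / real N \<le> 1"
      by (simp add: N_def)
    then show ?thesis
      using n [OF b0(1)] unfolding y0 by simp
  qed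
  then have "n b0 = q"
    by linarith
  moreover have "(\<Sum>b\<in>S. n b * D b a) = 0" if a: "a \<in> F" for a
  proof -
    have "real_of_int (\<Sum>b\<in>S. n b * D b a) = (\<Sum>b\<in>S. (n b - q * y b) * D b a) + q * (\<Sum>b\<in>S. y b * D b a)"
    proof -
      have "real_of_int (\<Sum>b\<in>S. n b * D b a) = (\<Sum>b\<in>S. (n b - q * y b) * D b a + q * (y b * D b a))"
        unfolding of_int_sum by (rule sum.cong) (auto simp: algebra_simps)
      then show ?thesis
        by (simp only: sum.distrib sum_distrib_left)
    qed
    then have "\<bar>real_of_int (\<Sum>b\<in>S. n b * D b a)\<bar> = \<bar>\<Sum>b\<in>S. (n b - q * y b) * D b a\<bar>"
      by (simp add: soly a)
    also have "\<dots> \<le> (\<Sum>b\<in>S. \<bar>(n b - q * y b) * D b a\<bar>)"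
      by (rule sum_abs)
    also have "\<dots> \<le> (\<Sum>b\<in>S. 1 / N * \<bar>D b a\<bar>)"
    proof (rule sum_mono)
      fix b assume "b \<in> S"
      then have "\<bar>n b - q * y b\<bar> \<le> 1 / N"
        using n [of b] by linarith
      then show "\<bar>(n b - q * y b) * D b a\<bar> \<le> 1 / N * \<bar>D b a\<bar>"
        unfolding abs_mult of_int_abs [symmetric] by (intro mult_right_mono) auto
    qed
    also have "\<dots> = 1 / N * real_of_int (\<Sum>b\<in>S. \<bar>D b a\<bar>)"
      by (simp add: sum_distrib_left)
    also have "\<dots> \<le> 1 / N * real_of_int (\<Sum>b\<in>S. \<Sum>a\<in>F. \<bar>D b a\<bar>)"
    proof -
      have "(\<Sum>b\<in>S. \<bar>D b a\<bar>) \<le> (\<Sum>b\<in>S. \<Sum>a\<in>F. \<bar>D b a\<bar>)"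
        using F a by (intro sum_mono member_le_sum) auto
      then show ?thesis
        unfolding of_int_le_iff [symmetric, where 'a = real] by (rule mult_left_mono) simp
    qed
    also have "\<dots> < 1"
    proof -
      have "(\<Sum>b\<in>S. \<Sum>a\<in>F. \<bar>D b a\<bar>) \<ge> 0"
        by (intro sum_nonneg) auto
      then have "real_of_int (\<Sum>b\<in>S. \<Sum>a\<in>F. \<bar>D b a\<bar>) < N"
        unfolding N_def by linarith
      then show ?thesis
        by (simp add: N_def del: of_int_sum)
    qed
    finally show ?thesis
      by linarith
  qed
  ultimately show ?thesis
    using q by (intro exI [of _ n]) auto
qed

section \<open>Rank and torsion of quotients of abelian groups\<close>

lemma (in group) rcos_eq_iff:
  assumes "subgroup H G" "x \<in> carrier G" "y \<in> carrier G"
  shows "H #> x = H #> y \<longleftrightarrow> x \<otimes> inv y \<in> H"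
  using assms coset_mult_inv1 [of H x y] coset_mult_inv2 [of H x y] coset_join1 [of H "x \<otimes> inv y"]
    coset_join2 [of "x \<otimes> inv y" H] subgroup.subset by blast

context comm_group
begin

definition indep_mod :: "'a set \<Rightarrow> 'a set \<Rightarrow> bool" where
  "indep_mod H R \<longleftrightarrow> finite R \<and> R \<subseteq> carrier G \<and>
     (\<forall>n. lincomb G (\<lambda>s. s) R n \<in> H \<longrightarrow> (\<forall>s\<in>R. n s = 0))"

lemma rcos_lincomb:
  assumes "subgroup H G" "finite R" "h \<in> R \<rightarrow> carrier G"
  shows "lincomb (G Mod H) (\<lambda>s. H #> h s) R n = H #> lincomb G h R n"
proof -
  interpret N: normal H G
    by (simp add: assms subgroup_imp_normal)
  show ?thesis
    using hom_lincomb [OF comm_group_axioms abelian_FactGroup [OF assms(1)] N.r_coset_hom_Mod assms(2,3)] by simp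
qed

lemma rcos_eq_self_iff:
  assumes "subgroup H G" "x \<in> carrier G"
  shows "H #> x = H \<longleftrightarrow> x \<in> H"
  using assms coset_join1 coset_join2 by blast

text \<open>Independence in a quotient is a statement about sets of cosets. It is moved to sets of
  representatives in \<open>G\<close>, so that quotients by different subgroups can be compared.\<close>

lemma Z_independent_FactGroup:
  assumes H: "subgroup H G"
  shows "card ` {S. Z_independent (G Mod H) S} = card ` {R. indep_mod H R}"
proof -
  let ?Q = "G Mod H"
  interpret Q: comm_group ?Q
    by (rule abelian_FactGroup) fact
  have "\<exists>R. indep_mod H R \<and> card R = card S" if S: "Z_independent ?Q S" for S
  proof -
    have fin: "finite S" and SQ: "S \<subseteq> (\<lambda>x. H #> x) ` carrier G"
      using S by (auto simp: Z_independent_def carrier_FactGroup)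
    then obtain R where R: "R \<subseteq> carrier G" "S = (\<lambda>x. H #> x) ` R" "inj_on (\<lambda>x. H #> x) R"
      by (metis subset_image_inj)
    have finR: "finite R"
      using R fin finite_image_iff by blast
    have QR: "(\<lambda>x. H #> x) \<in> R \<rightarrow> carrier ?Q"
      using R by (auto simp: carrier_FactGroup)
    have "indep_mod H R"
      unfolding indep_mod_def
    proof (intro conjI allI impI finR R(1))
      fix n :: "'a \<Rightarrow> int" assume n: "lincomb G (\<lambda>s. s) R n \<in> H"
      define m where "m c = n (inv_into R (\<lambda>x. H #> x) c)" for c
      have "finprod ?Q (\<lambda>s. s [^]\<^bsub>?Q\<^esub> m s) S = finprod ?Q (\<lambda>x. (H #> x) [^]\<^bsub>?Q\<^esub> m (H #> x)) R"
        unfolding R(2) using R(3) QR by (intro Q.finprod_reindex) (auto intro!: Q.int_pow_closed)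
      also have "\<dots> = lincomb ?Q (\<lambda>x. H #> x) R n"
        unfolding lincomb_def m_def using R(3) QR by (intro Q.finprod_cong') (auto intro!: Q.int_pow_closed)
      also have "\<dots> = H #> lincomb G (\<lambda>s. s) R n"
        by (rule rcos_lincomb) (use H finR R in auto)
      also have "\<dots> = \<one>\<^bsub>?Q\<^esub>"
        using n H R by (simp add: coset_join2 subset_iff)
      finally have "\<forall>s\<in>S. m s = 0"
        using S by (simp add: Z_independent_def)
      then show "\<forall>s\<in>R. n s = 0"
        using R by (auto simp: m_def)
    qed
    moreover have "card R = card S"
      using R by (simp add: card_image)
    ultimately show ?thesis by blast
  qed
  moreover have "\<exists>S. Z_independent ?Q S \<and> card S = card R" if R: "indep_mod H R" for R
  proof -
    have fin: "finite R" and RG: "R \<subseteq> carrier G"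
      and ind: "\<And>n s. lincomb G (\<lambda>s. s) R n \<in> H \<Longrightarrow> s \<in> R \<Longrightarrow> n s = 0"
      using R by (auto simp: indep_mod_def)
    have inj: "inj_on (\<lambda>x. H #> x) R"
    proof (rule inj_onI, rule ccontr)
      fix x y assume xy: "x \<in> R" "y \<in> R" "H #> x = H #> y" "x \<noteq> y"
      have "lincomb G (\<lambda>s. s) R (\<lambda>s. (if s = x then 1 else 0) - (if s = y then 1 else 0)) = x \<otimes> inv y"
      proof -
        have RI: "(\<lambda>s. s) \<in> R \<rightarrow> carrier G"
          using RG by auto
        show ?thesis
          using xy RG by (simp add: lincomb_diff [OF RI] lincomb_single [OF fin RI] subset_iff)
      qed
      also have "\<dots> \<in> H"
        using xy H RG rcos_eq_iff by (metis subsetD)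
      finally show False
        using ind [of _ x] xy by fastforce
    qed
    have QR: "(\<lambda>x. H #> x) \<in> R \<rightarrow> carrier ?Q"
      using RG by (auto simp: carrier_FactGroup)
    have "Z_independent ?Q ((\<lambda>x. H #> x) ` R)"
      unfolding Z_independent_def
    proof (intro conjI allI impI)
      fix m :: "'a set \<Rightarrow> int"
      assume m: "finprod ?Q (\<lambda>s. s [^]\<^bsub>?Q\<^esub> m s) ((\<lambda>x. H #> x) ` R) = \<one>\<^bsub>?Q\<^esub>"
      have "finprod ?Q (\<lambda>s. s [^]\<^bsub>?Q\<^esub> m s) ((\<lambda>x. H #> x) ` R) = lincomb ?Q (\<lambda>x. H #> x) R (\<lambda>x. m (H #> x))"
        unfolding lincomb_def using QR inj by (intro Q.finprod_reindex) (auto intro!: Q.int_pow_closed)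
      also have "\<dots> = H #> lincomb G (\<lambda>s. s) R (\<lambda>x. m (H #> x))"
        by (rule rcos_lincomb) (use H fin RG in auto)
      finally have "H #> lincomb G (\<lambda>s. s) R (\<lambda>x. m (H #> x)) = H"
        using m by simp
      moreover have "lincomb G (\<lambda>s. s) R (\<lambda>x. m (H #> x)) \<in> carrier G"
        by (rule lincomb_closed) (use RG in auto)
      ultimately have "lincomb G (\<lambda>s. s) R (\<lambda>x. m (H #> x)) \<in> H"
        using H by (simp add: rcos_eq_self_iff)
      then show "\<forall>s\<in>(\<lambda>x. H #> x) ` R. m s = 0"
        using ind by blast
    qed (use fin RG in \<open>auto simp: carrier_FactGroup\<close>)
    then show ?thesis
      using inj card_image by blast
  qed
  ultimately show ?thesis
    by (fastforce simp: image_iff)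
qed

lemma abelian_rank_FactGroup:
  "subgroup H G \<Longrightarrow> abelian_rank (G Mod H) = Sup (card ` {R. indep_mod H R})"
  by (simp add: abelian_rank_def Z_independent_FactGroup)

text \<open>A combination that lies in \<open>K\<close> has a multiple in \<open>H\<close>.\<close>

lemma indep_mod_torsion_extension:
  assumes HK: "subgroup H G" "subgroup K G" "H \<subseteq> K"
    and tors: "\<And>x. x \<in> K \<Longrightarrow> \<exists>k::int. k > 0 \<and> x [^] k \<in> H"
  shows "indep_mod H R \<longleftrightarrow> indep_mod K R"
proof
  assume R: "indep_mod H R"
  show "indep_mod K R"
    unfolding indep_mod_def
  proof (intro conjI allI impI ballI)
    fix n s assume n: "lincomb G (\<lambda>s. s) R n \<in> K" and s: "s \<in> R"
    obtain k :: int where k: "k > 0" "lincomb G (\<lambda>s. s) R n [^] k \<in> H"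
      using tors n by blast
    then have "lincomb G (\<lambda>s. s) R (\<lambda>s. k * n s) \<in> H"
      using R by (subst lincomb_power) (auto simp: indep_mod_def)
    then have "k * n s = 0"
      using R s unfolding indep_mod_def by blast
    with k show "n s = 0" by simp
  qed (use R in \<open>auto simp: indep_mod_def\<close>)
qed (use HK in \<open>auto simp: indep_mod_def\<close>)

text \<open>An element \<open>x\<close> of \<open>K\<close> without positive powers in \<open>H\<close> can be added to a maximal set that is
  independent modulo \<open>K\<close>, and the result is still independent modulo \<open>H\<close>. The bound makes the ranks
  genuine maxima: the rank of an abelian group with arbitrarily large independent sets is the
  supremum of an unbounded set of natural numbers, which is a default value.\<close>

lemma abelian_rank_FactGroup_eq_iff:
  assumes HK: "subgroup H G" "subgroup K G" "H \<subseteq> K"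
    and bound: "\<And>R. indep_mod H R \<Longrightarrow> card R \<le> N"
  shows "abelian_rank (G Mod H) = abelian_rank (G Mod K) \<longleftrightarrow> (\<forall>x\<in>K. \<exists>k::int. k > 0 \<and> x [^] k \<in> H)"
    (is "_ \<longleftrightarrow> ?tors")
proof
  assume ?tors
  then have "{R. indep_mod H R} = {R. indep_mod K R}"
    using indep_mod_torsion_extension [OF HK] by blast
  then show "abelian_rank (G Mod H) = abelian_rank (G Mod K)"
    using HK by (simp add: abelian_rank_FactGroup)
next
  assume eq: "abelian_rank (G Mod H) = abelian_rank (G Mod K)"
  show ?tors
  proof (rule ccontr)
    assume "\<not> ?tors"
    then obtain x where x: "x \<in> K" and nt: "\<And>k::int. k > 0 \<Longrightarrow> x [^] k \<notin> H" by auto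
    have xG: "x \<in> carrier G"
      using x HK subgroup.mem_carrier by metis
    have KH: "indep_mod H R" if "indep_mod K R" for R
      using that HK by (auto simp: indep_mod_def)
    have finH: "finite (card ` {R. indep_mod H R})"
      by (rule finite_subset [of _ "{..N}"]) (use bound in auto)
    have finK: "finite (card ` {R. indep_mod K R})"
      by (rule finite_subset [OF _ finH]) (use KH in auto)
    have "indep_mod K {}"
      by (simp add: indep_mod_def)
    then have "card ` {R. indep_mod K R} \<noteq> {}"
      by blast
    then have "Sup (card ` {R. indep_mod K R}) \<in> card ` {R. indep_mod K R}"
      using finK by (metis Sup_nat_def Max_in)
    then obtain R where R: "indep_mod K R" "card R = abelian_rank (G Mod K)"
      using HK by (auto simp: abelian_rank_FactGroup)
    have fin: "finite R" and RG: "R \<subseteq> carrier G"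
      and ind: "\<And>n s. lincomb G (\<lambda>s. s) R n \<in> K \<Longrightarrow> s \<in> R \<Longrightarrow> n s = 0"
      using R by (auto simp: indep_mod_def)
    have "x \<notin> R"
    proof
      assume "x \<in> R"
      then have "lincomb G (\<lambda>s. s) R (\<lambda>s. if s = x then 1 else 0) = x"
        using fin RG by (subst lincomb_single) auto
      then show False
        using ind [of "\<lambda>s. if s = x then 1 else 0" x] x \<open>x \<in> R\<close> by auto
    qed
    have "indep_mod H (insert x R)"
      unfolding indep_mod_def
    proof (intro conjI allI impI)
      fix n assume n: "lincomb G (\<lambda>s. s) (insert x R) n \<in> H"
      have split: "lincomb G (\<lambda>s. s) (insert x R) n = x [^] n x \<otimes> lincomb G (\<lambda>s. s) R n"
        by (rule lincomb_insert) (use fin RG xG \<open>x \<notin> R\<close> in auto)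
      have pK: "x [^] n x \<in> K"
        using x HK subgroup_int_pow_closed by blast
      have LG: "lincomb G (\<lambda>s. s) R n \<in> carrier G"
        by (rule lincomb_closed) (use RG in auto)
      have "inv (x [^] n x) \<otimes> (x [^] n x \<otimes> lincomb G (\<lambda>s. s) R n) \<in> K"
        using n HK pK unfolding split by (meson subgroup.m_closed subgroup.m_inv_closed subsetD)
      then have "lincomb G (\<lambda>s. s) R n \<in> K"
        using xG LG by (simp flip: m_assoc)
      then have z: "\<forall>s\<in>R. n s = 0"
        using ind by blast
      then have "lincomb G (\<lambda>s. s) R n = \<one>"
        using lincomb_cong [of "\<lambda>s. s" R n "\<lambda>_. 0"] RG by auto
      then have xn: "x [^] n x \<in> H"
        using n xG unfolding split by simp
      then have "x [^] (- n x) \<in> H"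
        using xG HK by (simp add: int_pow_neg subgroup.m_inv_closed)
      then have "n x = 0"
        using nt [of "n x"] nt [of "- n x"] xn by linarith
      then show "\<forall>s\<in>insert x R. n s = 0"
        using z by simp
    qed (use fin RG xG in auto)
    then have "card (insert x R) \<le> abelian_rank (G Mod H)"
      unfolding abelian_rank_FactGroup [OF HK(1)]
      using finH by (intro cSup_upper) (auto simp: bdd_above_nat)
    then show False
      using R eq \<open>x \<notin> R\<close> fin by simp
  qed
qed

text \<open>The isolator of \<open>H\<close> is the preimage of the torsion of \<open>G Mod H\<close>.\<close>

definition isolator :: "'a set \<Rightarrow> 'a set" where
  "isolator H = {x \<in> carrier G. \<exists>k::int. k > 0 \<and> x [^] k \<in> H}"

lemma torsion_FactGroup:
  assumes H: "subgroup H G"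
  shows "torsion (G Mod H) = (\<lambda>x. H #> x) ` isolator H"
proof -
  interpret N: normal H G
    by (simp add: H subgroup_imp_normal)
  have pow: "(H #> x) [^]\<^bsub>G Mod H\<^esub> k = \<one>\<^bsub>G Mod H\<^esub> \<longleftrightarrow> x [^] int k \<in> H" if "x \<in> carrier G" for x and k :: nat
    using that N.FactGroup_int_pow [OF that, of "int k"] H
    by (simp add: int_pow_int) (metis coset_join1 coset_join2 nat_pow_closed)
  have "(\<exists>k::int. k > 0 \<and> x [^] k \<in> H) \<longleftrightarrow> (\<exists>k::nat. k > 0 \<and> x [^] int k \<in> H)" for x
    by (metis of_nat_0_less_iff pos_int_cases)
  then show ?thesis
    unfolding torsion_def isolator_def carrier_FactGroup using pow by (auto intro!: imageI)
qed

lemma isolator_torsion_extension: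
  assumes HK: "subgroup H G" "subgroup K G" "H \<subseteq> K"
    and tors: "\<And>x. x \<in> K \<Longrightarrow> \<exists>k::int. k > 0 \<and> x [^] k \<in> H"
  shows "isolator H = isolator K"
proof
  show "isolator K \<subseteq> isolator H"
  proof
    fix x assume "x \<in> isolator K"
    then obtain k :: int where k: "x \<in> carrier G" "k > 0" "x [^] k \<in> K"
      by (auto simp: isolator_def)
    then obtain l :: int where "l > 0" "(x [^] k) [^] l \<in> H"
      using tors by blast
    then show "x \<in> isolator H"
      using k unfolding isolator_def by (auto simp: int_pow_pow intro!: exI [of _ "k * l"])
  qed
qed (use HK in \<open>auto simp: isolator_def\<close>)

text \<open>\<open>K\<close> is generated by \<open>H\<close> and an element \<open>g\<close> of order \<open>t\<close> modulo \<open>H\<close>. Both quotients have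
  the same isolator \<open>A\<close>, so the torsion groups are \<open>A / H\<close> and \<open>A / K\<close>, and a coset of \<open>K\<close> in
  \<open>A\<close> consists of the \<open>t\<close> cosets of \<open>H\<close> that arise from one of them by multiplication with
  powers of \<open>g\<close>.\<close>

lemma card_torsion_cyclic_extension:
  assumes HK: "subgroup H G" "subgroup K G" "H \<subseteq> K"
    and g: "g \<in> K" and t: "t > 0"
    and ord: "\<And>k::int. g [^] k \<in> H \<longleftrightarrow> int t dvd k"
    and K: "\<And>x. x \<in> K \<Longrightarrow> \<exists>h\<in>H. \<exists>k::int. x = h \<otimes> g [^] k"
  shows "card (torsion (G Mod H)) = t * card (torsion (G Mod K))"
proof -
  have gG: "g \<in> carrier G"
    using g HK subgroup.mem_carrier by metis
  have HG: "H \<subseteq> carrier G"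
    using HK subgroup.subset by metis
  have tors: "\<exists>k::int. k > 0 \<and> x [^] k \<in> H" if xK: "x \<in> K" for x
  proof -
    obtain h and k :: int where hk: "h \<in> H" "x = h \<otimes> g [^] k"
      using K [OF xK] by blast
    then have "x [^] int t = h [^] int t \<otimes> g [^] (k * int t)"
      using gG HG by (simp add: int_pow_distrib int_pow_pow subsetD)
    moreover have "h [^] int t \<in> H"
      using hk HK subgroup_int_pow_closed by blast
    moreover have "g [^] (k * int t) \<in> H"
      using ord by simp
    ultimately have "x [^] int t \<in> H"
      using HK by (simp add: subgroup.m_closed)
    then show ?thesis
      using t by (intro exI [of _ "int t"]) auto
  qed
  define A where "A = isolator H"
  have AG: "A \<subseteq> carrier G"
    by (auto simp: A_def isolator_def)
  have KA: "K \<subseteq> A"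
    using tors HK subgroup.subset by (fastforce simp: A_def isolator_def)
  have A_mult: "x \<otimes> y \<in> A" if xA: "x \<in> A" and yA: "y \<in> A" for x y
  proof -
    obtain k l :: int where k: "k > 0" "x [^] k \<in> H" and l: "l > 0" "y [^] l \<in> H"
      using xA yA by (auto simp: A_def isolator_def)
    have "(x \<otimes> y) [^] (k * l) = (x [^] k) [^] l \<otimes> (y [^] l) [^] k"
      using xA yA AG by (simp add: int_pow_distrib int_pow_pow mult.commute subsetD)
    also have "\<dots> \<in> H"
      by (rule subgroup.m_closed [OF HK(1) subgroup_int_pow_closed [OF HK(1) k(2)] subgroup_int_pow_closed [OF HK(1) l(2)]])
    finally show ?thesis
      using k l xA yA AG by (auto simp: A_def isolator_def intro!: exI [of _ "k * l"])
  qed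
  \<comment> \<open>A system of representatives for the cosets of \<open>K\<close>; \<open>rep c \<otimes> g [^] i\<close> with \<open>i < t\<close> then
    represents the cosets of \<open>H\<close>.\<close>
  define rep where "rep c = (SOME x. x \<in> A \<and> K #> x = c)" for c
  have rep: "rep c \<in> A \<and> K #> rep c = c" if "c \<in> (\<lambda>x. K #> x) ` A" for c
    unfolding rep_def by (rule someI_ex) (use that in auto)
  have "bij_betw (\<lambda>(c, i). H #> (rep c \<otimes> g [^] int i)) ((\<lambda>x. K #> x) ` A \<times> {..<t}) ((\<lambda>x. H #> x) ` A)"
  proof (rule bij_betw_imageI)
    show "inj_on (\<lambda>(c, i). H #> (rep c \<otimes> g [^] int i)) ((\<lambda>x. K #> x) ` A \<times> {..<t})"
    proof (rule inj_onI)
      fix p q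
      assume p: "p \<in> (\<lambda>x. K #> x) ` A \<times> {..<t}" and q: "q \<in> (\<lambda>x. K #> x) ` A \<times> {..<t}"
        and pq: "(case p of (c, i) \<Rightarrow> H #> (rep c \<otimes> g [^] int i)) = (case q of (c, i) \<Rightarrow> H #> (rep c \<otimes> g [^] int i))"
      from p q obtain x i y j where *: "x \<in> A" "y \<in> A" "i < t" "j < t"
        and pq_eq: "p = (K #> x, i)" "q = (K #> y, j)"
        by blast
      have eq: "H #> (rep (K #> x) \<otimes> g [^] int i) = H #> (rep (K #> y) \<otimes> g [^] int j)"
        using pq by (simp add: pq_eq)
      let ?x = "rep (K #> x)" and ?y = "rep (K #> y)"
      have xy: "?x \<in> A" "?y \<in> A" "K #> ?x = K #> x" "K #> ?y = K #> y"
        using rep * by auto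
      then have xyG: "?x \<in> carrier G" "?y \<in> carrier G"
        using AG by auto
      have "(?x \<otimes> g [^] int i) \<otimes> inv (?y \<otimes> g [^] int j) \<in> H"
        using eq HK xyG gG by (subst (asm) rcos_eq_iff) auto
      also have "(?x \<otimes> g [^] int i) \<otimes> inv (?y \<otimes> g [^] int j) = (?x \<otimes> inv ?y) \<otimes> g [^] (int i - int j)"
        using xyG gG by (simp add: inv_mult int_pow_diff m_ac)
      finally have H: "(?x \<otimes> inv ?y) \<otimes> g [^] (int i - int j) \<in> H" .
      then have "((?x \<otimes> inv ?y) \<otimes> g [^] (int i - int j)) \<otimes> inv (g [^] (int i - int j)) \<in> K"
        using HK g by (meson subgroup.m_closed subgroup.m_inv_closed subsetD subgroup_int_pow_closed)
      then have "?x \<otimes> inv ?y \<in> K"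
        using xyG gG by (simp add: m_assoc)
      then have "K #> ?x = K #> ?y"
        using HK xyG by (simp add: rcos_eq_iff)
      then have c: "K #> x = K #> y"
        using xy by simp
      then have "g [^] (int i - int j) \<in> H"
        using H xyG gG by (simp add: r_inv)
      then have "int t dvd int i - int j"
        using ord by blast
      then have "i = j"
        using * by (auto simp: zmod_int simp flip: mod_eq_dvd_iff)
      with c show "p = q"
        by (simp add: pq_eq)
    qed
    show "(\<lambda>(c, i). H #> (rep c \<otimes> g [^] int i)) ` ((\<lambda>x. K #> x) ` A \<times> {..<t}) = (\<lambda>x. H #> x) ` A"
    proof safe
      fix x i assume "x \<in> A"
      then have "rep (K #> x) \<otimes> g [^] int i \<in> A"
        using rep [of "K #> x"] KA subgroup_int_pow_closed [OF HK(2) g, of "int i"] by (intro A_mult) auto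
      then show "H #> (rep (K #> x) \<otimes> g [^] int i) \<in> (\<lambda>x. H #> x) ` A"
        by blast
    next
      fix x assume x: "x \<in> A"
      let ?y = "rep (K #> x)"
      have y: "?y \<in> A" "K #> ?y = K #> x"
        using rep x by auto
      have xyG: "x \<in> carrier G" "?y \<in> carrier G"
        using x y AG by auto
      have "x \<otimes> inv ?y \<in> K"
        using HK y xyG by (metis rcos_eq_iff)
      then obtain h and k :: int where hk: "h \<in> H" "x \<otimes> inv ?y = h \<otimes> g [^] k"
        using K by blast
      define i where "i = nat (k mod int t)"
      have i: "i < t" "int i = k mod int t"
        using t by (auto simp: i_def nat_less_iff)
      have hG: "h \<in> carrier G"
        using hk HG by auto
      have "x \<otimes> inv (?y \<otimes> g [^] int i) = (x \<otimes> inv ?y) \<otimes> inv (g [^] int i)"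
        using xyG gG by (simp add: inv_mult m_ac)
      also have "\<dots> = h \<otimes> g [^] (k - int i)"
        unfolding hk(2) using hG gG by (simp add: int_pow_diff m_ac)
      also have "\<dots> \<in> H"
      proof -
        have "int t dvd k - int i"
          by (simp add: i minus_mod_eq_mult_div)
        then show ?thesis
          using hk HK ord by (simp add: subgroup.m_closed)
      qed
      finally have "H #> x = H #> (?y \<otimes> g [^] int i)"
        using HK xyG gG by (subst rcos_eq_iff) auto
      then show "H #> x \<in> (\<lambda>(c, i). H #> (rep c \<otimes> g [^] int i)) ` ((\<lambda>x. K #> x) ` A \<times> {..<t})"
        using x i by (intro image_eqI [of _ _ "(K #> x, i)"]) auto
    qed
  qed
  then have "card ((\<lambda>x. H #> x) ` A) = card ((\<lambda>x. K #> x) ` A \<times> {..<t})"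
    by (simp add: bij_betw_same_card)
  moreover have "isolator K = A"
    using isolator_torsion_extension [OF HK tors] by (simp add: A_def)
  ultimately show ?thesis
    using HK by (simp add: torsion_FactGroup A_def card_cartesian_product mult.commute)
qed

end

lemma (in comm_group) lincomb_in_subgroup:
  assumes "subgroup H G" "finite I" "h \<in> I \<rightarrow> H"
  shows "lincomb G h I n \<in> H"
  using assms(2,3)
proof (induction I rule: finite_induct)
  case empty
  then show ?case using assms by (simp add: lincomb_def subgroup.one_closed)
next
  case (insert a I)
  have "h \<in> insert a I \<rightarrow> carrier G"
    using insert.prems assms(1) subgroup.subset by fastforce
  moreover have "h a [^] n a \<in> H"
    using insert.prems by (intro subgroup_int_pow_closed [OF assms(1)]) auto
  ultimately show ?case
    using insert assms(1) by (simp add: lincomb_insert subgroup.m_closed)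
qed

lemma (in comm_group) subgroup_isolator:
  assumes H: "subgroup H G"
  shows "subgroup (isolator H) G"
proof (unfold_locales)
  show "isolator H \<subseteq> carrier G"
    by (auto simp: isolator_def)
  show "\<one> \<in> isolator H"
    using subgroup.one_closed [OF H] by (auto simp: isolator_def intro!: exI [of _ 1])
  show "inv x \<in> isolator H" if "x \<in> isolator H" for x
    using that subgroup.m_inv_closed [OF H] by (auto simp: isolator_def int_pow_inv)
  fix x y assume "x \<in> isolator H" "y \<in> isolator H"
  then obtain k l :: int where x: "x \<in> carrier G" "k > 0" "x [^] k \<in> H" and y: "y \<in> carrier G" "l > 0" "y [^] l \<in> H"
    by (auto simp: isolator_def)
  have "(x \<otimes> y) [^] (k * l) = (x [^] k) [^] l \<otimes> (y [^] l) [^] k"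
    using x y by (simp add: int_pow_distrib int_pow_pow mult.commute)
  also have "\<dots> \<in> H"
    by (rule subgroup.m_closed [OF H subgroup_int_pow_closed [OF H x(3)] subgroup_int_pow_closed [OF H y(3)]])
  finally show "x \<otimes> y \<in> isolator H"
    using x y by (auto simp: isolator_def intro!: exI [of _ "k * l"])
qed

lemma (in comm_group) isolator_idem:
  assumes "H \<subseteq> isolator K" "subgroup K G"
  shows "isolator H \<subseteq> isolator K"
proof
  fix x assume "x \<in> isolator H"
  then obtain k :: int where k: "x \<in> carrier G" "k > 0" "x [^] k \<in> H"
    by (auto simp: isolator_def)
  then obtain l :: int where "l > 0" "(x [^] k) [^] l \<in> K"
    using assms by (auto simp: isolator_def)
  with k show "x \<in> isolator K"
    by (auto simp: isolator_def int_pow_pow intro!: exI [of _ "k * l"])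
qed

lemma (in comm_group) subset_isolator: "subgroup H G \<Longrightarrow> H \<subseteq> isolator H"
  using subgroup.subset by (fastforce simp: isolator_def intro: exI [of _ 1])

section \<open>Bases and circuits of a finite family in a group of integral vectors\<close>

text \<open>In the application \<open>G\<close> is the group of \<open>(d-1)\<close>-cycles, \<open>E\<close> the set of \<open>d\<close>-cells, \<open>g\<close> maps a
  cell to its boundary and \<open>\<phi>\<close> takes coordinates with respect to the set \<open>F\<close> of \<open>(d-1)\<close>-cells.\<close>

locale integral_system = comm_group G for G (structure) +
  fixes E :: "'i set" and g :: "'i \<Rightarrow> 'a" and F :: "'j set" and \<phi> :: "'a \<Rightarrow> 'j \<Rightarrow> int"
  assumes finE: "finite E" and finF: "finite F" and g_closed: "g \<in> E \<rightarrow> carrier G"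
    and coord_mult: "\<lbrakk>x \<in> carrier G; y \<in> carrier G; a \<in> F\<rbrakk> \<Longrightarrow> \<phi> (x \<otimes> y) a = \<phi> x a + \<phi> y a"
    and coord_inj: "\<lbrakk>x \<in> carrier G; \<And>a. a \<in> F \<Longrightarrow> \<phi> x a = 0\<rbrakk> \<Longrightarrow> x = \<one>"
begin

abbreviation L :: "('i \<Rightarrow> int) \<Rightarrow> 'a" where
  "L n \<equiv> lincomb G g E n"

lemma coord_one: "a \<in> F \<Longrightarrow> \<phi> \<one> a = 0"
  using coord_mult [of \<one> \<one> a] by simp

lemma coord_inv: "x \<in> carrier G \<Longrightarrow> a \<in> F \<Longrightarrow> \<phi> (inv x) a = - \<phi> x a"
  using coord_mult [of x "inv x" a] by (simp add: coord_one)

lemma coord_int_pow: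
  assumes "x \<in> carrier G" "a \<in> F"
  shows "\<phi> (x [^] (k::int)) a = k * \<phi> x a"
proof -
  have nat: "\<phi> (x [^] (m::nat)) a = int m * \<phi> x a" for m
    by (induction m) (auto simp: coord_one coord_mult assms algebra_simps)
  show ?thesis
  proof (cases k rule: int_cases2)
    case (nonneg m)
    then show ?thesis using nat by (simp add: int_pow_int)
  next
    case (nonpos m)
    then show ?thesis using nat assms by (simp add: int_pow_neg_int coord_inv)
  qed
qed

lemma coord_lincomb:
  assumes "finite I" "h \<in> I \<rightarrow> carrier G" "a \<in> F"
  shows "\<phi> (lincomb G h I n) a = (\<Sum>b\<in>I. n b * \<phi> (h b) a)"
  using assms
proof (induction I rule: finite_induct)
  case empty
  then show ?case by (simp add: lincomb_def coord_one)
next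
  case (insert b I)
  then show ?case
    by (simp add: lincomb_insert coord_mult coord_int_pow Pi_iff)
qed

lemma L_closed [simp]: "L n \<in> carrier G"
  using g_closed by simp

lemma L_eq_one_iff: "L n = \<one> \<longleftrightarrow> (\<forall>a\<in>F. (\<Sum>b\<in>E. n b * \<phi> (g b) a) = 0)"
  using coord_lincomb [OF finE g_closed] coord_inj [of "L n"] coord_one by (metis L_closed)

lemma L_single: "b \<in> E \<Longrightarrow> L (\<lambda>a. if a = b then k else 0) = g b [^] k"
  by (rule lincomb_single) (use finE g_closed in auto)

lemma indep_mod_card_le:
  assumes R: "indep_mod H R" and H: "subgroup H G"
  shows "card R \<le> card F"
proof (rule ccontr)
  assume "\<not> card R \<le> card F"
  then obtain n where n: "\<exists>s\<in>R. n s \<noteq> 0" "\<And>a. a \<in> F \<Longrightarrow> (\<Sum>s\<in>R. n s * \<phi> s a) = 0"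
    using integer_relation [of F R \<phi>] R finF by (auto simp: indep_mod_def)
  have RG: "(\<lambda>s. s) \<in> R \<rightarrow> carrier G" and fin: "finite R"
    using R by (auto simp: indep_mod_def)
  have "lincomb G (\<lambda>s. s) R n = \<one>"
    by (rule coord_inj) (use n RG fin in \<open>auto simp: coord_lincomb\<close>)
  then show False
    using n R subgroup.one_closed [OF H] unfolding indep_mod_def by auto
qed

definition gen_span :: "'i set \<Rightarrow> 'a set" where
  "gen_span S = L ` {n. supported S n}"

lemma gen_spanI: "supported S n \<Longrightarrow> L n \<in> gen_span S"
  by (auto simp: gen_span_def)

lemma subgroup_gen_span: "subgroup (gen_span S) G"
proof (unfold_locales)
  show "gen_span S \<subseteq> carrier G"
    by (auto simp: gen_span_def)
  show "\<one> \<in> gen_span S"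
    using gen_spanI [of S "\<lambda>_. 0"] by (simp add: supported_def)
  show "x \<otimes> y \<in> gen_span S" if "x \<in> gen_span S" "y \<in> gen_span S" for x y
    using that g_closed gen_spanI [of S] by (auto simp: gen_span_def supported_def simp flip: lincomb_add)
  show "inv x \<in> gen_span S" if "x \<in> gen_span S" for x
    using that g_closed by (auto simp: gen_span_def supported_def simp flip: lincomb_uminus)
qed

lemma gen_span_mono: "S \<subseteq> T \<Longrightarrow> gen_span S \<subseteq> gen_span T"
  unfolding gen_span_def supported_def by blast

lemma generator_in_span:
  assumes "b \<in> S" "b \<in> E"
  shows "g b \<in> gen_span S"
  using gen_spanI [of S "\<lambda>a. if a = b then 1 else 0"] assms g_closed
  by (auto simp: supported_def L_single Pi_iff)

lemma gen_span_subset: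
  assumes H: "subgroup H G" and g: "g ` (S \<inter> E) \<subseteq> H"
  shows "gen_span S \<subseteq> H"
proof
  fix x assume "x \<in> gen_span S"
  then obtain n where n: "supported S n" "x = L n"
    by (auto simp: gen_span_def)
  have "L n = lincomb G g (S \<inter> E) n"
    by (rule lincomb_restrict) (use finE g_closed n in \<open>auto simp: supported_def\<close>)
  also have "\<dots> \<in> H"
    by (rule lincomb_in_subgroup) (use H finE g in auto)
  finally show "x \<in> H"
    by (simp add: n)
qed

definition independent :: "'i set \<Rightarrow> bool" where
  "independent S \<longleftrightarrow> S \<subseteq> E \<and> (\<forall>n. supported S n \<and> L n = \<one> \<longrightarrow> n = (\<lambda>_. 0))"

definition basis :: "'i set \<Rightarrow> bool" where
  "basis S \<longleftrightarrow> independent S \<and> g ` E \<subseteq> isolator (gen_span S)"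

text \<open>The isolator of a subgroup is a subgroup, so it suffices to look at generators.\<close>

lemma generators_isolated_iff: "g ` E \<subseteq> isolator (gen_span S) \<longleftrightarrow> (\<forall>x\<in>gen_span E. \<exists>k::int. k > 0 \<and> x [^] k \<in> gen_span S)"
proof -
  have "g ` E \<subseteq> isolator (gen_span S) \<longleftrightarrow> gen_span E \<subseteq> isolator (gen_span S)"
    using gen_span_subset [OF subgroup_isolator [OF subgroup_gen_span], of E S] generator_in_span by auto
  also have "\<dots> \<longleftrightarrow> (\<forall>x\<in>gen_span E. \<exists>k::int. k > 0 \<and> x [^] k \<in> gen_span S)"
    by (auto simp: isolator_def gen_span_def)
  finally show ?thesis .
qed

lemma rank_eq_iff:
  assumes "S \<subseteq> E"
  shows "abelian_rank (G Mod gen_span S) = abelian_rank (G Mod gen_span E) \<longleftrightarrow> g ` E \<subseteq> isolator (gen_span S)"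
  unfolding generators_isolated_iff
  by (rule abelian_rank_FactGroup_eq_iff [OF subgroup_gen_span subgroup_gen_span gen_span_mono [OF assms]])
    (use indep_mod_card_le subgroup_gen_span in blast)

text \<open>A relation with a non-zero coefficient at \<open>b\<close> can be solved for a multiple of \<open>g b\<close>.\<close>

lemma generator_in_isolator:
  assumes b: "b \<in> E" and n: "supported (insert b S) n" "L n = \<one>" "n b \<noteq> 0"
  shows "g b \<in> isolator (gen_span S)"
proof -
  define m where "m a = (if a = b then 0 else - n a)" for a
  have m: "supported S m"
    using n by (auto simp: supported_def m_def)
  have "L m = L (\<lambda>a. (if a = b then n b else 0) - n a)"
    by (rule arg_cong [where f = L]) (auto simp: m_def)
  also have "\<dots> = g b [^] n b"
    using n b g_closed by (simp add: lincomb_diff L_single Pi_iff)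
  finally have pow: "g b [^] n b \<in> gen_span S"
    using gen_spanI [OF m] by simp
  then have "g b [^] (- n b) \<in> gen_span S"
    using b g_closed subgroup.m_inv_closed [OF subgroup_gen_span] by (simp add: int_pow_neg Pi_iff)
  with pow have "g b [^] \<bar>n b\<bar> \<in> gen_span S"
    by (simp add: abs_if)
  then show ?thesis
    using b g_closed n by (auto simp: isolator_def Pi_iff intro!: exI [of _ "\<bar>n b\<bar>"])
qed

text \<open>A maximal independent set is a basis: adding any further element creates a relation, and its
  coefficient at that element cannot vanish.\<close>

lemma exists_basis: "\<exists>S. basis S"
proof -
  have "finite {S. independent S}"
    by (rule finite_subset [of _ "Pow E"]) (use finE in \<open>auto simp: independent_def\<close>)
  moreover have "independent {}"
    by (auto simp: independent_def supported_def)
  ultimately obtain S where S: "independent S" and max: "\<And>T. independent T \<Longrightarrow> S \<subseteq> T \<Longrightarrow> S = T"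
    using finite_has_maximal [of "{S. independent S}"] by blast
  have "g b \<in> isolator (gen_span S)" if b: "b \<in> E" for b
  proof (cases "b \<in> S")
    case True
    then show ?thesis
      using b generator_in_span subset_isolator [OF subgroup_gen_span] by blast
  next
    case False
    then have "\<not> independent (insert b S)"
      using max by blast
    then obtain n where n: "supported (insert b S) n" "L n = \<one>" "n \<noteq> (\<lambda>_. 0)"
      using S b by (auto simp: independent_def)
    have "n b \<noteq> 0"
    proof
      assume "n b = 0"
      then have "supported S n"
        using n by (auto simp: supported_def)
      then show False
        using S n by (auto simp: independent_def)
    qed
    then show ?thesis
      using generator_in_isolator b n by blast
  qed
  with S show ?thesis
    by (auto simp: basis_def)
qed

text \<open>\<open>c\<close> generates the group of relations supported on \<open>S\<close> and \<open>b\<close>. It is determined by \<open>S\<close> and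
  \<open>b\<close> up to sign, and quotients of its values are independent of the choice.\<close>

definition circuit :: "'i set \<Rightarrow> 'i \<Rightarrow> ('i \<Rightarrow> int) \<Rightarrow> bool" where
  "circuit S b c \<longleftrightarrow> {n. supported (insert b S) n \<and> L n = \<one>} = range (\<lambda>k a. k * c a)"

lemma circuit_relation:
  assumes "circuit S b c"
  shows "supported (insert b S) c" "L c = \<one>"
proof -
  have "(\<lambda>a. 1 * c a) \<in> {n. supported (insert b S) n \<and> L n = \<one>}"
    using assms unfolding circuit_def by blast
  then show "supported (insert b S) c" "L c = \<one>"
    by auto
qed

lemma circuit_multiple:
  assumes "circuit S b c" "supported (insert b S) n" "L n = \<one>"
  obtains k where "n = (\<lambda>a. k * c a)"
  using assms unfolding circuit_def by blast

lemma power_generator_in_span_relation: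
  assumes b: "b \<in> E" "b \<notin> S" and k: "g b [^] k \<in> gen_span S"
  obtains n where "supported (insert b S) n" "L n = \<one>" "n b = k"
proof -
  obtain m where m: "supported S m" "L m = g b [^] k"
    using k by (auto simp: gen_span_def)
  let ?n = "\<lambda>a. (if a = b then k else 0) - m a"
  have "L ?n = \<one>"
    using b g_closed m by (simp add: lincomb_diff L_single Pi_iff)
  moreover have "supported (insert b S) ?n" "?n b = k"
    using m b by (auto simp: supported_def)
  ultimately show ?thesis
    using that by blast
qed

lemma basis_relation:
  assumes S: "basis S" and b: "b \<in> E" "b \<notin> S"
  obtains n where "supported (insert b S) n" "L n = \<one>" "n b > 0"
proof -
  have "g b \<in> isolator (gen_span S)"
    using S b by (auto simp: basis_def)
  then obtain k :: int where k: "k > 0" "g b [^] k \<in> gen_span S"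
    by (auto simp: isolator_def)
  then show ?thesis
    using power_generator_in_span_relation [OF b k(2)] that by metis
qed

lemma circuit_nonzero:
  assumes "basis S" "b \<in> E" "b \<notin> S" "circuit S b c"
  shows "c b \<noteq> 0"
proof -
  obtain n where n: "supported (insert b S) n" "L n = \<one>" "n b > 0"
    using basis_relation [OF assms(1-3)] by blast
  then obtain k where "n = (\<lambda>a. k * c a)"
    using circuit_multiple [OF assms(4)] by blast
  with n show ?thesis by auto
qed

text \<open>The values at \<open>b\<close> of the relations supported on \<open>S\<close> and \<open>b\<close> form a subgroup of the integers,
  and a relation is determined by its value at \<open>b\<close> because \<open>S\<close> is independent. A relation with the
  least positive value at \<open>b\<close> is therefore a generator.\<close>

lemma exists_circuit:
  assumes S: "basis S" and b: "b \<in> E" "b \<notin> S"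
  shows "\<exists>c. circuit S b c"
proof -
  define R where "R = {n. supported (insert b S) n \<and> L n = \<one>}"
  have R_diff: "(\<lambda>a. n a - k * m a) \<in> R" if "n \<in> R" "m \<in> R" for n m k
    using that g_closed finE by (auto simp: R_def supported_def lincomb_diff lincomb_power)
  have zero: "(\<lambda>_. 0) \<in> R"
    by (auto simp: R_def supported_def)
  define P where "P t \<longleftrightarrow> t > 0 \<and> (\<exists>n\<in>R. n b = int t)" for t
  obtain n where n: "n \<in> R" "n b > 0"
    using basis_relation [OF S b] unfolding R_def by blast
  then have "P (nat (n b))"
    by (auto simp: P_def)
  then have P: "P (LEAST t. P t)"
    by (rule LeastI)
  define t where "t = (LEAST t. P t)"
  obtain c where c: "c \<in> R" "c b = int t" and t: "t > 0"
    using P unfolding t_def P_def by blast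
  have least: "\<not> P s" if "s < t" for s
    using that not_less_Least unfolding t_def by blast
  have "\<exists>k. m = (\<lambda>a. k * c a)" if m: "m \<in> R" for m
  proof -
    define k where "k = m b div int t"
    define l where "l a = m a - k * c a" for a
    have l: "l \<in> R"
      using R_diff [OF m c(1), of k] by (simp add: l_def [abs_def])
    have lb: "l b = m b mod int t"
      by (simp add: l_def c k_def minus_div_mult_eq_mod)
    have "l b = 0"
    proof (rule ccontr)
      assume "l b \<noteq> 0"
      then have "l b > 0"
        using lb t by (metis of_nat_0_less_iff pos_mod_sign order_le_less)
      moreover have "l b < int t"
        using lb t by simp
      ultimately have "P (nat (l b))" "nat (l b) < t"
        using l by (auto simp: P_def)
      then show False
        using least by blast
    qed
    then have "supported S l"
      using l by (auto simp: R_def supported_def)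
    then have "l = (\<lambda>_. 0)"
      using S l by (auto simp: basis_def independent_def R_def)
    then show ?thesis
      by (intro exI [of _ k]) (auto simp: l_def fun_eq_iff)
  qed
  moreover have "(\<lambda>a. k * c a) \<in> R" for k
    using R_diff [OF zero c(1), of "- k"] by simp
  ultimately have "R = range (\<lambda>k a. k * c a)"
    by auto
  then show ?thesis
    unfolding circuit_def R_def by blast
qed

definition theta :: "'i set \<Rightarrow> nat" where
  "theta S = card (torsion (G Mod gen_span S))"

text \<open>The order of \<open>g b\<close> modulo the span of \<open>S\<close> is \<open>\<bar>c b\<bar>\<close>, since \<open>k\<close> times \<open>g b\<close> lies in the span if
  and only if \<open>k\<close> is the coefficient at \<open>b\<close> of some multiple of \<open>c\<close>.\<close>

lemma theta_insert:
  assumes S: "basis S" and b: "b \<in> E" "b \<notin> S" and c: "circuit S b c"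
  shows "theta S = nat \<bar>c b\<bar> * theta (insert b S)"
  unfolding theta_def
proof (rule card_torsion_cyclic_extension)
  show "g b \<in> gen_span (insert b S)"
    using generator_in_span b by auto
  show "0 < nat \<bar>c b\<bar>"
    using circuit_nonzero [OF assms] by simp
  show "g b [^] k \<in> gen_span S \<longleftrightarrow> int (nat \<bar>c b\<bar>) dvd k" for k :: int
  proof
    assume "g b [^] k \<in> gen_span S"
    then obtain n where n: "supported (insert b S) n" "L n = \<one>" "n b = k"
      using power_generator_in_span_relation [OF b] by blast
    then obtain m where "n = (\<lambda>a. m * c a)"
      using circuit_multiple [OF c] by blast
    then show "int (nat \<bar>c b\<bar>) dvd k"
      using n by auto
  next
    assume "int (nat \<bar>c b\<bar>) dvd k"
    then have "c b dvd k" by simp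
    then obtain m where m: "k = m * c b"
      by (metis dvd_def mult.commute)
    define n where "n a = (if a = b then 0 else - (m * c a))" for a
    have "supported S n"
      using circuit_relation [OF c] by (auto simp: supported_def n_def)
    moreover have "L n = L (\<lambda>a. (if a = b then k else 0) - m * c a)"
      by (rule arg_cong [where f = L]) (auto simp: n_def m)
    then have "L n = g b [^] k"
      using circuit_relation [OF c] b g_closed finE by (simp add: lincomb_diff lincomb_power L_single Pi_iff)
    ultimately show "g b [^] k \<in> gen_span S"
      using gen_spanI by metis
  qed
  show "\<exists>h\<in>gen_span S. \<exists>k::int. x = h \<otimes> g b [^] k" if x: "x \<in> gen_span (insert b S)" for x
  proof -
    obtain n where n: "supported (insert b S) n" "x = L n"
      using x by (auto simp: gen_span_def)
    have "L n = L (\<lambda>a. (if a = b then 0 else n a) + (if a = b then n b else 0))"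
      by (rule arg_cong [where f = L]) auto
    also have "\<dots> = L (\<lambda>a. if a = b then 0 else n a) \<otimes> g b [^] n b"
      using g_closed b by (simp add: lincomb_add L_single)
    finally have "x = L (\<lambda>a. if a = b then 0 else n a) \<otimes> g b [^] n b"
      using n by simp
    moreover have "L (\<lambda>a. if a = b then 0 else n a) \<in> gen_span S"
      by (rule gen_spanI) (use n in \<open>auto simp: supported_def\<close>)
    ultimately show ?thesis by blast
  qed
qed (use gen_span_mono [of S "insert b S"] in \<open>auto intro: subgroup_gen_span\<close>)

text \<open>A relation supported on the new set is a multiple of \<open>c\<close> that vanishes at \<open>b'\<close>, hence is \<open>0\<close>;
  and \<open>c\<close> itself expresses a multiple of \<open>g b'\<close> through the new set.\<close>

lemma basis_exchange:
  assumes S: "basis S" and b: "b \<in> E" "b \<notin> S" and c: "circuit S b c" and b': "b' \<in> S" "c b' \<noteq> 0"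
  shows "basis (insert b (S - {b'}))" "circuit (insert b (S - {b'})) b' c"
proof -
  let ?S = "insert b (S - {b'})"
  have ins: "insert b' ?S = insert b S"
    using b b' by auto
  show c': "circuit ?S b' c"
    using c unfolding circuit_def ins .
  have SE: "S \<subseteq> E"
    using S by (auto simp: basis_def independent_def)
  have "n = (\<lambda>_. 0)" if n: "supported ?S n" "L n = \<one>" for n
  proof -
    have "supported (insert b S) n"
      using n(1) by (auto simp: supported_def)
    then obtain k where k: "n = (\<lambda>a. k * c a)"
      using circuit_multiple [OF c] n by blast
    have "n b' = 0"
      using n(1) b b' by (auto simp: supported_def)
    then show ?thesis
      using k b' by auto
  qed
  then have "independent ?S"
    using SE b by (auto simp: independent_def)
  moreover have "g ` E \<subseteq> isolator (gen_span ?S)"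
  proof -
    have "g a \<in> isolator (gen_span ?S)" if "a \<in> S" for a
    proof (cases "a = b'")
      case True
      then show ?thesis
        using generator_in_isolator [of b' ?S c] circuit_relation [OF c'] b' SE by auto
    next
      case False
      then have "g a \<in> gen_span ?S"
        using that SE by (intro generator_in_span) auto
      then show ?thesis
        using subset_isolator [OF subgroup_gen_span] by blast
    qed
    then have "gen_span S \<subseteq> isolator (gen_span ?S)"
      by (intro gen_span_subset subgroup_isolator subgroup_gen_span) auto
    then have "isolator (gen_span S) \<subseteq> isolator (gen_span ?S)"
      by (rule isolator_idem [OF _ subgroup_gen_span])
    then show ?thesis
      using S by (auto simp: basis_def)
  qed
  ultimately show "basis ?S"
    by (simp add: basis_def)
qed

text \<open>Both sides count the torsion for the union of the two bases, multiplied by \<open>\<bar>c b * c b'\<bar>\<close>.\<close>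

lemma theta_exchange:
  assumes S: "basis S" and b: "b \<in> E" "b \<notin> S" and c: "circuit S b c" and b': "b' \<in> S" "c b' \<noteq> 0"
  shows "real (theta S) * \<bar>c b'\<bar> = real (theta (insert b (S - {b'}))) * \<bar>c b\<bar>"
proof -
  let ?S = "insert b (S - {b'})"
  have ins: "insert b' ?S = insert b S"
    using b b' by auto
  have SE: "S \<subseteq> E"
    using S by (auto simp: basis_def independent_def)
  have "theta ?S = nat \<bar>c b'\<bar> * theta (insert b S)"
    using theta_insert [OF basis_exchange(1) [OF assms] _ _ basis_exchange(2) [OF assms]] b b' SE ins by auto
  moreover have "theta S = nat \<bar>c b\<bar> * theta (insert b S)"
    by (rule theta_insert) fact+
  ultimately show ?thesis
    by simp
qed

text \<open>Dividing the coefficients of a multiple \<open>k * x\<close> in the span by \<open>k\<close> with remainder moves \<open>x\<close>,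
  modulo the span, to an element whose coordinates are bounded by the sums of the absolute values
  of the coordinates of the generators. There are finitely many such elements.\<close>

lemma finite_torsion: "finite (torsion (G Mod gen_span S))"
proof -
  define M where "M a = (\<Sum>b\<in>E. \<bar>\<phi> (g b) a\<bar>)" for a
  define X where "X = {x \<in> carrier G. \<forall>a\<in>F. \<bar>\<phi> x a\<bar> \<le> M a}"
  have "finite X"
  proof (rule finite_imageD)
    show "finite ((\<lambda>x. restrict (\<phi> x) F) ` X)"
    proof (rule finite_subset)
      have "- M a \<le> \<phi> x a \<and> \<phi> x a \<le> M a" if "x \<in> X" "a \<in> F" for x a
        using that by (auto simp: X_def abs_le_iff minus_le_iff)
      then show "(\<lambda>x. restrict (\<phi> x) F) ` X \<subseteq> (\<Pi>\<^sub>E a\<in>F. {- M a..M a})"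
        by auto
      show "finite (\<Pi>\<^sub>E a\<in>F. {- M a..M a})"
        by (intro finite_PiE finF) auto
    qed
    show "inj_on (\<lambda>x. restrict (\<phi> x) F) X"
    proof (rule inj_onI)
      fix x y assume xy: "x \<in> X" "y \<in> X" and eq: "restrict (\<phi> x) F = restrict (\<phi> y) F"
      have "\<phi> x a = \<phi> y a" if "a \<in> F" for a
        using fun_cong [OF eq, of a] that by simp
      then have "x \<otimes> inv y = \<one>"
        using xy by (intro coord_inj) (auto simp: X_def coord_mult coord_inv)
      then show "x = y"
        using xy inv_equality [of x "inv y"] by (auto simp: X_def)
    qed
  qed
  moreover have "(\<lambda>x. gen_span S #> x) ` isolator (gen_span S) \<subseteq> (\<lambda>x. gen_span S #> x) ` X"
  proof clarify
    fix x assume "x \<in> isolator (gen_span S)"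
    then obtain k :: int and n where k: "x \<in> carrier G" "k > 0" "x [^] k = L n" "supported S n"
      by (auto simp: isolator_def gen_span_def)
    let ?h = "L (\<lambda>b. n b div k)"
    have h: "?h \<in> gen_span S"
      by (rule gen_spanI) (use k in \<open>auto simp: supported_def\<close>)
    let ?y = "x \<otimes> inv ?h"
    have yG: "?y \<in> carrier G"
      using k by simp
    have "\<bar>\<phi> ?y a\<bar> \<le> M a" if a: "a \<in> F" for a
    proof -
      have "k * \<phi> x a = (\<Sum>b\<in>E. n b * \<phi> (g b) a)"
        using coord_int_pow [OF k(1) a, of k] unfolding k(3) by (simp add: coord_lincomb finE g_closed a)
      moreover have "\<phi> ?h a = (\<Sum>b\<in>E. (n b div k) * \<phi> (g b) a)"
        by (simp add: coord_lincomb finE g_closed a)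
      ultimately have "k * \<phi> ?y a = (\<Sum>b\<in>E. n b * \<phi> (g b) a) - k * (\<Sum>b\<in>E. (n b div k) * \<phi> (g b) a)"
        using k a by (simp add: coord_mult coord_inv right_diff_distrib)
      also have "\<dots> = (\<Sum>b\<in>E. (n b - k * (n b div k)) * \<phi> (g b) a)"
        by (simp add: sum_distrib_left sum_subtractf left_diff_distrib mult.assoc)
      also have "\<dots> = (\<Sum>b\<in>E. (n b mod k) * \<phi> (g b) a)"
        by (simp add: minus_mult_div_eq_mod)
      finally have "\<bar>k * \<phi> ?y a\<bar> \<le> (\<Sum>b\<in>E. \<bar>(n b mod k) * \<phi> (g b) a\<bar>)"
        using sum_abs by metis
      also have "\<dots> \<le> (\<Sum>b\<in>E. k * \<bar>\<phi> (g b) a\<bar>)"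
      proof (rule sum_mono)
        fix b
        have "\<bar>n b mod k\<bar> \<le> k"
          using k(2) by (simp add: order_less_imp_le)
        then show "\<bar>(n b mod k) * \<phi> (g b) a\<bar> \<le> k * \<bar>\<phi> (g b) a\<bar>"
          unfolding abs_mult by (rule mult_right_mono) simp
      qed
      also have "\<dots> = k * M a"
        by (simp add: M_def sum_distrib_left)
      finally show ?thesis
        using k(2) by (simp add: abs_mult)
    qed
    then have "?y \<in> X"
      using yG by (simp add: X_def)
    moreover have "gen_span S #> x = gen_span S #> ?y"
    proof -
      have "x \<otimes> inv ?y = x \<otimes> (inv x \<otimes> ?h)"
        using k(1) by (simp add: inv_mult)
      also have "\<dots> = ?h"
        using k(1) by (simp flip: m_assoc)
      finally have "x \<otimes> inv ?y = ?h" .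
      then show ?thesis
        using k h subgroup_gen_span by (simp add: rcos_eq_iff)
    qed
    ultimately show "gen_span S #> x \<in> (\<lambda>x. gen_span S #> x) ` X"
      by blast
  qed
  ultimately show ?thesis
    unfolding torsion_FactGroup [OF subgroup_gen_span] using finite_subset by blast
qed

lemma theta_pos: "theta S > 0"
proof -
  have "\<one> \<in> isolator (gen_span S)"
    by (rule subgroup.one_closed [OF subgroup_isolator [OF subgroup_gen_span]])
  then have "torsion (G Mod gen_span S) \<noteq> {}"
    unfolding torsion_FactGroup [OF subgroup_gen_span] by blast
  then show ?thesis
    using finite_torsion by (simp add: theta_def card_gt_0_iff)
qed

section \<open>The weighted mean of the basis projections\<close>

definition real_relations :: "('i \<Rightarrow> real) set" where
  "real_relations = {x. supported E x \<and> (\<forall>a\<in>F. (\<Sum>b\<in>E. x b * real_of_int (\<phi> (g b) a)) = 0)}"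

text \<open>A real relation supported on \<open>S\<close> with a non-zero coefficient at \<open>b\<close> would yield an integral one.\<close>

lemma independent_real:
  assumes S: "independent S" and x: "x \<in> real_relations" "supported S x"
  shows "x = (\<lambda>_. 0)"
proof (rule ccontr)
  assume "x \<noteq> (\<lambda>_. 0)"
  then obtain b where b: "x b \<noteq> 0" by auto
  then have bS: "b \<in> S"
    using x by (auto simp: supported_def)
  have SE: "S \<subseteq> E"
    using S by (auto simp: independent_def)
  have sum: "(\<Sum>b\<in>S. y b * D b) = (\<Sum>b\<in>E. y b * D b)" if "supported S y" for y D :: "'i \<Rightarrow> 'r::comm_ring_1"
    using that SE finE by (intro sum.mono_neutral_left) (auto simp: supported_def)
  obtain n where n: "n b \<noteq> 0" "\<And>a. a \<in> F \<Longrightarrow> (\<Sum>b\<in>S. n b * \<phi> (g b) a) = 0"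
    using integer_solution_of_real_solution [of S F b x "\<lambda>b. \<phi> (g b)"] finite_subset [OF SE finE] finF bS b x(1)
    by (auto simp: sum [OF x(2)] real_relations_def)
  define m where "m a = (if a \<in> S then n a else 0)" for a
  have m: "supported S m"
    by (auto simp: supported_def m_def)
  have "(\<Sum>b\<in>S. m b * \<phi> (g b) a) = (\<Sum>b\<in>S. n b * \<phi> (g b) a)" for a
    by (rule sum.cong) (auto simp: m_def)
  then have "L m = \<one>"
    unfolding L_eq_one_iff using n by (simp add: sum [OF m, symmetric])
  then have "m = (\<lambda>_. 0)"
    using S m by (auto simp: independent_def)
  then show False
    using n bS by (metis m_def)
qed

text \<open>\<open>y\<close> is the image of \<open>b\<close> under the projection onto the relations that belongs to \<open>S\<close>. It is
  a predicate rather than a function because circuits are only unique up to sign.\<close>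

definition fundamental :: "'i set \<Rightarrow> 'i \<Rightarrow> ('i \<Rightarrow> real) \<Rightarrow> bool" where
  "fundamental S b y \<longleftrightarrow> (if b \<in> S then y = (\<lambda>_. 0) else \<exists>c. circuit S b c \<and> y = (\<lambda>a. c a / c b))"

lemma fundamental_relation:
  assumes S: "basis S" and b: "b \<in> E" and y: "fundamental S b y"
  shows "y \<in> real_relations"
proof (cases "b \<in> S")
  case False
  then obtain c where c: "circuit S b c" "y = (\<lambda>a. c a / c b)"
    using y by (auto simp: fundamental_def)
  have SE: "S \<subseteq> E"
    using S by (auto simp: basis_def independent_def)
  have 1: "(\<Sum>b'\<in>E. y b' * real_of_int (\<phi> (g b') a)) = real_of_int (\<Sum>b'\<in>E. c b' * \<phi> (g b') a) / c b" for a
    by (simp add: c(2) sum_divide_distrib)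
  have 2: "(\<Sum>b'\<in>E. c b' * \<phi> (g b') a) = 0" if "a \<in> F" for a
    using circuit_relation(2) [OF c(1)] that by (simp add: L_eq_one_iff)
  have "(\<Sum>b'\<in>E. y b' * real_of_int (\<phi> (g b') a)) = 0" if "a \<in> F" for a
    by (simp only: 1 2 [OF that] of_int_0 div_0)
  moreover have "supported E y"
    using circuit_relation(1) [OF c(1)] SE b unfolding supported_def c(2) by auto
  ultimately show ?thesis
    by (simp add: real_relations_def)
qed (use y in \<open>auto simp: fundamental_def real_relations_def supported_def\<close>)

lemma fundamental_outside:
  assumes S: "basis S" and b: "b \<in> E" and y: "fundamental S b y" and a: "a \<notin> S"
  shows "y a = (if a = b then 1 else 0)"
proof (cases "b \<in> S")
  case False
  then obtain c where c: "circuit S b c" "y = (\<lambda>a. c a / c b)"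
    using y by (auto simp: fundamental_def)
  then show ?thesis
    using circuit_nonzero [OF S b False c(1)] circuit_relation(1) [OF c(1)] a by (auto simp: supported_def)
qed (use y a in \<open>auto simp: fundamental_def\<close>)

lemma real_relations_sum:
  assumes "\<And>i. i \<in> I \<Longrightarrow> y i \<in> real_relations"
  shows "(\<lambda>a. \<Sum>i\<in>I. k i * y i a) \<in> real_relations"
proof -
  have "(\<Sum>b\<in>E. (\<Sum>i\<in>I. k i * y i b) * real_of_int (\<phi> (g b) a)) = 0" if a: "a \<in> F" for a
  proof -
    have "(\<Sum>b\<in>E. (\<Sum>i\<in>I. k i * y i b) * real_of_int (\<phi> (g b) a))
        = (\<Sum>i\<in>I. k i * (\<Sum>b\<in>E. y i b * real_of_int (\<phi> (g b) a)))"
      unfolding sum_distrib_left sum_distrib_right by (subst sum.swap) (simp add: mult.assoc)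
    also have "\<dots> = 0"
      using assms a by (intro sum.neutral) (auto simp: real_relations_def)
    finally show ?thesis .
  qed
  then show ?thesis
    using assms by (auto simp: real_relations_def supported_def)
qed

text \<open>The difference of both sides is a real relation. Outside \<open>S\<close> it vanishes, since there \<open>y b\<close> is
  the indicator of \<open>b\<close>; so it is supported on an independent set.\<close>

lemma fundamental_projection:
  assumes S: "basis S" and y: "\<And>b. b \<in> E \<Longrightarrow> fundamental S b (y b)" and z: "z \<in> real_relations"
  shows "(\<Sum>b\<in>E. z b * y b a) = z a"
proof -
  define u where "u a = z a - (\<Sum>b\<in>E. z b * y b a)" for a
  have w: "(\<lambda>a. \<Sum>b\<in>E. z b * y b a) \<in> real_relations"
    by (rule real_relations_sum) (use fundamental_relation [OF S] y in blast)
  have "u \<in> real_relations"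
    using z w by (auto simp: real_relations_def supported_def u_def left_diff_distrib sum_subtractf)
  moreover have "supported S u"
  proof -
    have "u a = 0" if a: "a \<notin> S" for a
    proof -
      have "(\<Sum>b\<in>E. z b * y b a) = (\<Sum>b\<in>E. if b = a then z b else 0)"
        by (rule sum.cong) (use fundamental_outside [OF S _ y a] in auto)
      also have "\<dots> = z a"
        using z finE by (auto simp: real_relations_def supported_def)
      finally show ?thesis
        by (simp add: u_def)
    qed
    then show ?thesis
      by (simp add: supported_def)
  qed
  ultimately have "u = (\<lambda>_. 0)"
    using independent_real S unfolding basis_def by blast
  then show ?thesis
    by (metis u_def eq_iff_diff_eq_0)
qed

text \<open>The mean fixes all real relations, so orthogonality follows from the symmetry of
  \<open>r a * Q b a\<close>, where \<open>Q\<close> is the sum of the weighted projections. The symmetry comes from the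
  bijection that exchanges \<open>a\<close> for \<open>b\<close> in the bases that contribute.\<close>

lemma weighted_basis_projection:
  fixes r :: "'i \<Rightarrow> real" and \<tau> :: "'i set \<Rightarrow> 'i \<Rightarrow> 'i \<Rightarrow> real"
  defines "w \<equiv> \<lambda>S. (real (theta S))\<^sup>2 * (\<Prod>b\<in>S. inverse (r b))"
  defines "P \<equiv> \<lambda>x a. 1 / (\<Sum>S | basis S. w S) * (\<Sum>S | basis S. w S * (\<Sum>b\<in>E. x b * \<tau> S b a))"
  assumes r: "\<And>b. b \<in> E \<Longrightarrow> r b > 0"
    and \<tau>: "\<And>S b. basis S \<Longrightarrow> b \<in> E \<Longrightarrow> fundamental S b (\<tau> S b)"
  shows "P x \<in> real_relations"
    and "z \<in> real_relations \<Longrightarrow> (\<Sum>a\<in>E. r a * (x a - P x a) * z a) = 0"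
proof -
  let ?B = "{S. basis S}"
  define \<Delta> where "\<Delta> = (\<Sum>S\<in>?B. w S)"
  have BE: "S \<subseteq> E" "finite S" if "basis S" for S
    using that finE finite_subset unfolding basis_def independent_def by blast+
  have finB: "finite ?B"
    by (rule finite_subset [of _ "Pow E"]) (use finE BE in auto)
  have wpos: "w S > 0" if "basis S" for S
    unfolding w_def using theta_pos [of S] BE [OF that] r by (intro mult_pos_pos prod_pos) auto
  have \<Delta>: "\<Delta> > 0"
    unfolding \<Delta>_def using exists_basis finB wpos by (intro sum_pos) auto
  define Q where "Q b a = (\<Sum>S\<in>?B. w S * \<tau> S b a)" for b a
  have PQ: "P x a = (1 / \<Delta>) * (\<Sum>b\<in>E. x b * Q b a)" for x a
    unfolding P_def Q_def \<Delta>_def sum_distrib_left by (subst (2) sum.swap) (simp add: mult.left_commute)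
  have Q: "Q b \<in> real_relations" if "b \<in> E" for b
    unfolding Q_def by (rule real_relations_sum) (use fundamental_relation \<tau> that in auto)
  have "(\<lambda>a. \<Sum>b\<in>E. (1 / \<Delta> * x b) * Q b a) \<in> real_relations"
    by (rule real_relations_sum) (rule Q)
  then show "P x \<in> real_relations"
    unfolding PQ [abs_def] sum_distrib_left by (simp add: mult.assoc)
  have Q_fix: "(\<Sum>b\<in>E. z b * Q b a) = \<Delta> * z a" if z: "z \<in> real_relations" for z a
  proof -
    have "(\<Sum>b\<in>E. z b * Q b a) = (\<Sum>S\<in>?B. w S * (\<Sum>b\<in>E. z b * \<tau> S b a))"
      unfolding Q_def sum_distrib_left by (subst sum.swap) (simp add: mult.left_commute)
    also have "\<dots> = (\<Sum>S\<in>?B. w S * z a)"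
      by (rule sum.cong) (use fundamental_projection \<tau> z in auto)
    finally show ?thesis
      by (simp add: \<Delta>_def sum_distrib_right)
  qed
  have Q_sym: "r a * Q b a = r b * Q a b" if ab: "a \<in> E" "b \<in> E" for a b
  proof (cases "a = b")
    case False
    \<comment> \<open>The bases that contribute to \<open>Q v u\<close>.\<close>
    define A where "A u v = {S. basis S \<and> v \<notin> S \<and> u \<in> S \<and> \<tau> S v u \<noteq> 0}" for u v
    have Q_A: "Q v u = (\<Sum>S\<in>A u v. w S * \<tau> S v u)" if "v \<in> E" "u \<noteq> v" for u v
      unfolding Q_def
    proof (rule sum.mono_neutral_right)
      have "\<tau> S v u = 0" if "basis S" "v \<in> S \<or> u \<notin> S" for S
        using that \<tau> [OF that(1) \<open>v \<in> E\<close>] fundamental_outside [OF that(1) \<open>v \<in> E\<close> \<tau> [OF that(1) \<open>v \<in> E\<close>], of u] \<open>u \<noteq> v\<close>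
        by (auto simp: fundamental_def)
      then show "\<forall>S\<in>?B - A u v. w S * \<tau> S v u = 0"
        by (auto simp: A_def)
    qed (use finB in \<open>auto simp: A_def\<close>)
    have swap: "insert v (S - {u}) \<in> A v u \<and> r v * (w (insert v (S - {u})) * \<tau> (insert v (S - {u})) u v) = r u * (w S * \<tau> S v u)"
      if uv: "u \<in> E" "v \<in> E" "u \<noteq> v" and S: "S \<in> A u v" for u v S
    proof -
      let ?S = "insert v (S - {u})"
      have B: "basis S" and v: "v \<notin> S" and u: "u \<in> S" and nz: "\<tau> S v u \<noteq> 0"
        using S by (auto simp: A_def)
      obtain c where c: "circuit S v c" "\<tau> S v = (\<lambda>a. c a / c v)"
        using \<tau> [OF B uv(2)] v by (auto simp: fundamental_def)
      have cv: "c v \<noteq> 0" and cu: "c u \<noteq> 0"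
        using nz by (auto simp: c(2))
      note B' = basis_exchange [OF B uv(2) v c(1) u cu]
      have uS: "u \<notin> ?S"
        using uv by auto
      obtain c' where c': "circuit ?S u c'" "\<tau> ?S u = (\<lambda>a. c' a / c' u)"
        using \<tau> [OF B'(1) uv(1)] uS by (auto simp: fundamental_def)
      \<comment> \<open>The circuit underlying \<open>\<tau>\<close> at the exchanged basis is \<open>c\<close> up to a factor, which cancels.\<close>
      obtain k where k: "c = (\<lambda>a. k * c' a)"
        using circuit_multiple [OF c'(1) circuit_relation [OF B'(2)]] by blast
      have \<tau>': "\<tau> ?S u v = c v / c u"
        using cu by (simp add: c'(2) k)
      have "?S \<in> A v u"
        using B'(1) uS uv cv cu by (auto simp: A_def \<tau>')
      moreover have "r v * (w ?S * \<tau> ?S u v) = r u * (w S * \<tau> S v u)"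
      proof -
        let ?p = "\<Prod>b\<in>S - {u}. inverse (r b)"
        have fin: "finite S"
          using BE B by blast
        have pS: "(\<Prod>b\<in>S. inverse (r b)) = inverse (r u) * ?p"
          using fin u by (simp add: prod.remove)
        have pS': "(\<Prod>b\<in>?S. inverse (r b)) = inverse (r v) * ?p"
          using fin v by simp
        have rr: "r u > 0" "r v > 0"
          using r uv by auto
        have "(real (theta S) * \<bar>c u\<bar>)\<^sup>2 = (real (theta ?S) * \<bar>c v\<bar>)\<^sup>2"
          using theta_exchange [OF B uv(2) v c(1) u cu] by simp
        then have th: "(real (theta S))\<^sup>2 * (c u)\<^sup>2 = (real (theta ?S))\<^sup>2 * (c v)\<^sup>2"
          by (simp add: power_mult_distrib flip: of_int_power)
        have "r v * (w ?S * \<tau> ?S u v) = (real (theta ?S))\<^sup>2 * ?p * (c v / c u)"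
          using rr by (simp add: w_def pS' \<tau>')
        also have "\<dots> = (real (theta S))\<^sup>2 * ?p * (c u / c v)"
        proof -
          have "(real (theta ?S))\<^sup>2 * (c v / c u) = (real (theta S))\<^sup>2 * (c u / c v)"
            using th cu cv by (simp add: field_simps power2_eq_square)
          then have "?p * ((real (theta ?S))\<^sup>2 * (c v / c u)) = ?p * ((real (theta S))\<^sup>2 * (c u / c v))"
            by (rule arg_cong)
          then show ?thesis
            by (simp only: mult_ac)
        qed
        also have "\<dots> = r u * (w S * \<tau> S v u)"
          using rr by (simp add: w_def pS c(2))
        finally show ?thesis .
      qed
      ultimately show ?thesis by blast
    qed
    have "(\<Sum>S\<in>A a b. r a * (w S * \<tau> S b a)) = (\<Sum>S\<in>A b a. r b * (w S * \<tau> S a b))"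
      by (rule sum.reindex_bij_witness [where i = "\<lambda>S. insert a (S - {b})" and j = "\<lambda>S. insert b (S - {a})"])
        (use swap [of a b] swap [of b a] ab False in \<open>auto simp: A_def insert_absorb\<close>)
    then show ?thesis
      using Q_A ab False by (simp add: sum_distrib_left)
  qed simp
  show "(\<Sum>a\<in>E. r a * (x a - P x a) * z a) = 0" if z: "z \<in> real_relations"
  proof -
    have "(\<Sum>a\<in>E. r a * P x a * z a) = (1 / \<Delta>) * (\<Sum>a\<in>E. \<Sum>b\<in>E. x b * (r a * Q b a) * z a)"
      by (simp add: PQ sum_distrib_left sum_distrib_right mult_ac)
    also have "(\<Sum>a\<in>E. \<Sum>b\<in>E. x b * (r a * Q b a) * z a) = (\<Sum>a\<in>E. \<Sum>b\<in>E. x b * (r b * Q a b) * z a)"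
      by (intro sum.cong refl) (simp add: Q_sym)
    also have "\<dots> = (\<Sum>b\<in>E. r b * x b * (\<Sum>a\<in>E. z a * Q a b))"
      unfolding sum_distrib_left by (subst sum.swap) (simp add: mult_ac)
    also have "\<dots> = \<Delta> * (\<Sum>b\<in>E. r b * x b * z b)"
      by (simp add: Q_fix [OF z] sum_distrib_left mult_ac)
    finally have "(\<Sum>a\<in>E. r a * P x a * z a) = (\<Sum>b\<in>E. r b * x b * z b)"
      using \<Delta> by simp
    then show ?thesis
      by (simp add: left_diff_distrib right_diff_distrib sum_subtractf)
  qed
qed

end

section \<open>Disks and their radial deformation\<close>

definition rad :: "nat \<Rightarrow> (nat \<Rightarrow> real) \<Rightarrow> real" where
  "rad k x = sqrt (\<Sum>i<k. (x i)\<^sup>2)"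

lemma disk_eq_top_of_set: "disk k = top_of_set {x. (\<forall>i\<ge>k. x i = 0) \<and> (\<Sum>i<k. (x i)\<^sup>2) \<le> 1}"
  by (simp add: disk_def Euclidean_space_def subtopology_subtopology euclidean_product_topology Collect_conj_eq)

lemma topspace_disk: "topspace (disk k) = {x. (\<forall>i\<ge>k. x i = 0) \<and> rad k x \<le> 1}"
  by (auto simp: disk_eq_top_of_set rad_def)

lemma disk_interior_alt: "disk_interior k = {x. (\<forall>i\<ge>k. x i = 0) \<and> rad k x < 1}"
  by (auto simp: disk_interior_def topspace_Euclidean_space rad_def)

lemma disk_boundary_alt: "disk_boundary k = {x. (\<forall>i\<ge>k. x i = 0) \<and> rad k x = 1}"
  by (auto simp: disk_boundary_def topspace_Euclidean_space rad_def)

lemma topspace_disk_eq_Un: "topspace (disk k) = disk_interior k \<union> disk_boundary k"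
  by (auto simp: topspace_disk disk_interior_alt disk_boundary_alt)

lemma disk_interior_boundary_disjoint: "disk_interior k \<inter> disk_boundary k = {}"
  by (auto simp: disk_interior_alt disk_boundary_alt)

lemma rad_nonneg [simp]: "rad k x \<ge> 0"
  by (simp add: rad_def sum_nonneg)

lemma rad_cmult: "rad k (\<lambda>i. x i / c) = rad k x / \<bar>c\<bar>"
  by (simp add: rad_def power_divide real_sqrt_divide flip: sum_divide_distrib)

lemma continuous_on_rad [continuous_intros]: "continuous_on S (rad k)"
  unfolding rad_def by (intro continuous_intros continuous_on_product_coordinates [THEN continuous_on_subset]) auto

lemma continuous_map_rad: "continuous_map (disk k) euclideanreal (rad k)"
  by (simp add: disk_eq_top_of_set continuous_on_rad)

text \<open>The disk is a closed subset of a product of compact intervals and points.\<close>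

lemma compact_space_disk: "compact_space (disk k)"
proof -
  let ?D = "{x. (\<forall>i\<ge>k. x i = 0) \<and> (\<Sum>i<k. (x i)\<^sup>2) \<le> (1::real)}"
  let ?B = "\<Pi>\<^sub>E i\<in>UNIV. if i < k then {-1..1::real} else {0}"
  have "compactin (product_topology (\<lambda>i. euclideanreal) (UNIV::nat set)) ?B"
    unfolding compactin_PiE by (auto simp: compactin_euclidean_iff)
  then have B: "compact ?B"
    by (simp add: euclidean_product_topology flip: compactin_euclidean_iff)
  have eq: "?D = {x. (\<Sum>i<k. (x i)\<^sup>2) \<le> 1} \<inter> ?B"
  proof -
    have "x i \<in> {-1..1}" if "(\<Sum>i<k. (x i)\<^sup>2) \<le> 1" "i < k" for x :: "nat \<Rightarrow> real" and i
    proof -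
      have "(x i)\<^sup>2 \<le> (\<Sum>i<k. (x i)\<^sup>2)"
        using that by (intro member_le_sum) auto
      then have "(x i)\<^sup>2 \<le> 1" using that by linarith
      then show ?thesis by (simp add: abs_square_le_1 abs_le_iff)
    qed
    then show ?thesis by (fastforce simp: PiE_iff split: if_splits)
  qed
  have "closed {x :: nat \<Rightarrow> real. (\<Sum>i<k. (x i)\<^sup>2) \<le> 1}"
    by (intro closed_Collect_le continuous_intros continuous_on_product_coordinates)
  from closed_Int_compact [OF this B] have "compact ?D"
    unfolding eq .
  then show ?thesis
    unfolding disk_eq_top_of_set by (intro compact_space_subtopology) (simp add: compactin_euclidean_iff)
qed

lemma Hausdorff_space_disk: "Hausdorff_space (disk k)"
  by (simp add: disk_def Hausdorff_Euclidean_space Hausdorff_space_subtopology)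

text \<open>For \<open>t\<close> from \<open>0\<close> to \<open>1\<close> these maps deform the identity of the disk, keeping the boundary fixed,
  to a map that sends everything of radius at least \<open>1/2\<close> to the boundary. Dividing by a maximum
  keeps the maps defined and continuous at the centre.\<close>

definition stretch :: "nat \<Rightarrow> real \<Rightarrow> (nat \<Rightarrow> real) \<Rightarrow> nat \<Rightarrow> real" where
  "stretch k t x = (\<lambda>i. x i / max (1 - t / 2) (rad k x))"

lemma rad_stretch: "t \<le> 1 \<Longrightarrow> rad k (stretch k t x) = rad k x / max (1 - t / 2) (rad k x)"
  unfolding stretch_def by (subst rad_cmult) auto

lemma stretch_in_disk: "x \<in> topspace (disk k) \<Longrightarrow> t \<le> 1 \<Longrightarrow> stretch k t x \<in> topspace (disk k)"
  by (simp add: topspace_disk rad_stretch max_def field_simps) (auto simp: stretch_def)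

lemma stretch_boundary: "x \<in> disk_boundary k \<Longrightarrow> 0 \<le> t \<Longrightarrow> stretch k t x = x"
  by (auto simp: disk_boundary_alt stretch_def max_def)

lemma stretch_0: "x \<in> topspace (disk k) \<Longrightarrow> stretch k 0 x = x"
  by (auto simp: topspace_disk stretch_def max_def)

lemma stretch_1: "x \<in> topspace (disk k) \<Longrightarrow> 1/2 \<le> rad k x \<Longrightarrow> stretch k 1 x \<in> disk_boundary k"
  by (simp add: disk_boundary_alt topspace_disk rad_stretch max_def) (auto simp: stretch_def)

lemma rad_stretch_ge: "x \<in> topspace (disk k) \<Longrightarrow> 0 \<le> t \<Longrightarrow> t \<le> 1 \<Longrightarrow> rad k x \<le> rad k (stretch k t x)"
  by (auto simp: topspace_disk rad_stretch max_def field_simps mult_left_le)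

lemma continuous_map_stretch:
  "continuous_map (prod_topology (top_of_set {0..1}) (disk k)) (disk k) (\<lambda>(t, x). stretch k t x)"
proof -
  let ?D = "{x. (\<forall>i\<ge>k. x i = 0) \<and> (\<Sum>i<k. (x i)\<^sup>2) \<le> (1::real)}"
  have "continuous_on ({0..1::real} \<times> ?D) (\<lambda>p. snd p i / max (1 - fst p / 2) (rad k (snd p)))" for i
  proof -
    have "continuous_on ({0..1::real} \<times> ?D) (\<lambda>p. snd p i)"
      using continuous_on_compose2 [OF continuous_on_product_coordinates [of i] continuous_on_snd [OF continuous_on_id]] by auto
    moreover have "continuous_on ({0..1::real} \<times> ?D) (\<lambda>p. rad k (snd p))"
      using continuous_on_compose2 [OF continuous_on_rad [of UNIV k] continuous_on_snd [OF continuous_on_id]] by auto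
    ultimately show ?thesis
      by (intro continuous_intros) auto
  qed
  then have "continuous_on ({0..1::real} \<times> ?D) (\<lambda>p. stretch k (fst p) (snd p))"
    unfolding stretch_def by (rule continuous_on_coordinatewise_then_product)
  moreover have "prod_topology (top_of_set {0..1::real}) (disk k) = top_of_set ({0..1} \<times> ?D)"
    by (simp add: disk_eq_top_of_set flip: subtopology_Times)
  ultimately show ?thesis
    using stretch_in_disk [of _ k]
    by (simp add: case_prod_unfold) (auto simp: disk_eq_top_of_set continuous_map_in_subtopology)
qed

section \<open>Homology of a space relative to the complement of a cell\<close>

text \<open>\<open>X\<close> is obtained from the closed subspace \<open>Y\<close> by attaching one \<open>k\<close>-cell.\<close>

locale attached_cell =
  fixes X :: "'a topology" and Y :: "'a set" and k :: nat and \<Phi> :: "(nat \<Rightarrow> real) \<Rightarrow> 'a"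
  assumes Hausdorff: "Hausdorff_space X"
    and closed: "closedin X Y"
    and contin: "continuous_map (disk k) X \<Phi>"
    and embed: "embedding_map (subtopology (disk k) (disk_interior k)) X \<Phi>"
    and boundary: "\<Phi> ` disk_boundary k \<subseteq> Y"
    and interior: "\<Phi> ` disk_interior k = topspace X - Y"
begin

lemma inj_interior: "inj_on \<Phi> (disk_interior k)"
  using embed by (auto simp: embedding_map_def topspace_disk_eq_Un dest!: homeomorphic_imp_injective_map elim: inj_on_subset)

lemma Y_subset: "Y \<subseteq> topspace X"
  using closed closedin_subset by blast

definition cell_point :: "'a \<Rightarrow> nat \<Rightarrow> real" where
  "cell_point y = inv_into (disk_interior k) \<Phi> y"

lemma cell_point: "x \<in> disk_interior k \<Longrightarrow> cell_point (\<Phi> x) = x"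
  by (simp add: cell_point_def inj_interior)

text \<open>The deformation \<open>stretch\<close> of the disk, transported to \<open>X\<close> and extended by the identity on \<open>Y\<close>.\<close>

definition push :: "real \<times> 'a \<Rightarrow> 'a" where
  "push = (\<lambda>(t, y). if y \<in> topspace X - Y then \<Phi> (stretch k t (cell_point y)) else y)"

lemma push_cell:
  assumes "x \<in> topspace (disk k)" "0 \<le> t" "t \<le> 1"
  shows "push (t, \<Phi> x) = \<Phi> (stretch k t x)"
proof (cases "x \<in> disk_interior k")
  case True
  then have "\<Phi> x \<in> topspace X - Y"
    using interior by blast
  then show ?thesis
    using True by (simp add: push_def cell_point)
next
  case False
  then have "x \<in> disk_boundary k"
    using assms by (auto simp: topspace_disk_eq_Un)
  then show ?thesis
    using boundary assms by (auto simp: push_def stretch_boundary)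
qed

lemma push_Y: "y \<in> Y \<Longrightarrow> push (t, y) = y"
  by (simp add: push_def)

lemma topspace_eq: "topspace X = Y \<union> \<Phi> ` topspace (disk k)"
  using interior boundary Y_subset by (auto simp: topspace_disk_eq_Un)

lemma closedin_image: "closedin (disk k) S \<Longrightarrow> closedin X (\<Phi> ` S)"
  using continuous_imp_closed_map [OF contin compact_space_disk Hausdorff]
  by (simp add: closed_map_def)

text \<open>\<open>X\<close> is the union of the closed sets \<open>Y\<close> and the closed cell. On the closed cell, continuity can
  be checked after pulling back along the characteristic map times the interval, which is a
  quotient map because its source is compact and its target is Hausdorff.\<close>

lemma continuous_push:
  "continuous_map (prod_topology (top_of_set {0..1}) X) X push"
proof -
  let ?I = "top_of_set {0..1::real}"
  let ?K = "\<Phi> ` topspace (disk k)"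
  have K: "closedin X ?K"
    by (simp add: closedin_image)
  have cY: "continuous_map (subtopology (prod_topology ?I X) ({0..1} \<times> Y)) X push"
  proof (rule continuous_map_eq)
    show "continuous_map (subtopology (prod_topology ?I X) ({0..1} \<times> Y)) X snd"
      by (intro continuous_map_from_subtopology continuous_map_snd)
  qed (auto simp: push_Y)
  have cK: "continuous_map (subtopology (prod_topology ?I X) ({0..1} \<times> ?K)) X push"
  proof -
    let ?q = "\<lambda>(t, x). (t, \<Phi> x)"
    let ?P = "prod_topology ?I (disk k)"
    let ?Q = "prod_topology ?I (subtopology X ?K)"
    have Q: "subtopology (prod_topology ?I X) ({0..1} \<times> ?K) = ?Q"
      by (simp add: subtopology_Times subtopology_subtopology)
    have "compact_space ?P"
      by (auto simp: compact_space_prod_topology compact_space_disk intro!: compact_space_subtopology simp: compactin_euclidean_iff)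
    moreover have "Hausdorff_space ?Q"
      by (simp add: Hausdorff_space_prod_topology Hausdorff Hausdorff_space_subtopology)
    moreover have "continuous_map ?P ?I fst"
      by (rule continuous_map_fst)
    then have "continuous_map ?P ?Q ?q"
      using contin by (auto simp: case_prod_unfold continuous_map_pairwise o_def continuous_map_in_subtopology
          intro!: continuous_map_compose [OF continuous_map_snd, unfolded o_def])
    moreover have "?q ` topspace ?P = topspace ?Q"
      using contin continuous_map_image_subset_topspace by (fastforce simp: image_iff)
    ultimately have "quotient_map ?P ?Q ?q"
      using continuous_imp_quotient_map by blast
    moreover have "continuous_map ?P X (push \<circ> ?q)"
    proof (rule continuous_map_eq)
      show "continuous_map ?P X (\<Phi> \<circ> (\<lambda>(t, x). stretch k t x))"
        by (rule continuous_map_compose [OF continuous_map_stretch contin])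
    qed (auto simp: push_cell)
    ultimately have "continuous_map ?Q X push"
      by (rule continuous_compose_quotient_map)
    then show ?thesis
      by (simp add: Q)
  qed
  show ?thesis
  proof (rule pasting_lemma_closed [where I = "{Y, ?K}" and T = "\<lambda>S. {0..1} \<times> S" and f = "\<lambda>_. push"])
    show "closedin (prod_topology ?I X) ({0..1} \<times> S)" if "S \<in> {Y, ?K}" for S
      using that closed K by (auto simp: closedin_prod_Times_iff)
  qed (use cY cK topspace_eq in auto)
qed

text \<open>A neighbourhood of \<open>Y\<close> that deforms into \<open>Y\<close>, and in particular one that allows \<open>Y\<close> to be
  excised.\<close>

definition collar :: "'a set" where
  "collar = Y \<union> \<Phi> ` {x \<in> topspace (disk k). 1/2 \<le> rad k x}"

lemma Y_subset_collar: "Y \<subseteq> collar"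
  by (auto simp: collar_def)

text \<open>The final map of the deformation is a homotopy inverse of the inclusion of pairs.\<close>

lemma iso_collar:
  "hom_induced p X Y X collar id \<in> iso (relative_homology_group p X Y) (relative_homology_group p X collar)"
proof (rule homotopy_equivalence_relative_homology_group_isomorphism)
  let ?g = "\<lambda>y. push (1, y)"
  have push_collar: "push (t, y) \<in> collar" if ty: "y \<in> collar" "0 \<le> t" "t \<le> 1" for t y
  proof (cases "y \<in> Y")
    case True
    then show ?thesis by (simp add: collar_def push_Y)
  next
    case False
    then obtain x where x: "x \<in> topspace (disk k)" "1/2 \<le> rad k x" "y = \<Phi> x"
      using ty by (auto simp: collar_def)
    then have "rad k (stretch k t x) \<ge> 1/2"
      using rad_stretch_ge [of x k t] ty by linarith
    with x ty show ?thesis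
      by (auto simp: collar_def push_cell intro!: stretch_in_disk)
  qed
  have h: "homotopic_with P X X id ?g"
    if "\<And>t. t \<in> {0..1} \<Longrightarrow> P (\<lambda>y. push (t, y))" for P
    unfolding homotopic_with_def
  proof (intro exI conjI ballI allI)
    show "push (0, y) = id y" for y
    proof (cases "y \<in> topspace X - Y")
      case True
      then obtain x where "x \<in> disk_interior k" "y = \<Phi> x"
        using interior by blast
      then show ?thesis
        by (simp add: push_cell topspace_disk_eq_Un stretch_0)
    qed (auto simp: push_def)
  qed (use continuous_push that in auto)
  show "homotopic_with (\<lambda>h. h \<in> Y \<rightarrow> Y) X X (?g \<circ> id) id"
    using h [of "\<lambda>h. h \<in> Y \<rightarrow> Y"] by (simp add: homotopic_with_symD push_Y)
  show "homotopic_with (\<lambda>h. h \<in> collar \<rightarrow> collar) X X (id \<circ> ?g) id"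
    using h [of "\<lambda>h. h \<in> collar \<rightarrow> collar"] push_collar by (simp add: homotopic_with_symD)
  show "continuous_map X X ?g"
    using h [of "\<lambda>_. True"] homotopic_with_imp_continuous_maps by blast
  show "?g \<in> collar \<rightarrow> Y"
  proof
    fix y assume "y \<in> collar"
    then show "?g y \<in> Y"
      using boundary stretch_1 by (auto simp: collar_def push_Y push_cell)
  qed
qed (auto simp: collar_def)

text \<open>The complement of the cell of radius \<open>1/2\<close> is open, contains \<open>Y\<close> and lies in the collar.\<close>

lemma iso_excise:
  "hom_induced p (subtopology X (topspace X - Y)) (collar - Y) X collar id
     \<in> iso (relative_homology_group p (subtopology X (topspace X - Y)) (collar - Y)) (relative_homology_group p X collar)"
proof -
  let ?C = "\<Phi> ` {x \<in> topspace (disk k). rad k x \<le> 1/2}"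
  have "closedin (disk k) {x \<in> topspace (disk k). rad k x \<in> {..1/2}}"
    by (rule closedin_continuous_map_preimage [OF continuous_map_rad]) auto
  then have "closedin X ?C"
    using closedin_image by auto
  then have "openin X (topspace X - ?C)"
    by blast
  moreover have "topspace X - ?C \<subseteq> collar"
  proof
    fix y assume y: "y \<in> topspace X - ?C"
    show "y \<in> collar"
    proof (cases "y \<in> Y")
      case False
      then obtain x where x: "x \<in> topspace (disk k)" "y = \<Phi> x"
        using y topspace_eq by blast
      with y have "\<not> rad k x \<le> 1/2"
        by blast
      then have "1/2 \<le> rad k x"
        by linarith
      with x show ?thesis
        by (auto simp: collar_def)
    qed (simp add: collar_def)
  qed
  moreover have "Y \<subseteq> topspace X - ?C"
  proof -
    have "\<Phi> x \<notin> Y" if "x \<in> topspace (disk k)" "rad k x \<le> 1/2" for x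
    proof -
      have "x \<in> disk_interior k"
        using that by (auto simp: topspace_disk disk_interior_alt)
      then show ?thesis
        using interior by blast
    qed
    then show ?thesis using Y_subset by blast
  qed
  ultimately have "Y \<subseteq> X interior_of collar"
    by (meson interior_of_maximal order_trans)
  then have "X closure_of Y \<subseteq> X interior_of collar"
    by (simp add: closure_of_closedin closed)
  moreover have "collar \<subseteq> topspace X"
    using topspace_eq by (auto simp: collar_def)
  ultimately show ?thesis
    using homology_excision_axiom [of X Y collar "topspace X" p] by simp
qed

lemma homeomorphic_interior:
  "homeomorphic_map (subtopology (disk k) (disk_interior k)) (subtopology X (topspace X - Y)) \<Phi>"
  using embed interior by (simp add: embedding_map_def topspace_disk_eq_Un Int_absorb1)

end

lemma attached_cell_disk: "attached_cell (disk k) (disk_boundary k) k id"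
proof
  have "disk_boundary k = {x \<in> topspace (disk k). rad k x \<in> {1..}}"
    by (auto simp: topspace_disk disk_boundary_alt)
  moreover have "closedin (disk k) {x \<in> topspace (disk k). rad k x \<in> {1..}}"
    by (rule closedin_continuous_map_preimage [OF continuous_map_rad]) auto
  ultimately show "closedin (disk k) (disk_boundary k)"
    by simp
  show "id ` disk_interior k = topspace (disk k) - disk_boundary k"
    using disk_interior_boundary_disjoint by (auto simp: topspace_disk_eq_Un)
  show "embedding_map (subtopology (disk k) (disk_interior k)) (disk k) id"
    by (simp add: embedding_map_def) (metis subtopology_restrict)
qed (auto simp: Hausdorff_space_disk)

context attached_cell
begin

interpretation D: attached_cell "disk k" "disk_boundary k" k id
  by (rule attached_cell_disk)

text \<open>The disk relative to its boundary is itself a space with one attached cell. So its homology and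
  that of \<open>X\<close> relative to \<open>Y\<close> are both identified, compatibly with the characteristic map, with the
  homology of an open cell relative to its part in the collar, and on the open cells the
  characteristic map is a homeomorphism.\<close>

theorem iso_characteristic_map:
  "hom_induced p (disk k) (disk_boundary k) X Y \<Phi>
     \<in> iso (relative_homology_group p (disk k) (disk_boundary k)) (relative_homology_group p X Y)"
proof -
  let ?D = "disk k" and ?S = "disk_boundary k" and ?D' = "subtopology (disk k) (topspace (disk k) - disk_boundary k)"
  let ?X' = "subtopology X (topspace X - Y)"
  let ?h = "hom_induced p ?D ?S X Y \<Phi>" and ?hA = "hom_induced p ?D D.collar X collar \<Phi>"
  let ?h' = "hom_induced p ?D' (D.collar - ?S) ?X' (collar - Y) \<Phi>"
  let ?G = "\<lambda>X Y. relative_homology_group p X Y"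
  have Di: "topspace (disk k) - disk_boundary k = disk_interior k"
    using D.interior by simp
  have col: "\<Phi> ` (D.collar - ?S) = collar - Y"
  proof -
    have 1: "D.collar - ?S = {x \<in> disk_interior k. 1/2 \<le> rad k x}"
      using disk_interior_boundary_disjoint by (auto simp: D.collar_def topspace_disk_eq_Un)
    have "x \<in> disk_interior k" if "\<Phi> x \<notin> Y" "x \<in> topspace (disk k)" for x
      using that boundary by (auto simp: topspace_disk_eq_Un)
    then show ?thesis
      using interior unfolding 1 collar_def by (fastforce simp: topspace_disk_eq_Un)
  qed
  have colf: "\<Phi> \<in> D.collar \<rightarrow> collar"
    using boundary by (auto simp: collar_def D.collar_def)
  have h': "?h' \<in> iso (?G ?D' (D.collar - ?S)) (?G ?X' (collar - Y))"
  proof (rule homeomorphic_map_relative_homology_iso)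
    show "homeomorphic_map ?D' ?X' \<Phi>"
      using homeomorphic_interior by (simp add: Di)
    show "D.collar - disk_boundary k \<subseteq> topspace (subtopology (disk k) (topspace (disk k) - disk_boundary k))"
      by (auto simp: D.collar_def topspace_disk_eq_Un)
  qed (rule col)
  have c': "continuous_map ?D' ?X' \<Phi>"
    using homeomorphic_interior by (simp add: Di homeomorphic_imp_continuous_map)
  let ?e = "hom_induced p ?X' (collar - Y) X collar id" and ?eD = "hom_induced p ?D' (D.collar - ?S) ?D D.collar id"
  let ?c = "hom_induced p X Y X collar id" and ?cD = "hom_induced p ?D ?S ?D D.collar id"
  have sq1: "?hA \<circ> ?eD = ?e \<circ> ?h'"
  proof -
    have "?hA \<circ> ?eD = hom_induced p ?D' (D.collar - ?S) X collar (\<Phi> \<circ> id)"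
      by (rule hom_induced_compose [symmetric]) (use colf contin in \<open>auto simp: continuous_map_from_subtopology\<close>)
    also have "\<dots> = hom_induced p ?D' (D.collar - ?S) X collar (id \<circ> \<Phi>)"
      by simp
    also have "\<dots> = ?e \<circ> ?h'"
      by (rule hom_induced_compose) (use col c' in \<open>auto simp: continuous_map_from_subtopology\<close>)
    finally show ?thesis .
  qed
  have sq2: "?hA \<circ> ?cD = ?c \<circ> ?h"
  proof -
    have "?hA \<circ> ?cD = hom_induced p ?D ?S X collar (\<Phi> \<circ> id)"
      by (rule hom_induced_compose [symmetric]) (use colf contin D.Y_subset_collar in auto)
    also have "\<dots> = hom_induced p ?D ?S X collar (id \<circ> \<Phi>)"
      by simp
    also have "\<dots> = ?c \<circ> ?h"
      by (rule hom_induced_compose) (use contin boundary Y_subset_collar in auto)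
    finally show ?thesis .
  qed
  have bij: "bij_betw (hom_induced p A B C D f) (carrier (?G A B)) (carrier (?G C D))"
    if "hom_induced p A B C D f \<in> iso (?G A B) (?G C D)" for A :: "'x topology" and B and C :: "'y topology" and D f
    using that by (simp add: iso_def)
  have "bij_betw (?hA \<circ> ?eD) (carrier (?G ?D' (D.collar - ?S))) (carrier (?G X collar))"
    unfolding sq1 using bij_betw_trans [OF bij [OF h'] bij [OF iso_excise]] .
  then have "bij_betw ?hA (carrier (?G ?D D.collar)) (carrier (?G X collar))"
    using bij_betw_comp_iff [OF bij [OF D.iso_excise]] by blast
  then have "bij_betw (?c \<circ> ?h) (carrier (?G ?D ?S)) (carrier (?G X collar))"
    unfolding sq2 [symmetric] using bij_betw_trans [OF bij [OF D.iso_collar]] by blast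
  then have "bij_betw ?h (carrier (?G ?D ?S)) (carrier (?G X Y))"
    using bij_betw_comp_iff2 [OF bij [OF iso_collar]] hom_induced_carrier by (metis image_subsetI)
  then show ?thesis
    by (simp add: iso_def hom_induced_hom)
qed

end

section \<open>The fundamental class of a disk\<close>

lemma contractible_space_disk: "contractible_space (disk k)"
proof -
  let ?D = "{x. (\<forall>i\<ge>k. x i = 0) \<and> (\<Sum>i<k. (x i)\<^sup>2) \<le> (1::real)}"
  let ?h = "\<lambda>(t::real, x::nat \<Rightarrow> real) i. (1 - t) * x i"
  have "continuous_on ({0..1::real} \<times> ?D) (\<lambda>p. (1 - fst p) * snd p i)" for i
  proof -
    have "continuous_on ({0..1::real} \<times> ?D) (\<lambda>p. snd p i)"
      using continuous_on_compose2 [OF continuous_on_product_coordinates [of i] continuous_on_snd [OF continuous_on_id]] by auto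
    then show ?thesis
      by (intro continuous_intros) auto
  qed
  then have "continuous_on ({0..1::real} \<times> ?D) ?h"
    unfolding case_prod_unfold by (rule continuous_on_coordinatewise_then_product)
  moreover have "prod_topology (top_of_set {0..1::real}) (disk k) = top_of_set ({0..1} \<times> ?D)"
    by (simp add: disk_eq_top_of_set flip: subtopology_Times)
  moreover have "?h (t, x) \<in> ?D" if "0 \<le> t" "t \<le> 1" "x \<in> ?D" for t x
  proof -
    have "(\<Sum>i<k. ((1 - t) * x i)\<^sup>2) \<le> (\<Sum>i<k. (x i)\<^sup>2)"
    proof (rule sum_mono)
      fix i
      have "(1 - t)\<^sup>2 \<le> 1"
        using that by (simp add: power_le_one)
      then show "((1 - t) * x i)\<^sup>2 \<le> (x i)\<^sup>2"
        by (simp add: power_mult_distrib mult_left_le_one_le)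
    qed
    then show ?thesis
      using that by auto
  qed
  ultimately have "continuous_map (prod_topology (top_of_set {0..1}) (disk k)) (disk k) ?h"
    by (auto simp: disk_eq_top_of_set continuous_map_in_subtopology)
  then have "homotopic_with (\<lambda>_. True) (disk k) (disk k) id (\<lambda>x i. 0)"
    unfolding homotopic_with_def by (intro exI [of _ ?h]) auto
  then show ?thesis
    unfolding contractible_space_def by blast
qed

text \<open>For positive \<open>k\<close> the disk is contractible, so the boundary map identifies its relative homology
  with the reduced homology of the sphere of dimension \<open>k - 1\<close>.\<close>

lemma disk_homology_infinite_cyclic: "relative_homology_group (int k) (disk k) (disk_boundary k) \<cong> integer_group"
proof (cases k)
  case 0
  have "topspace (disk 0) = {\<lambda>_. 0}"
    by (auto simp: disk_eq_top_of_set)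
  moreover have "disk_boundary 0 = {}"
    by (simp add: disk_boundary_def)
  ultimately show ?thesis
    using homology_coefficients 0 by auto
next
  case (Suc n)
  have sphere: "subtopology (disk k) (disk_boundary k) = nsphere n"
  proof -
    have "{x. (\<Sum>i<k. (x i)\<^sup>2) \<le> 1} \<inter> disk_boundary k = topspace (Euclidean_space (Suc n)) \<inter> {x. (\<Sum>i\<le>n. (x i)\<^sup>2) = 1}"
      by (auto simp: disk_boundary_def Suc lessThan_Suc_atMost)
    then show ?thesis
      by (simp add: disk_def nsphere_def Suc subtopology_subtopology) (metis subtopology_restrict)
  qed
  have "topspace (disk k) \<inter> disk_boundary k \<noteq> {}"
    using nonempty_nsphere [of n] unfolding sphere [symmetric] by (simp flip: null_topspace_iff_trivial)
  then have "relative_homology_group (int k) (disk k) (disk_boundary k) \<cong> reduced_homology_group (int k - 1) (nsphere n)"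
    using isomorphic_group_relative_homology_of_contractible [OF contractible_space_disk] by (metis sphere)
  also have "\<dots> \<cong> integer_group"
    using reduced_homology_group_nsphere(1) [of n] by (simp add: Suc)
  finally show ?thesis .
qed

text \<open>In an infinite cyclic group a generator has infinite order.\<close>

lemma infinite_cyclic_unique_power:
  assumes "G \<cong> integer_group" "is_generator G g" "group G" "x \<in> carrier G"
  shows "\<exists>!n::int. x = g [^]\<^bsub>G\<^esub> n"
proof -
  interpret group G by fact
  have g: "g \<in> carrier G" and ran: "carrier G = range (\<lambda>n :: int. g [^]\<^bsub>G\<^esub> n)"
    using assms by (auto simp: is_generator_def)
  have "infinite (carrier G)"
    using iso_finite [OF assms(1)] by simp
  moreover have "subgroup_generated G {g} = G"
    using ran g by (metis carrier_subgroup_generated_by_singleton subgroup_generated_group_carrier subgroup_generated_def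
       subgroup_generated2 carrier_subgroup_generated)
  ultimately have "ord g = 0"
    using g infinite_cyclic_subgroup_order by metis
  then have "g [^]\<^bsub>G\<^esub> n = g [^]\<^bsub>G\<^esub> m \<longleftrightarrow> n = m" for n m :: int
    using g by (auto simp: int_pow_eq)
  then show ?thesis
    using assms(4) unfolding ran by auto
qed

lemma isomorphic_integer_group_generator:
  assumes "G \<cong> integer_group" "group G"
  obtains g where "is_generator G g"
proof -
  interpret group G by fact
  have "cyclic_group G"
    using isomorphic_group_cyclicity [OF assms(1)] assms(2) by auto
  then show ?thesis
    using that unfolding cyclic_group is_generator_def by blast
qed

lemma disk_class_generator:
  "is_generator (relative_homology_group (int k) (disk k) (disk_boundary k)) (disk_class k)"
  using isomorphic_integer_group_generator [OF disk_homology_infinite_cyclic]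
  unfolding disk_class_def by (metis group_relative_homology_group someI_ex)

lemma disk_class_carrier [simp]:
  "disk_class k \<in> carrier (relative_homology_group (int k) (disk k) (disk_boundary k))"
  using disk_class_generator [of k] unfolding is_generator_def by blast

lemma disk_class_unique:
  assumes "x \<in> carrier (relative_homology_group (int k) (disk k) (disk_boundary k))"
  shows "\<exists>!n::int. x = disk_class k [^]\<^bsub>relative_homology_group (int k) (disk k) (disk_boundary k)\<^esub> n"
  using infinite_cyclic_unique_power [OF disk_homology_infinite_cyclic disk_class_generator _ assms] by simp

section \<open>Homology of finitely many attached cells\<close>

text \<open>\<open>X\<close> is obtained from the closed subspace \<open>Y\<close> by attaching finitely many cells of the same
  dimension \<open>k\<close>.\<close>

locale attached_cells =
  fixes X :: "'a topology" and Y :: "'a set" and k :: nat and I :: "'i set"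
    and \<Phi> :: "'i \<Rightarrow> (nat \<Rightarrow> real) \<Rightarrow> 'a"
  assumes Hausdorff: "Hausdorff_space X"
    and closed: "closedin X Y"
    and finite: "finite I"
    and contin: "b \<in> I \<Longrightarrow> continuous_map (disk k) X (\<Phi> b)"
    and embed: "b \<in> I \<Longrightarrow> embedding_map (subtopology (disk k) (disk_interior k)) X (\<Phi> b)"
    and boundary: "b \<in> I \<Longrightarrow> \<Phi> b ` disk_boundary k \<subseteq> Y"
    and disjoint: "disjoint_family_on (\<lambda>b. \<Phi> b ` disk_interior k) I"
    and disjoint_Y: "b \<in> I \<Longrightarrow> \<Phi> b ` disk_interior k \<inter> Y = {}"
    and cover: "topspace X = Y \<union> (\<Union>b\<in>I. \<Phi> b ` disk_interior k)"
begin

abbreviation cell :: "'i \<Rightarrow> 'a set" where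
  "cell b \<equiv> \<Phi> b ` disk_interior k"

definition attached_class :: "'i \<Rightarrow> 'a chain set" where
  "attached_class b = hom_induced (int k) (disk k) (disk_boundary k) X Y (\<Phi> b) (disk_class k)"

lemma closedin_minus_cell:
  assumes "b \<in> I"
  shows "closedin X (topspace X - cell b)"
proof -
  have image: "\<Phi> b' ` topspace (disk k) \<subseteq> topspace X" if "b' \<in> I" for b'
    using contin [OF that] continuous_map_image_subset_topspace by blast
  have eq: "topspace X - cell b = Y \<union> (\<Union>b'\<in>I - {b}. \<Phi> b' ` topspace (disk k))" (is "?L = ?R")
  proof
    show "?L \<subseteq> ?R"
      using cover by (auto simp: topspace_disk_eq_Un)
    have "\<Phi> b' ` topspace (disk k) \<subseteq> ?L" if "b' \<in> I" "b' \<noteq> b" for b'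
    proof -
      have "cell b' \<inter> cell b = {}"
        using disjoint that assms by (auto simp: disjoint_family_on_def)
      then show ?thesis
        using image [OF that(1)] boundary [OF that(1)] disjoint_Y [OF assms]
        unfolding topspace_disk_eq_Un by blast
    qed
    moreover have "Y \<subseteq> ?L"
      using disjoint_Y [OF assms] cover by blast
    ultimately show "?R \<subseteq> ?L"
      by blast
  qed
  have "closedin X (\<Phi> b' ` topspace (disk k))" if "b' \<in> I" for b'
    using continuous_imp_closed_map [OF contin [OF that] compact_space_disk Hausdorff] by (simp add: closed_map_def)
  then show ?thesis
    unfolding eq using closed finite by (intro closedin_Un closedin_Union) auto
qed

lemma attached_cell:
  assumes "b \<in> I"
  shows "attached_cell X (topspace X - cell b) k (\<Phi> b)"
proof
  show "\<Phi> b ` disk_boundary k \<subseteq> topspace X - cell b"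
    using boundary [OF assms] disjoint_Y [OF assms] cover by blast
  show "cell b = topspace X - (topspace X - cell b)"
    using cover assms by blast
qed (use assms Hausdorff closedin_minus_cell contin embed in auto)

lemma attached_cells_remove:
  assumes "b \<in> I"
  shows "attached_cells (subtopology X (topspace X - cell b)) Y k (I - {b}) \<Phi>"
proof
  let ?U = "topspace X - cell b"
  have U: "\<Phi> b' ` topspace (disk k) \<subseteq> ?U" "cell b' \<subseteq> ?U" if "b' \<in> I - {b}" for b'
  proof -
    have "cell b' \<inter> cell b = {}"
      using disjoint that assms by (auto simp: disjoint_family_on_def)
    moreover have "\<Phi> b' ` topspace (disk k) \<subseteq> topspace X"
      using contin [of b'] that continuous_map_image_subset_topspace by blast
    ultimately show "\<Phi> b' ` topspace (disk k) \<subseteq> ?U"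
      using that boundary [of b'] disjoint_Y [OF assms] unfolding topspace_disk_eq_Un by blast
    then show "cell b' \<subseteq> ?U"
      unfolding topspace_disk_eq_Un by blast
  qed
  have YU: "Y \<subseteq> ?U"
    using disjoint_Y [OF assms] cover by blast
  then show "closedin (subtopology X ?U) Y"
    using closed closedin_subset_topspace by blast
  show "continuous_map (disk k) (subtopology X ?U) (\<Phi> b')" if "b' \<in> I - {b}" for b'
    using contin [of b'] U [OF that] that by (auto simp: continuous_map_in_subtopology)
  show "embedding_map (subtopology (disk k) (disk_interior k)) (subtopology X ?U) (\<Phi> b')" if "b' \<in> I - {b}" for b'
    using embed [of b'] U [OF that] that by (auto simp: embedding_map_in_subtopology)
  show "topspace (subtopology X ?U) = Y \<union> (\<Union>b'\<in>I - {b}. cell b')"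
  proof -
    have "?U \<subseteq> Y \<union> (\<Union>b'\<in>I - {b}. cell b')"
      using cover by blast
    moreover have "Y \<union> (\<Union>b'\<in>I - {b}. cell b') \<subseteq> ?U"
      using YU U(2) by blast
    ultimately have "?U = Y \<union> (\<Union>b'\<in>I - {b}. cell b')"
      by (rule equalityI)
    then show ?thesis
      by auto
  qed
  show "disjoint_family_on (\<lambda>b. cell b) (I - {b})"
    using disjoint by (auto simp: disjoint_family_on_def)
qed (use Hausdorff finite boundary disjoint_Y in \<open>auto intro: Hausdorff_space_subtopology\<close>)

lemma attached_class_carrier [simp]: "attached_class b \<in> carrier (relative_homology_group (int k) X Y)"
  by (simp add: attached_class_def hom_induced_carrier)

lemma hom_induced_minus_cell:
  assumes "b \<in> I" "b' \<in> I"
  shows "hom_induced (int k) X Y X (topspace X - cell b) id (attached_class b') =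
    hom_induced (int k) (disk k) (disk_boundary k) X (topspace X - cell b) (\<Phi> b') (disk_class k)"
proof -
  have "Y \<subseteq> topspace X - cell b"
    using disjoint_Y [OF assms(1)] cover by blast
  then show ?thesis
    using contin [OF assms(2)] boundary [OF assms(2)] unfolding attached_class_def
    by (subst hom_induced_compose') (auto simp: subset_iff)
qed

text \<open>The closed cell \<open>b'\<close> is contained in the complement of the open cell \<open>b\<close>, and the homology of
  that complement relative to itself is trivial.\<close>

lemma hom_induced_minus_other_cell:
  assumes "b \<in> I" "b' \<in> I" "b' \<noteq> b"
  shows "hom_induced (int k) X Y X (topspace X - cell b) id (attached_class b')
     = \<one>\<^bsub>relative_homology_group (int k) X (topspace X - cell b)\<^esub>"
proof -
  let ?U = "topspace X - cell b"
  interpret R: attached_cells "subtopology X ?U" Y k "I - {b}" \<Phi>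
    by (rule attached_cells_remove) fact
  let ?G = "relative_homology_group (int k) (subtopology X ?U) ?U"
  let ?x = "hom_induced (int k) (disk k) (disk_boundary k) (subtopology X ?U) ?U (\<Phi> b') (disk_class k)"
  have "\<Phi> b' \<in> disk_boundary k \<rightarrow> ?U"
    using boundary [OF assms(2)] disjoint_Y [OF assms(1)] cover by blast
  then have "hom_induced (int k) (disk k) (disk_boundary k) X ?U (\<Phi> b') (disk_class k) =
      hom_induced (int k) (subtopology X ?U) ?U X ?U id ?x"
    using R.contin [of b'] assms
    by (subst hom_induced_compose') (auto simp: continuous_map_from_subtopology)
  moreover have "trivial_group ?G"
    using trivial_relative_homology_group_topspace [of "int k" "subtopology X ?U"] by (simp add: Int_absorb1)
  then have "?x = \<one>\<^bsub>?G\<^esub>"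
    using hom_induced_carrier unfolding trivial_group_def by (metis singletonD)
  moreover have "hom_induced (int k) (subtopology X ?U) ?U X ?U id \<one>\<^bsub>?G\<^esub> = \<one>\<^bsub>relative_homology_group (int k) X ?U\<^esub>"
    by (intro hom_one hom_induced_hom) auto
  ultimately show ?thesis
    using hom_induced_minus_cell assms by simp
qed

lemma lincomb_minus_cell:
  assumes "b \<in> I"
  shows "hom_induced (int k) X Y X (topspace X - cell b) id (lincomb (relative_homology_group (int k) X Y) attached_class I n)
     = hom_induced (int k) (disk k) (disk_boundary k) X (topspace X - cell b) (\<Phi> b)
         (disk_class k [^]\<^bsub>relative_homology_group (int k) (disk k) (disk_boundary k)\<^esub> n b)"
proof -
  let ?U = "topspace X - cell b"
  let ?p = "hom_induced (int k) X Y X ?U id" and ?G = "relative_homology_group (int k) X Y"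
    and ?H = "relative_homology_group (int k) X ?U" and ?D = "relative_homology_group (int k) (disk k) (disk_boundary k)"
  let ?\<phi> = "hom_induced (int k) (disk k) (disk_boundary k) X ?U (\<Phi> b)"
  interpret H: comm_group ?H by simp
  have p: "?p \<in> hom ?G ?H" and phi: "?\<phi> \<in> hom ?D ?H"
    by (auto simp: hom_induced_hom)
  have "?p (lincomb ?G attached_class I n) = lincomb ?H (\<lambda>b'. ?p (attached_class b')) I n"
    by (rule hom_lincomb [OF _ _ p finite]) auto
  also have "\<dots> = lincomb ?H (\<lambda>b'. ?p (attached_class b')) I (\<lambda>b'. if b' = b then n b else 0)"
    unfolding lincomb_def
    by (rule H.finprod_cong') (auto simp: hom_induced_minus_other_cell [OF assms] hom_induced_carrier simp del: one_relative_homology_group)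
  also have "\<dots> = ?p (attached_class b) [^]\<^bsub>?H\<^esub> n b"
    by (rule H.lincomb_single) (use assms finite hom_induced_carrier in auto)
  also have "\<dots> = ?\<phi> (disk_class k) [^]\<^bsub>?H\<^esub> n b"
    by (simp add: hom_induced_minus_cell assms)
  also have "\<dots> = ?\<phi> (disk_class k [^]\<^bsub>?D\<^esub> n b)"
    by (rule hom_int_pow [OF phi, symmetric]) auto
  finally show ?thesis .
qed

lemma lincomb_attached_class_inj:
  assumes "lincomb (relative_homology_group (int k) X Y) attached_class I n
         = lincomb (relative_homology_group (int k) X Y) attached_class I m"
    and b: "b \<in> I"
  shows "n b = m b"
proof -
  let ?U = "topspace X - cell b"
  let ?D = "relative_homology_group (int k) (disk k) (disk_boundary k)"
  let ?\<phi> = "hom_induced (int k) (disk k) (disk_boundary k) X ?U (\<Phi> b)"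
  interpret D: group ?D by simp
  interpret C: attached_cell X ?U k "\<Phi> b"
    by (rule attached_cell) fact
  have g: "disk_class k \<in> carrier ?D"
    using disk_class_generator [of k] unfolding is_generator_def by blast
  have "inj_on ?\<phi> (carrier ?D)"
    using C.iso_characteristic_map by (simp add: iso_def bij_betw_def)
  moreover have "?\<phi> (disk_class k [^]\<^bsub>?D\<^esub> n b) = ?\<phi> (disk_class k [^]\<^bsub>?D\<^esub> m b)"
    using lincomb_minus_cell [OF b] assms(1) by metis
  ultimately have "disk_class k [^]\<^bsub>?D\<^esub> n b = disk_class k [^]\<^bsub>?D\<^esub> m b"
    using g by (simp add: inj_on_eq_iff)
  then show ?thesis
    using disk_class_unique [of "disk_class k [^]\<^bsub>?D\<^esub> n b" k] g by auto
qed

end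

text \<open>Induction on the number of cells. Subtracting a suitable multiple of the class of \<open>b\<close> from \<open>x\<close>
  makes the projection to the homology relative to the complement of \<open>b\<close> vanish; by the exact
  sequence of the triple the difference then comes from the space without the cell \<open>b\<close>.\<close>

lemma attached_class_span:
  assumes "attached_cells X Y k I \<Phi>" "x \<in> carrier (relative_homology_group (int k) X Y)"
  shows "\<exists>n. x = lincomb (relative_homology_group (int k) X Y) (attached_cells.attached_class X Y k \<Phi>) I n"
  using assms
proof (induction "card I" arbitrary: X I x)
  case 0
  interpret attached_cells X Y k I \<Phi> by fact
  have "I = {}"
    using 0 finite by simp
  then have "trivial_group (relative_homology_group (int k) X Y)"
    using cover trivial_relative_homology_group_topspace [of "int k" X] by simp
  then have "x = \<one>\<^bsub>relative_homology_group (int k) X Y\<^esub>"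
    using 0 unfolding trivial_group_def by blast
  moreover interpret G: comm_group "relative_homology_group (int k) X Y" by simp
  have "lincomb (relative_homology_group (int k) X Y) attached_class I (\<lambda>_. 0) = \<one>\<^bsub>relative_homology_group (int k) X Y\<^esub>"
    by (rule G.lincomb_zero)
  ultimately show ?case
    by metis
next
  case (Suc c)
  interpret attached_cells X Y k I \<Phi> by fact
  obtain b where b: "b \<in> I"
    using Suc(2) by fastforce
  define U where "U = topspace X - cell b"
  define G where "G = relative_homology_group (int k) X Y"
  let ?p = "hom_induced (int k) X Y X U id" and ?i = "hom_induced (int k) (subtopology X U) Y X Y id"
    and ?H = "relative_homology_group (int k) X U" and ?D = "relative_homology_group (int k) (disk k) (disk_boundary k)"
    and ?L = "relative_homology_group (int k) (subtopology X U) Y"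
  interpret R: attached_cells "subtopology X U" Y k "I - {b}" \<Phi>
    unfolding U_def by (rule attached_cells_remove) fact
  interpret C: attached_cell X U k "\<Phi> b"
    unfolding U_def by (rule attached_cell) fact
  interpret G: comm_group G by (simp add: G_def)
  have x: "x \<in> carrier G" and cls: "attached_class a \<in> carrier G" for a
    using Suc by (auto simp: G_def)
  have YU: "Y \<subseteq> U"
    using disjoint_Y [OF b] cover by (auto simp: U_def)
  have "hom_induced (int k) (disk k) (disk_boundary k) X U (\<Phi> b) ` carrier ?D = carrier ?H"
    using C.iso_characteristic_map [of "int k"] unfolding iso_def bij_betw_def by simp
  moreover have "?p x \<in> carrier ?H"
    by (rule hom_induced_carrier)
  ultimately have "?p x \<in> hom_induced (int k) (disk k) (disk_boundary k) X U (\<Phi> b) ` carrier ?D"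
    by simp
  then obtain u where u: "?p x = hom_induced (int k) (disk k) (disk_boundary k) X U (\<Phi> b) u" "u \<in> carrier ?D"
    by (rule imageE)
  have "\<exists>m::int. u = disk_class k [^]\<^bsub>?D\<^esub> m"
    by (rule ex1_implies_ex [OF disk_class_unique [OF u(2)]])
  then obtain m :: int where m: "u = disk_class k [^]\<^bsub>?D\<^esub> m"
    by (rule exE)
  \<comment> \<open>The multiple of the class of \<open>b\<close> with the same projection as \<open>x\<close>.\<close>
  define l where "l = lincomb G attached_class I (\<lambda>a. if a = b then m else 0)"
  have l: "l \<in> carrier G"
    using cls by (simp add: l_def)
  have "?p l = ?p x"
    unfolding l_def U_def G_def lincomb_minus_cell [OF b] using u(1) m unfolding U_def by simp
  moreover have hom: "group_hom G ?H ?p"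
    by (simp add: group_hom_def group_hom_axioms_def G_def hom_induced_hom)
  ultimately have "?p (x \<otimes>\<^bsub>G\<^esub> inv\<^bsub>G\<^esub> l) = \<one>\<^bsub>?H\<^esub>"
    using x l by (simp add: group_hom.hom_mult group_hom.hom_inv group.r_inv group_hom.hom_closed)
  then have "x \<otimes>\<^bsub>G\<^esub> inv\<^bsub>G\<^esub> l \<in> kernel G ?H ?p"
    using x l by (simp add: kernel_def)
  then have "x \<otimes>\<^bsub>G\<^esub> inv\<^bsub>G\<^esub> l \<in> ?i ` carrier ?L"
    using homology_exactness_triple_3 [OF YU, of "int k" X] by (simp add: G_def)
  then obtain v where v: "v \<in> carrier ?L" "x \<otimes>\<^bsub>G\<^esub> inv\<^bsub>G\<^esub> l = ?i v"
    by blast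
  have "c = card (I - {b})"
    using Suc.hyps(2) b finite by simp
  from Suc.hyps(1) [OF this R.attached_cells_axioms v(1)]
  obtain n where n: "v = lincomb ?L R.attached_class (I - {b}) n"
    by (rule exE)
  have "?i v = lincomb G (\<lambda>a. ?i (R.attached_class a)) (I - {b}) n"
    unfolding n by (rule hom_lincomb) (use finite in \<open>auto simp: G_def hom_induced_hom\<close>)
  also have "\<dots> = lincomb G attached_class (I - {b}) n"
  proof (rule G.lincomb_cong_gens)
    show "?i (R.attached_class a) = attached_class a" if "a \<in> I - {b}" for a
      unfolding attached_class_def R.attached_class_def
      using R.contin [OF that] R.boundary [OF that]
      by (subst hom_induced_compose') (auto simp: continuous_map_from_subtopology)
  qed (use cls in auto)
  also have "\<dots> = lincomb G attached_class (I - {b}) (\<lambda>a. if a = b then 0 else n a)"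
    by (rule G.lincomb_cong) (use cls in auto)
  also have "\<dots> = lincomb G attached_class I (\<lambda>a. if a = b then 0 else n a)"
    by (rule G.lincomb_restrict [symmetric]) (use cls finite in auto)
  finally have w: "x \<otimes>\<^bsub>G\<^esub> inv\<^bsub>G\<^esub> l = lincomb G attached_class I (\<lambda>a. if a = b then 0 else n a)"
    unfolding v(2) .
  have "(x \<otimes>\<^bsub>G\<^esub> inv\<^bsub>G\<^esub> l) \<otimes>\<^bsub>G\<^esub> l = x"
    using x l by (simp add: G.m_assoc)
  then have "lincomb G attached_class I (\<lambda>a. if a = b then 0 else n a) \<otimes>\<^bsub>G\<^esub> l = x"
    by (simp only: w)
  moreover have "lincomb G attached_class I (\<lambda>a. (if a = b then 0 else n a) + (if a = b then m else 0))
      = lincomb G attached_class I (\<lambda>a. if a = b then 0 else n a) \<otimes>\<^bsub>G\<^esub> l"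
    unfolding l_def by (rule G.lincomb_add) (use cls in auto)
  ultimately have "x = lincomb G attached_class I (\<lambda>a. (if a = b then 0 else n a) + (if a = b then m else 0))"
    by simp
  then show ?case
    unfolding G_def by blast
qed

theorem (in attached_cells) attached_class_basis:
  assumes "x \<in> carrier (relative_homology_group (int k) X Y)"
  shows "\<exists>!n. (\<forall>b. b \<notin> I \<longrightarrow> n b = 0) \<and> x = lincomb (relative_homology_group (int k) X Y) attached_class I n"
proof -
  interpret G: comm_group "relative_homology_group (int k) X Y" by simp
  obtain n where "x = lincomb (relative_homology_group (int k) X Y) attached_class I n"
    using attached_class_span [OF attached_cells_axioms assms] by blast
  then have "x = lincomb (relative_homology_group (int k) X Y) attached_class I (\<lambda>b. if b \<in> I then n b else 0)"
    by (simp add: G.lincomb_cong [of attached_class I n "\<lambda>b. if b \<in> I then n b else 0"])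
  then show ?thesis
  proof (intro ex1I conjI)
    fix m assume m: "(\<forall>b. b \<notin> I \<longrightarrow> m b = 0) \<and> x = lincomb (relative_homology_group (int k) X Y) attached_class I m"
    then show "m = (\<lambda>b. if b \<in> I then n b else 0)"
      using lincomb_attached_class_inj [of m n] \<open>x = lincomb _ _ _ n\<close> by auto
  qed auto
qed

section \<open>Skeleta and cellular chains of a finite CW complex\<close>

locale finite_cw =
  fixes X :: "('a, 'i) cw"
  assumes complex: "finite_cw_complex X"
begin

lemma Hausdorff: "Hausdorff_space (cw_space X)"
  and finite_cells: "finite (cells X)"
  and disjoint_cells: "disjoint_family_on (open_cell X) (cells X)"
  and cells_cover: "(\<Union>b \<in> cells X. open_cell X b) = topspace (cw_space X)"
  using complex by (auto simp: finite_cw_complex_def)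

lemma char_map:
  assumes "b \<in> cells X"
  shows "continuous_map (disk (cell_dim X b)) (cw_space X) (char_map X b)"
    and "embedding_map (subtopology (disk (cell_dim X b)) (disk_interior (cell_dim X b))) (cw_space X) (char_map X b)"
    and "char_map X b ` disk_boundary (cell_dim X b) \<subseteq> skeleton X (int (cell_dim X b) - 1)"
  using complex assms by (auto simp: finite_cw_complex_def)

lemma skeleton_mono: "k \<le> l \<Longrightarrow> skeleton X k \<subseteq> skeleton X l"
  unfolding skeleton_def by (intro UN_mono) auto

lemma char_map_disk:
  assumes "b \<in> cells X"
  shows "char_map X b ` topspace (disk (cell_dim X b)) \<subseteq> open_cell X b \<union> skeleton X (int (cell_dim X b) - 1)"
  using char_map(3) [OF assms] unfolding topspace_disk_eq_Un open_cell_def by blast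

lemma open_cell_subset_char_map: "open_cell X b \<subseteq> char_map X b ` topspace (disk (cell_dim X b))"
  unfolding open_cell_def topspace_disk_eq_Un by blast

lemma closedin_char_map:
  assumes "b \<in> cells X"
  shows "closedin (cw_space X) (char_map X b ` topspace (disk (cell_dim X b)))"
  using continuous_imp_closed_map [OF char_map(1) [OF assms] compact_space_disk Hausdorff] by (simp add: closed_map_def)

lemma closedin_cells:
  assumes "B \<subseteq> cells X" and "\<And>b. b \<in> B \<Longrightarrow> skeleton X (int (cell_dim X b) - 1) \<subseteq> (\<Union>b\<in>B. open_cell X b)"
  shows "closedin (cw_space X) (\<Union>b\<in>B. open_cell X b)"
proof -
  have "(\<Union>b\<in>B. open_cell X b) = (\<Union>b\<in>B. char_map X b ` topspace (disk (cell_dim X b)))"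
  proof
    show "(\<Union>b\<in>B. open_cell X b) \<subseteq> (\<Union>b\<in>B. char_map X b ` topspace (disk (cell_dim X b)))"
      using open_cell_subset_char_map by (intro UN_mono) auto
    show "(\<Union>b\<in>B. char_map X b ` topspace (disk (cell_dim X b))) \<subseteq> (\<Union>b\<in>B. open_cell X b)"
    proof (rule UN_least)
      fix b assume "b \<in> B"
      with assms char_map_disk [of b] show "char_map X b ` topspace (disk (cell_dim X b)) \<subseteq> (\<Union>b\<in>B. open_cell X b)"
        by blast
    qed
  qed
  moreover have "finite B"
    using assms(1) finite_cells finite_subset by blast
  ultimately show ?thesis
    using assms(1) closedin_char_map by (auto intro!: closedin_Union)
qed

lemma closedin_skeleton: "closedin (cw_space X) (skeleton X k)"
  unfolding skeleton_def
proof (rule closedin_cells)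
  fix b assume "b \<in> {b \<in> cells X. int (cell_dim X b) \<le> k}"
  then show "skeleton X (int (cell_dim X b) - 1) \<subseteq> (\<Union>b\<in>{b \<in> cells X. int (cell_dim X b) \<le> k}. open_cell X b)"
    using skeleton_mono [of "int (cell_dim X b) - 1" k] by (simp add: skeleton_def)
qed auto

text \<open>For \<open>S\<close> a set of \<open>k\<close>-cells these are exactly the subcomplexes between the skeleta of
  dimensions \<open>k - 1\<close> and \<open>k\<close>. The skeleton of dimension \<open>k\<close> itself is the case in which \<open>S\<close>
  contains all \<open>k\<close>-cells, so one statement about chains of layers covers both the trees
  and the cellular chain groups of the whole complex.\<close>

definition layer :: "nat \<Rightarrow> 'i set \<Rightarrow> 'a set" where
  "layer k S = skeleton X (int k - 1) \<union> (\<Union>b\<in>S. open_cell X b)"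

lemma layer_eq_cells:
  "layer k S = (\<Union>b\<in>{b \<in> cells X. int (cell_dim X b) \<le> int k - 1} \<union> S. open_cell X b)"
  by (auto simp: layer_def skeleton_def)

lemma kcellsD: "b \<in> kcells X (int k) \<Longrightarrow> b \<in> cells X \<and> cell_dim X b = k"
  by (simp add: kcells_def)

lemma closedin_layer:
  assumes "S \<subseteq> kcells X (int k)"
  shows "closedin (cw_space X) (layer k S)"
  unfolding layer_eq_cells
proof (rule closedin_cells)
  fix b assume "b \<in> {b \<in> cells X. int (cell_dim X b) \<le> int k - 1} \<union> S"
  then have "int (cell_dim X b) - 1 \<le> int k - 1"
    using assms kcellsD by fastforce
  then have "skeleton X (int (cell_dim X b) - 1) \<subseteq> layer k S"
    using skeleton_mono unfolding layer_def by blast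
  then show "skeleton X (int (cell_dim X b) - 1) \<subseteq> (\<Union>b\<in>{b \<in> cells X. int (cell_dim X b) \<le> int k - 1} \<union> S. open_cell X b)"
    unfolding layer_eq_cells .
qed (use assms in \<open>auto simp: kcells_def\<close>)

lemma open_cell_disjoint_skeleton:
  assumes "b \<in> cells X" "k < int (cell_dim X b)"
  shows "open_cell X b \<inter> skeleton X k = {}"
proof -
  have "open_cell X b \<inter> open_cell X b' = {}" if "b' \<in> cells X" "int (cell_dim X b') \<le> k" for b'
  proof -
    have "b \<noteq> b'"
      using that assms by auto
    then show ?thesis
      using disjoint_cells that assms unfolding disjoint_family_on_def by blast
  qed
  then show ?thesis
    unfolding skeleton_def by blast
qed

lemma open_cell_nonempty: "open_cell X b \<noteq> {}"
proof -
  have "(\<lambda>_. 0) \<in> disk_interior (cell_dim X b)"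
    by (simp add: disk_interior_def topspace_Euclidean_space)
  then show ?thesis
    unfolding open_cell_def by blast
qed

lemma open_cell_subset_layer_iff:
  assumes S: "S \<subseteq> kcells X (int k)" and b: "b \<in> cells X"
  shows "open_cell X b \<subseteq> layer k S \<longleftrightarrow> cell_dim X b < k \<or> b \<in> S"
proof
  assume "open_cell X b \<subseteq> layer k S"
  then obtain b' where b': "b' \<in> {b \<in> cells X. int (cell_dim X b) \<le> int k - 1} \<union> S" "open_cell X b \<inter> open_cell X b' \<noteq> {}"
    using open_cell_nonempty unfolding layer_eq_cells by blast
  moreover have "b' \<in> cells X"
    using b' S kcellsD by blast
  ultimately have "b = b'"
    using disjoint_cells b by (auto simp: disjoint_family_on_def)
  then show "cell_dim X b < k \<or> b \<in> S"
    using b' by auto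
next
  assume "cell_dim X b < k \<or> b \<in> S"
  then show "open_cell X b \<subseteq> layer k S"
    using b unfolding layer_eq_cells by (intro UN_upper) auto
qed

lemma layer_inj:
  assumes "S \<subseteq> kcells X (int k)" "S' \<subseteq> kcells X (int k)" "layer k S = layer k S'"
  shows "S = S'"
proof -
  have "b \<in> S \<longleftrightarrow> b \<in> S'" if "b \<in> kcells X (int k)" for b
    using open_cell_subset_layer_iff [OF assms(1), of b] open_cell_subset_layer_iff [OF assms(2), of b] assms(3)
      kcellsD [OF that] by auto
  then show ?thesis
    using assms by blast
qed

lemma layer_subset_topspace: "S \<subseteq> kcells X (int k) \<Longrightarrow> layer k S \<subseteq> topspace (cw_space X)"
  using closedin_layer closedin_subset by blast

lemma attached_cells_layer:
  assumes S: "S \<subseteq> kcells X (int k)"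
  shows "attached_cells (subtopology (cw_space X) (layer k S)) (skeleton X (int k - 1)) k S (char_map X)"
proof
  have b: "b \<in> cells X" "cell_dim X b = k" if "b \<in> S" for b
    using S that kcellsD by auto
  have in_layer: "char_map X b ` topspace (disk k) \<subseteq> layer k S" if "b \<in> S" for b
    using char_map_disk [OF b(1) [OF that]] that unfolding layer_def b(2) [OF that] by blast
  show "Hausdorff_space (subtopology (cw_space X) (layer k S))"
    by (rule Hausdorff_space_subtopology [OF Hausdorff])
  show "closedin (subtopology (cw_space X) (layer k S)) (skeleton X (int k - 1))"
    using closedin_skeleton by (auto simp: layer_def intro!: closedin_subset_topspace)
  show "finite S"
    by (rule finite_subset [OF _ finite_cells]) (use b in auto)
  show "continuous_map (disk k) (subtopology (cw_space X) (layer k S)) (char_map X b)" if "b \<in> S" for b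
    using char_map(1) [OF b(1) [OF that]] in_layer [OF that] b(2) [OF that] by (auto simp: continuous_map_in_subtopology)
  show "embedding_map (subtopology (disk k) (disk_interior k)) (subtopology (cw_space X) (layer k S)) (char_map X b)"
    if "b \<in> S" for b
    using char_map(2) [OF b(1) [OF that]] in_layer [OF that] b(2) [OF that] by (auto simp: embedding_map_in_subtopology)
  show "char_map X b ` disk_boundary k \<subseteq> skeleton X (int k - 1)" if "b \<in> S" for b
    using char_map(3) [OF b(1) [OF that]] b(2) [OF that] by simp
  have oc: "char_map X b ` disk_interior k = open_cell X b" if "b \<in> S" for b
    using b(2) [OF that] by (simp add: open_cell_def)
  show "disjoint_family_on (\<lambda>b. char_map X b ` disk_interior k) S"
    using disjoint_cells b(1) oc by (auto simp: disjoint_family_on_def)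
  show "char_map X b ` disk_interior k \<inter> skeleton X (int k - 1) = {}" if "b \<in> S" for b
    using open_cell_disjoint_skeleton [OF b(1) [OF that], of "int k - 1"] b(2) [OF that] oc [OF that] by simp
  show "topspace (subtopology (cw_space X) (layer k S)) = skeleton X (int k - 1) \<union> (\<Union>b\<in>S. char_map X b ` disk_interior k)"
    using layer_subset_topspace [OF S] oc by (simp add: layer_def Int_absorb1)
qed

lemma layer_kcells: "layer k (kcells X (int k)) = skeleton X (int k)"
  unfolding layer_eq_cells skeleton_def by (intro arg_cong [where f = "\<lambda>B. \<Union>b\<in>B. open_cell X b"]) (auto simp: kcells_def)

definition layer_complex :: "nat \<Rightarrow> 'i set \<Rightarrow> ('a, 'i) cw" where
  "layer_complex k S = restrict_cw X (layer k S)"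

lemma layer_complex_simps [simp]:
  "cw_space (layer_complex k S) = subtopology (cw_space X) (layer k S)"
  "char_map (layer_complex k S) = char_map X"
  "cell_dim (layer_complex k S) = cell_dim X"
  "open_cell (layer_complex k S) = open_cell X"
  by (auto simp: layer_complex_def restrict_cw_def open_cell_def fun_eq_iff)

lemma cells_layer_complex:
  assumes "S \<subseteq> kcells X (int k)"
  shows "cells (layer_complex k S) = {b \<in> cells X. cell_dim X b < k} \<union> S"
  using open_cell_subset_layer_iff [OF assms] assms
  by (auto simp: layer_complex_def restrict_cw_def kcells_def)

lemma kcells_layer_complex:
  assumes "S \<subseteq> kcells X (int k)"
  shows "kcells (layer_complex k S) (int k) = S"
    and "l < int k \<Longrightarrow> kcells (layer_complex k S) l = kcells X l"
  using assms unfolding kcells_def cells_layer_complex [OF assms] by auto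

lemma skeleton_layer_complex_low:
  assumes "S \<subseteq> kcells X (int k)" "l < int k"
  shows "skeleton (layer_complex k S) l = skeleton X l"
proof -
  have "{b \<in> cells (layer_complex k S). int (cell_dim X b) \<le> l} = {b \<in> cells X. int (cell_dim X b) \<le> l}"
    using assms by (auto simp: cells_layer_complex kcells_def)
  then show ?thesis
    by (simp add: skeleton_def)
qed

lemma skeleton_layer_complex_high:
  assumes "S \<subseteq> kcells X (int k)" "int k \<le> l"
  shows "skeleton (layer_complex k S) l = layer k S"
proof -
  have "{b \<in> cells (layer_complex k S). int (cell_dim X b) \<le> l} = {b \<in> cells X. int (cell_dim X b) \<le> int k - 1} \<union> S"
    using assms by (auto simp: cells_layer_complex kcells_def)
  then show ?thesis
    by (simp add: skeleton_def layer_eq_cells)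
qed

lemma subtopology_skeleton_low:
  assumes "l < int k"
  shows "subtopology (subtopology (cw_space X) (layer k S)) (skeleton X l) = subtopology (cw_space X) (skeleton X l)"
proof -
  have "skeleton X l \<subseteq> layer k S"
    using skeleton_mono [of l "int k - 1"] assms unfolding layer_def by auto
  then show ?thesis
    by (simp add: subtopology_subtopology Int_absorb1)
qed

lemma cell_chain_group_low:
  assumes "S \<subseteq> kcells X (int k)" "l < int k"
  shows "cell_chain_group (layer_complex k S) l = cell_chain_group X l"
  using assms by (simp add: cell_chain_group_def skeleton_layer_complex_low subtopology_skeleton_low)

lemma cell_boundary_low:
  assumes "S \<subseteq> kcells X (int k)" "l < int k"
  shows "cell_boundary (layer_complex k S) l = cell_boundary X l"
  using assms by (simp add: cell_boundary_def skeleton_layer_complex_low subtopology_skeleton_low)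

lemma cell_cycle_group_low:
  assumes "S \<subseteq> kcells X (int k)" "l < int k"
  shows "cell_cycle_group (layer_complex k S) l = cell_cycle_group X l"
  using assms by (simp add: cell_cycle_group_def cell_chain_group_low cell_boundary_low)

lemma cell_chain_group_top:
  assumes "S \<subseteq> kcells X (int k)"
  shows "cell_chain_group (layer_complex k S) (int k)
    = relative_homology_group (int k) (subtopology (cw_space X) (layer k S)) (skeleton X (int k - 1))"
  using assms by (simp add: cell_chain_group_def skeleton_layer_complex_low skeleton_layer_complex_high subtopology_subtopology)

lemma cell_class_top:
  assumes "S \<subseteq> kcells X (int k)" "b \<in> S"
  shows "cell_class (layer_complex k S) b
    = hom_induced (int k) (disk k) (disk_boundary k) (subtopology (cw_space X) (layer k S)) (skeleton X (int k - 1))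
        (char_map X b) (disk_class k)"
proof -
  have "cell_dim X b = k"
    using assms kcellsD by blast
  then show ?thesis
    using assms by (simp add: cell_class_def Let_def skeleton_layer_complex_low skeleton_layer_complex_high subtopology_subtopology)
qed

lemma cell_class_closed:
  assumes "S \<subseteq> kcells X (int k)"
  shows "cell_class (layer_complex k S) \<in> S \<rightarrow> carrier (cell_chain_group (layer_complex k S) (int k))"
  unfolding cell_chain_group_top [OF assms] by (auto simp: cell_class_top [OF assms] hom_induced_carrier)

lemma cell_class_basis:
  assumes S: "S \<subseteq> kcells X (int k)" and x: "x \<in> carrier (cell_chain_group (layer_complex k S) (int k))"
  shows "\<exists>!n. supported S n \<and> x = lincomb (cell_chain_group (layer_complex k S) (int k)) (cell_class (layer_complex k S)) S n"
proof -
  interpret A: attached_cells "subtopology (cw_space X) (layer k S)" "skeleton X (int k - 1)" k S "char_map X"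
    by (rule attached_cells_layer) fact
  interpret G: comm_group "cell_chain_group (layer_complex k S) (int k)"
    by (simp add: cell_chain_group_def)
  have "lincomb (cell_chain_group (layer_complex k S) (int k)) A.attached_class S n
      = lincomb (cell_chain_group (layer_complex k S) (int k)) (cell_class (layer_complex k S)) S n" for n
    by (rule G.lincomb_cong_gens [OF cell_class_closed [OF S]])
      (simp add: cell_class_top [OF S] A.attached_class_def)
  then show ?thesis
    using A.attached_class_basis x unfolding cell_chain_group_top [OF S, symmetric] supported_def by simp
qed

lemma cell_coords_top:
  assumes S: "S \<subseteq> kcells X (int k)"
  shows "cell_coords (layer_complex k S) (int k) x =
    (THE n. supported S n \<and> x = lincomb (cell_chain_group (layer_complex k S) (int k)) (cell_class (layer_complex k S)) S n)"
  by (simp add: cell_coords_def supported_def lincomb_def kcells_layer_complex [OF S])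

lemma cell_coords:
  assumes S: "S \<subseteq> kcells X (int k)" and x: "x \<in> carrier (cell_chain_group (layer_complex k S) (int k))"
  shows "supported S (cell_coords (layer_complex k S) (int k) x)"
    and "lincomb (cell_chain_group (layer_complex k S) (int k)) (cell_class (layer_complex k S)) S
           (cell_coords (layer_complex k S) (int k) x) = x"
  using theI' [OF cell_class_basis [OF assms]] unfolding cell_coords_top [OF S] by metis+

lemma cell_coords_lincomb:
  assumes S: "S \<subseteq> kcells X (int k)" and n: "supported S n"
  shows "cell_coords (layer_complex k S) (int k)
    (lincomb (cell_chain_group (layer_complex k S) (int k)) (cell_class (layer_complex k S)) S n) = n"
proof -
  interpret G: comm_group "cell_chain_group (layer_complex k S) (int k)"
    by (simp add: cell_chain_group_def)
  show ?thesis
    unfolding cell_coords_top [OF S]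
    by (rule the1_equality [OF cell_class_basis [OF S]]) (use n G.lincomb_closed [OF cell_class_closed [OF S]] in auto)
qed

lemma layer_complex_kcells:
  assumes "has_cw_dimension X k"
  shows "layer_complex k (kcells X (int k)) = X"
proof -
  have top: "layer k (kcells X (int k)) = topspace (cw_space X)"
    unfolding layer_kcells cells_cover [symmetric] skeleton_def
    using assms by (auto simp: has_cw_dimension_def)
  have "{b \<in> cells X. open_cell X b \<subseteq> topspace (cw_space X)} = cells X"
    using cells_cover by blast
  then show ?thesis
    unfolding layer_complex_def restrict_cw_def top by simp
qed

end

text \<open>The composite contains two consecutive maps of the exact sequence of a pair of skeleta.\<close>

lemma cell_boundary_boundary:
  "cell_boundary W (k - 1) (cell_boundary W k z) = \<one>\<^bsub>cell_chain_group W (k - 2)\<^esub>"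
proof -
  let ?X = "\<lambda>l. subtopology (cw_space W) (skeleton W l)"
  have mono: "skeleton W (l - 1) \<subseteq> skeleton W l" for l
    unfolding skeleton_def by (intro UN_mono) auto
  have sub: "subtopology (?X l) (skeleton W (l - 1)) = ?X (l - 1)" for l
    using mono [of l] by (simp add: subtopology_subtopology Int_absorb1)
  have sub1: "subtopology (?X k) (skeleton W (k - 1)) = ?X (k - 1)"
    and sub2: "subtopology (?X (k - 1)) (skeleton W (k - 2)) = ?X (k - 2)"
    using sub [of k] sub [of "k - 1"] by simp_all
  define u where "u = hom_boundary k (?X k) (skeleton W (k - 1)) z"
  have u: "u \<in> carrier (homology_group (k - 1) (?X (k - 1)))"
    unfolding u_def sub1 [symmetric] by (rule hom_boundary_carrier)
  have exact: "exact_seq ([homology_group (k - 1 - 1) (subtopology (?X (k - 1)) (skeleton W (k - 2))),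
      relative_homology_group (k - 1) (?X (k - 1)) (skeleton W (k - 2)), homology_group (k - 1) (?X (k - 1))],
      [hom_boundary (k - 1) (?X (k - 1)) (skeleton W (k - 2)), hom_induced (k - 1) (?X (k - 1)) {} (?X (k - 1)) (skeleton W (k - 2)) id])"
    by (rule homology_exactness_axiom_1)
  let ?v = "hom_induced (k - 1) (?X (k - 1)) {} (?X (k - 1)) (skeleton W (k - 2)) id u"
  have "?v \<in> kernel (relative_homology_group (k - 1) (?X (k - 1)) (skeleton W (k - 2)))
      (homology_group (k - 1 - 1) (subtopology (?X (k - 1)) (skeleton W (k - 2))))
      (hom_boundary (k - 1) (?X (k - 1)) (skeleton W (k - 2)))"
    using exact u by auto
  then have zero: "hom_boundary (k - 1) (?X (k - 1)) (skeleton W (k - 2)) ?v = \<one>\<^bsub>homology_group (k - 2) (?X (k - 2))\<^esub>"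
    by (simp add: kernel_def sub2 del: one_relative_homology_group)
  have 1: "cell_boundary W k z = ?v"
    by (simp add: cell_boundary_def hom_relboundary_def u_def sub1)
  have 2: "cell_boundary W (k - 1) ?v
      = hom_induced (k - 2) (?X (k - 2)) {} (?X (k - 2)) (skeleton W (k - 3)) id
          (hom_boundary (k - 1) (?X (k - 1)) (skeleton W (k - 2)) ?v)"
    by (simp add: cell_boundary_def hom_relboundary_def sub2)
  have 3: "cell_chain_group W (k - 2) = relative_homology_group (k - 2) (?X (k - 2)) (skeleton W (k - 3))"
    by (simp add: cell_chain_group_def)
  show ?thesis
    unfolding 1 2 zero 3
    by (rule hom_one [OF hom_induced_hom]) auto
qed

lemma comm_group_cell_chain_group [simp]: "comm_group (cell_chain_group W k)"
  by (simp add: cell_chain_group_def)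

lemma group_cell_chain_group [simp]: "group (cell_chain_group W k)"
  by (simp add: cell_chain_group_def)

lemma subgroup_cell_cycles: "subgroup (kernel (cell_chain_group V k) (cell_chain_group V (k - 1)) (cell_boundary V k)) (cell_chain_group V k)"
proof -
  interpret group_hom "cell_chain_group V k" "cell_chain_group V (k - 1)" "cell_boundary V k"
    by (simp add: group_hom_def group_hom_axioms_def cell_boundary_hom)
  show ?thesis by (rule subgroup_kernel)
qed

lemma carrier_cell_cycle_group:
  "carrier (cell_cycle_group V k) = {x \<in> carrier (cell_chain_group V k). cell_boundary V k x = \<one>\<^bsub>cell_chain_group V (k - 1)\<^esub>}"
  using subgroup.carrier_subgroup_generated_subgroup [OF subgroup_cell_cycles [of V k]]
  by (simp add: cell_cycle_group_def kernel_def)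

lemma comm_group_cell_cycle_group: "comm_group (cell_cycle_group V k)"
  unfolding cell_cycle_group_def by (simp add: group.abelian_subgroup_generated)

lemma mult_cell_cycle_group [simp]: "monoid.mult (cell_cycle_group V k) = monoid.mult (cell_chain_group V k)"
  "\<one>\<^bsub>cell_cycle_group V k\<^esub> = \<one>\<^bsub>cell_chain_group V k\<^esub>"
  by (simp_all add: cell_cycle_group_def)

context finite_cw
begin

lemma cell_chain_group_kcells:
  "cell_chain_group (layer_complex k (kcells X (int k))) (int k) = cell_chain_group X (int k)"
  unfolding cell_chain_group_top [OF order_refl] layer_kcells by (simp add: cell_chain_group_def)

lemma cell_class_kcells:
  assumes "b \<in> kcells X (int k)"
  shows "cell_class (layer_complex k (kcells X (int k))) b = cell_class X b"
  using kcellsD [OF assms] unfolding cell_class_top [OF order_refl assms] layer_kcells by (simp add: cell_class_def Let_def)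

lemma cell_class_carrier: "cell_class X \<in> kcells X (int k) \<rightarrow> carrier (cell_chain_group X (int k))"
  using cell_class_closed [of "kcells X (int k)" k] unfolding cell_chain_group_kcells by (auto simp: Pi_iff cell_class_kcells)

lemma lincomb_cell_class_kcells:
  "lincomb (cell_chain_group X (int k)) (cell_class (layer_complex k (kcells X (int k)))) (kcells X (int k)) n
     = lincomb (cell_chain_group X (int k)) (cell_class X) (kcells X (int k)) n"
  using cell_class_carrier [of k] by (intro comm_group.lincomb_cong_gens) (auto simp: cell_class_kcells)

lemma cell_coords_kcells:
  "cell_coords (layer_complex k (kcells X (int k))) (int k) x = cell_coords X (int k) x"
  unfolding cell_coords_top [OF order_refl] cell_chain_group_kcells lincomb_cell_class_kcells
  by (simp add: cell_coords_def supported_def lincomb_def)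

lemma cell_coords_X:
  assumes "x \<in> carrier (cell_chain_group X (int k))"
  shows "supported (kcells X (int k)) (cell_coords X (int k) x)"
    and "lincomb (cell_chain_group X (int k)) (cell_class X) (kcells X (int k)) (cell_coords X (int k) x) = x"
  using cell_coords [OF order_refl, of x k] assms
  unfolding cell_chain_group_kcells cell_coords_kcells lincomb_cell_class_kcells by auto

lemma cell_coords_X_lincomb:
  assumes "supported (kcells X (int k)) n"
  shows "cell_coords X (int k) (lincomb (cell_chain_group X (int k)) (cell_class X) (kcells X (int k)) n) = n"
  using cell_coords_lincomb [OF order_refl assms]
  unfolding cell_chain_group_kcells cell_coords_kcells lincomb_cell_class_kcells .

lemma cell_coords_X_mult:
  assumes "x \<in> carrier (cell_chain_group X (int k))" "y \<in> carrier (cell_chain_group X (int k))"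
  shows "cell_coords X (int k) (x \<otimes>\<^bsub>cell_chain_group X (int k)\<^esub> y) b = cell_coords X (int k) x b + cell_coords X (int k) y b"
proof -
  let ?C = "cell_chain_group X (int k)" and ?K = "kcells X (int k)" and ?c = "cell_coords X (int k)"
  have "x \<otimes>\<^bsub>?C\<^esub> y = lincomb ?C (cell_class X) ?K (?c x) \<otimes>\<^bsub>?C\<^esub> lincomb ?C (cell_class X) ?K (?c y)"
    using assms by (simp add: cell_coords_X)
  also have "\<dots> = lincomb ?C (cell_class X) ?K (\<lambda>b. ?c x b + ?c y b)"
    by (rule comm_group.lincomb_add [symmetric, OF _ cell_class_carrier]) simp
  finally have "?c (x \<otimes>\<^bsub>?C\<^esub> y) = (\<lambda>b. ?c x b + ?c y b)"
    using cell_coords_X(1) [OF assms(1)] cell_coords_X(1) [OF assms(2)]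
    by (simp add: cell_coords_X_lincomb supported_def)
  then show ?thesis
    by simp
qed

text \<open>The connecting homomorphism is natural for the inclusion of the layer into the skeleton of
  dimension \<open>k\<close>, and on the skeleton of dimension \<open>k - 1\<close> this inclusion is the identity.\<close>

lemma cell_boundary_layer_complex:
  assumes S: "S \<subseteq> kcells X (int k)" and b: "b \<in> S"
  shows "cell_boundary (layer_complex k S) (int k) (cell_class (layer_complex k S) b) = cell_boundary X (int k) (cell_class X b)"
proof -
  let ?T = "layer k S" and ?A = "skeleton X (int k - 1)" and ?B = "skeleton X (int k - 2)"
  let ?XT = "subtopology (cw_space X) ?T" and ?X = "subtopology (cw_space X) (skeleton X (int k))"
  let ?z = "cell_class (layer_complex k S) b"
  let ?i = "hom_induced (int k) ?XT ?A ?X ?A id"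
  interpret A: attached_cells ?XT ?A k S "char_map X"
    by (rule attached_cells_layer) fact
  have AT: "?A \<subseteq> ?T" "?T \<subseteq> skeleton X (int k)" "?A \<subseteq> skeleton X (int k)"
    using S layer_kcells [of k] unfolding layer_def by blast+
  have subA: "subtopology ?XT ?A = subtopology (cw_space X) ?A" "subtopology ?X ?A = subtopology (cw_space X) ?A"
    using AT by (simp_all add: subtopology_subtopology Int_absorb1)
  have cont: "continuous_map ?XT ?X id"
    using AT(2) continuous_map_from_subtopology_mono [of "cw_space X" "skeleton X (int k)" ?X id ?T] by simp
  have iz: "?i ?z = cell_class X b"
  proof -
    have "?i ?z = hom_induced (int k) (disk k) (disk_boundary k) ?X ?A (id \<circ> char_map X b) (disk_class k)"
      unfolding cell_class_top [OF S b]
      by (rule hom_induced_compose') (use A.contin [OF b] A.boundary [OF b] cont in auto)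
    then show ?thesis
      using kcellsD [of b k] S b by (simp add: cell_class_def Let_def subset_iff)
  qed
  have nat: "hom_relboundary (int k) ?X ?A ?B \<circ> ?i = hom_induced (int k - 1) (subtopology ?XT ?A) ?B (subtopology ?X ?A) ?B id \<circ> hom_relboundary (int k) ?XT ?A ?B"
    by (rule naturality_hom_induced_relboundary) (use cont in auto)
  have "cell_boundary X (int k) (cell_class X b) = (hom_relboundary (int k) ?X ?A ?B \<circ> ?i) ?z"
    by (simp add: cell_boundary_def iz)
  also have "\<dots> = hom_relboundary (int k) ?XT ?A ?B ?z"
    unfolding nat subA o_apply by (rule hom_induced_id) (metis hom_relboundary subA(1))
  also have "\<dots> = cell_boundary (layer_complex k S) (int k) ?z"
    by (simp add: cell_boundary_def skeleton_layer_complex_high skeleton_layer_complex_low S subtopology_subtopology)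
  finally show ?thesis ..
qed

end

locale cw_dim = finite_cw X for X :: "('a, 'i) cw" +
  fixes d :: nat
  assumes dim: "has_cw_dimension X d" and dim_pos: "d \<ge> 1"
begin

lemma d1: "int (d - 1) = int d - 1"
  using dim_pos by simp

abbreviation "lower_chains \<equiv> cell_chain_group X (int d - 1)"
abbreviation "lower_cycles \<equiv> cell_cycle_group X (int d - 1)"
abbreviation "E \<equiv> kcells X (int d)"
abbreviation "F \<equiv> kcells X (int d - 1)"
abbreviation "bdry \<equiv> (\<lambda>b. cell_boundary X (int d) (cell_class X b))"
abbreviation "coords \<equiv> cell_coords X (int d - 1)"
abbreviation "W \<equiv> layer_complex d"

lemmas coords_lower = cell_coords_X [where k = "d - 1", unfolded d1]
lemmas coords_lower_mult = cell_coords_X_mult [where k = "d - 1", unfolded d1]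

lemma boundary_in_cycles: "bdry \<in> E \<rightarrow> carrier lower_cycles"
proof
  fix b assume "b \<in> E"
  then have "bdry b \<in> carrier lower_chains"
    using hom_in_carrier [OF cell_boundary_hom] cell_class_carrier [of d] by blast
  then show "bdry b \<in> carrier lower_cycles"
    using cell_boundary_boundary [of X "int d"] by (simp add: carrier_cell_cycle_group)
qed

sublocale integral_system lower_cycles E bdry F coords
proof -
  interpret Z: comm_group lower_cycles by (rule comm_group_cell_cycle_group)
  show "integral_system lower_cycles E bdry F coords"
  proof
    show "finite E" "finite F"
      using finite_cells by (auto simp: kcells_def)
    show "bdry \<in> E \<rightarrow> carrier lower_cycles"
      by (rule boundary_in_cycles)
    fix x y a
    assume x: "x \<in> carrier lower_cycles"
    then have xC: "x \<in> carrier lower_chains"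
      by (simp add: carrier_cell_cycle_group)
    show "coords (x \<otimes>\<^bsub>lower_cycles\<^esub> y) a = coords x a + coords y a" if y: "y \<in> carrier lower_cycles"
      using coords_lower_mult [OF xC, of y a] y by (simp add: carrier_cell_cycle_group)
    show "x = \<one>\<^bsub>lower_cycles\<^esub>" if "\<And>a. a \<in> F \<Longrightarrow> coords x a = 0"
    proof -
      have "coords x = (\<lambda>_. 0)"
        using coords_lower(1) [OF xC] that by (auto simp: supported_def)
      then have "x = lincomb lower_chains (cell_class X) F (\<lambda>_. 0)"
        using coords_lower(2) [OF xC] by simp
      then show ?thesis
        by (simp add: comm_group.lincomb_zero)
    qed
  qed
qed

end

section \<open>Spanning trees as bases\<close>

lemma (in group) trivial_group_Mod_one: "trivial_group (G Mod {\<one>}) \<longleftrightarrow> carrier G = {\<one>}"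
proof -
  have "{\<one>} #> x = {x}" if "x \<in> carrier G" for x
    using that by (simp add: r_coset_def)
  then have "carrier (G Mod {\<one>}) = (\<lambda>x. {x}) ` carrier G"
    unfolding carrier_FactGroup by (intro image_cong) auto
  moreover have "group (G Mod {\<one>})"
    by (rule normal.factorgroup_is_group [OF one_is_normal])
  ultimately show ?thesis
    by (auto simp: trivial_group_def)
qed

context cw_dim
begin

lemma W_chain_carrier:
  assumes S: "S \<subseteq> E"
  shows "carrier (cell_chain_group (W S) (int d))
    = {lincomb (cell_chain_group (W S) (int d)) (cell_class (W S)) S n | n. supported S n}"
proof -
  interpret C: comm_group "cell_chain_group (W S) (int d)" by simp
  show ?thesis
    using cell_class_basis [OF S] C.lincomb_closed [OF cell_class_closed [OF S]] by blast
qed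

lemma W_boundary_lincomb:
  assumes S: "S \<subseteq> E" and n: "supported S n"
  shows "cell_boundary (W S) (int d) (lincomb (cell_chain_group (W S) (int d)) (cell_class (W S)) S n) = L n"
proof -
  interpret C: comm_group lower_chains by simp
  have finS: "finite S"
    using S finE finite_subset by blast
  have bS: "bdry \<in> S \<rightarrow> carrier lower_cycles"
    using boundary_in_cycles S by blast
  have bC: "bdry \<in> S \<rightarrow> carrier lower_chains"
    using bS by (auto simp: carrier_cell_cycle_group)
  have low: "cell_chain_group (W S) (int d - 1) = lower_chains"
    by (rule cell_chain_group_low) (use S in auto)
  have "cell_boundary (W S) (int d) (lincomb (cell_chain_group (W S) (int d)) (cell_class (W S)) S n)
      = lincomb (cell_chain_group (W S) (int d - 1)) (\<lambda>b. cell_boundary (W S) (int d) (cell_class (W S) b)) S n"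
    by (rule hom_lincomb [OF _ _ cell_boundary_hom finS cell_class_closed [OF S]]) auto
  also have "\<dots> = lincomb lower_chains bdry S n"
    unfolding low by (rule C.lincomb_cong_gens [OF bC]) (simp add: cell_boundary_layer_complex [OF S])
  also have "\<dots> = lincomb lower_cycles bdry S n"
  proof -
    have "id (lincomb lower_cycles bdry S n) = lincomb lower_chains (\<lambda>b. id (bdry b)) S n"
    proof (rule hom_lincomb [OF _ _ _ finS bS])
      show "id \<in> hom lower_cycles lower_chains"
        by (auto simp: hom_def carrier_cell_cycle_group)
    qed (auto intro: comm_group_cell_cycle_group)
    then show ?thesis by simp
  qed
  also have "\<dots> = L n"
    by (rule lincomb_restrict [symmetric, OF finE S boundary_in_cycles]) (use n in \<open>auto simp: supported_def\<close>)
  finally show ?thesis .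
qed

lemma W_boundaries:
  assumes S: "S \<subseteq> E"
  shows "cell_boundaries (W S) (int d - 1) = gen_span S"
proof -
  have "cell_boundaries (W S) (int d - 1) = cell_boundary (W S) (int d) ` carrier (cell_chain_group (W S) (int d))"
    by (simp add: cell_boundaries_def)
  also have "\<dots> = gen_span S"
    unfolding W_chain_carrier [OF S] gen_span_def using W_boundary_lincomb [OF S] by (force simp: image_iff)
  finally show ?thesis .
qed

lemma W_homology:
  assumes S: "S \<subseteq> E"
  shows "cell_homology_group (W S) (int d - 1) = lower_cycles Mod gen_span S"
  using S by (simp add: cell_homology_group_def W_boundaries cell_cycle_group_low)

lemma W_E: "W E = X"
  by (rule layer_complex_kcells [OF dim])

lemma W_betti_eq_iff:
  assumes S: "S \<subseteq> E"
  shows "betti (W S) (int d - 1) = betti X (int d - 1) \<longleftrightarrow> bdry ` E \<subseteq> isolator (gen_span S)"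
proof -
  have "betti X (int d - 1) = abelian_rank (lower_cycles Mod gen_span E)"
    using W_homology [OF order_refl] unfolding W_E betti_def by simp
  moreover have "betti (W S) (int d - 1) = abelian_rank (lower_cycles Mod gen_span S)"
    using W_homology [OF S] unfolding betti_def by simp
  ultimately show ?thesis
    using rank_eq_iff [OF S] by simp
qed

lemma tree_theta_layer:
  assumes S: "S \<subseteq> E"
  shows "tree_theta X d (layer d S) = theta S"
  unfolding tree_theta_def theta_def layer_complex_def [symmetric] W_homology [OF S] ..

lemma W_cycle_carrier:
  assumes S: "S \<subseteq> E"
  shows "carrier (cell_cycle_group (W S) (int d))
    = {lincomb (cell_chain_group (W S) (int d)) (cell_class (W S)) S n | n. supported S n \<and> L n = \<one>\<^bsub>lower_cycles\<^esub>}"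
proof -
  have "\<one>\<^bsub>cell_chain_group (W S) (int d - 1)\<^esub> = \<one>\<^bsub>lower_cycles\<^esub>"
    using S by (simp add: cell_chain_group_low)
  then show ?thesis
    unfolding carrier_cell_cycle_group W_chain_carrier [OF S] using W_boundary_lincomb [OF S] by auto
qed

text \<open>A layer of dimension \<open>d\<close> equals its skeleta of dimensions \<open>d\<close> and \<open>d + 1\<close>, so it has no
  chains of dimension \<open>d + 1\<close>.\<close>

lemma W_top_boundaries:
  assumes S: "S \<subseteq> E"
  shows "cell_boundaries (W S) (int d) = {\<one>\<^bsub>cell_chain_group (W S) (int d)\<^esub>}"
proof -
  have "trivial_group (cell_chain_group (W S) (int d + 1))"
    using trivial_relative_homology_group_topspace [of "int d + 1" "subtopology (cw_space X) (layer d S)"] layer_subset_topspace [OF S]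
    by (simp add: cell_chain_group_def skeleton_layer_complex_high S subtopology_subtopology Int_absorb1)
  then have "cell_boundaries (W S) (int d) = {cell_boundary (W S) (int d + 1) \<one>\<^bsub>cell_chain_group (W S) (int d + 1)\<^esub>}"
    by (simp add: cell_boundaries_def trivial_group_def)
  also have "cell_boundary (W S) (int d + 1) \<one>\<^bsub>cell_chain_group (W S) (int d + 1)\<^esub> = \<one>\<^bsub>cell_chain_group (W S) (int d + 1 - 1)\<^esub>"
    by (rule hom_one [OF cell_boundary_hom]) auto
  finally show ?thesis
    by simp
qed

lemma W_top_homology_trivial_iff:
  assumes S: "S \<subseteq> E"
  shows "trivial_group (cell_homology_group (W S) (int d)) \<longleftrightarrow> independent S"
proof -
  let ?C = "cell_chain_group (W S) (int d)"
  let ?lc = "lincomb ?C (cell_class (W S)) S"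
  let ?R = "{n. supported S n \<and> L n = \<one>\<^bsub>lower_cycles\<^esub>}"
  interpret Z: comm_group "cell_cycle_group (W S) (int d)"
    by (rule comm_group_cell_cycle_group)
  interpret C: comm_group ?C by simp
  have zero: "?lc (\<lambda>_. 0) = \<one>\<^bsub>?C\<^esub>"
    by (rule C.lincomb_zero)
  have inj: "n = (\<lambda>_. 0)" if "supported S n" "?lc n = \<one>\<^bsub>?C\<^esub>" for n
    using cell_coords_lincomb [OF S that(1)] cell_coords_lincomb [OF S, of "\<lambda>_. 0"] that(2) zero by (simp add: supported_def)
  have "trivial_group (cell_homology_group (W S) (int d)) \<longleftrightarrow> carrier (cell_cycle_group (W S) (int d)) = {\<one>\<^bsub>?C\<^esub>}"
    using Z.trivial_group_Mod_one by (simp add: cell_homology_group_def W_top_boundaries [OF S])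
  also have "\<dots> \<longleftrightarrow> (\<forall>n\<in>?R. ?lc n = \<one>\<^bsub>?C\<^esub>)"
  proof -
    have "carrier (cell_cycle_group (W S) (int d)) = ?lc ` ?R"
      unfolding W_cycle_carrier [OF S] by blast
    moreover have "(\<lambda>_. 0) \<in> ?R"
      by (auto simp: supported_def)
    ultimately show ?thesis
      by auto
  qed
  also have "\<dots> \<longleftrightarrow> (\<forall>n\<in>?R. n = (\<lambda>_. 0))"
  proof (intro ball_cong refl iffI)
    show "n = (\<lambda>_. 0)" if "n \<in> ?R" "?lc n = \<one>\<^bsub>?C\<^esub>" for n
      using that inj by blast
    show "?lc n = \<one>\<^bsub>?C\<^esub>" if "n = (\<lambda>_. 0)" for n
      unfolding that by (rule zero)
  qed
  also have "\<dots> \<longleftrightarrow> independent S"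
    by (simp add: independent_def S)
  finally show ?thesis .
qed

lemma subcomplex_layer:
  assumes S: "S \<subseteq> E"
  shows "subcomplex X (layer d S)"
  unfolding subcomplex_def
proof (intro conjI exI)
  show "closedin (cw_space X) (layer d S)"
    by (rule closedin_layer) fact
  show "layer d S = (\<Union>b\<in>{b \<in> cells X. int (cell_dim X b) \<le> int d - 1} \<union> S. open_cell X b)"
    by (rule layer_eq_cells)
qed (use S in \<open>auto simp: kcells_def\<close>)

text \<open>\<open>X\<close> has no cells above dimension \<open>d\<close>, so beyond the skeleton only \<open>d\<close>-cells can be added.\<close>

lemma subcomplex_is_layer:
  assumes T: "subcomplex X T" and sk: "skeleton X (int d - 1) \<subseteq> T"
  obtains S where "S \<subseteq> E" "T = layer d S"
proof -
  obtain B where B: "B \<subseteq> cells X" "T = (\<Union>b\<in>B. open_cell X b)"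
    using T by (auto simp: subcomplex_def)
  have "T = layer d (B \<inter> E)"
  proof
    show "layer d (B \<inter> E) \<subseteq> T"
      unfolding layer_def using sk B by blast
    show "T \<subseteq> layer d (B \<inter> E)"
      unfolding B(2)
    proof (rule UN_least)
      fix b assume b: "b \<in> B"
      then have "cell_dim X b \<le> d"
        using B dim by (auto simp: has_cw_dimension_def)
      then have "cell_dim X b < d \<or> b \<in> B \<inter> E"
        using b B by (auto simp: kcells_def)
      then show "open_cell X b \<subseteq> layer d (B \<inter> E)"
        using b B by (subst open_cell_subset_layer_iff) auto
    qed
  qed
  then show ?thesis
    using that [of "B \<inter> E"] by blast
qed

text \<open>Vanishing homology in degree \<open>d\<close> is independence of the boundaries, and the equality of Betti
  numbers says that the boundaries of the layer have finite index in all boundaries.\<close>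

lemma spanning_tree_iff: "spanning_tree X d T \<longleftrightarrow> (\<exists>S. basis S \<and> T = layer d S)"
proof
  assume T: "spanning_tree X d T"
  then obtain S where S: "S \<subseteq> E" "T = layer d S"
    using subcomplex_is_layer unfolding spanning_tree_def by blast
  have W: "restrict_cw X T = W S"
    by (simp add: layer_complex_def S)
  have "basis S"
    using T S(1) unfolding spanning_tree_def W basis_def
    by (simp add: W_top_homology_trivial_iff W_betti_eq_iff)
  then show "\<exists>S. basis S \<and> T = layer d S"
    using S by blast
next
  assume "\<exists>S. basis S \<and> T = layer d S"
  then obtain S where S: "basis S" "T = layer d S" by blast
  have SE: "S \<subseteq> E"
    using S by (auto simp: basis_def independent_def)
  have W: "restrict_cw X T = W S"
    by (simp add: layer_complex_def S)
  show "spanning_tree X d T"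
    unfolding spanning_tree_def W
    using S(1) SE subcomplex_layer [OF SE]
    by (auto simp: S(2) W_top_homology_trivial_iff W_betti_eq_iff basis_def layer_def)
qed

lemma spanning_trees: "{T. spanning_tree X d T} = layer d ` {S. basis S}" "inj_on (layer d) {S. basis S}"
  using layer_inj by (auto simp: spanning_tree_iff basis_def independent_def intro!: inj_onI)

lemma sum_spanning_trees: "(\<Sum>T | spanning_tree X d T. f T) = (\<Sum>S | basis S. f (layer d S))" for f :: "'a set \<Rightarrow> real"
  unfolding spanning_trees(1) by (rule sum.reindex_cong [OF spanning_trees(2) refl refl])

lemma tree_weight_layer:
  assumes S: "S \<subseteq> E"
  shows "tree_weight X d r (layer d S) = (real (theta S))\<^sup>2 * (\<Prod>b\<in>S. inverse (r b))"
  unfolding tree_weight_def tree_theta_layer [OF S] layer_complex_def [symmetric] kcells_layer_complex(1) [OF S] ..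

text \<open>Taking coordinates identifies the group of \<open>d\<close>-cycles of the tree with the cell \<open>b\<close> added and
  the group of relations supported on \<open>S\<close> and \<open>b\<close>. A circuit makes it cyclic, so the choice
  operator does return a generator, and the coordinates of a generator are again a circuit.\<close>

lemma circuit_generator:
  assumes S: "S \<subseteq> E" and b: "b \<in> E" and ex: "\<exists>c. circuit S b c"
  defines "U \<equiv> insert b S"
  shows "circuit S b (cell_coords (W U) (int d) (SOME c. is_generator (cell_cycle_group (W U) (int d)) c))"
proof -
  let ?C = "cell_chain_group (W U) (int d)" and ?Z = "cell_cycle_group (W U) (int d)"
  let ?lc = "lincomb ?C (cell_class (W U)) U"
  let ?R = "{n. supported U n \<and> L n = \<one>\<^bsub>lower_cycles\<^esub>}"
  interpret C: comm_group ?C by simp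
  have U: "U \<subseteq> E" and finU: "finite U"
    using S b finE finite_subset by (auto simp: U_def)
  note cls = cell_class_closed [OF U]
  have Z: "carrier ?Z = ?lc ` ?R"
    unfolding W_cycle_carrier [OF U] by blast
  have pow: "?lc n [^]\<^bsub>?Z\<^esub> k = ?lc (\<lambda>a. k * n a)" if "n \<in> ?R" for n and k :: int
  proof -
    have "?lc n \<in> carrier ?Z"
      using that Z by blast
    then have "?lc n [^]\<^bsub>?Z\<^esub> k = ?lc n [^]\<^bsub>?C\<^esub> k"
      unfolding cell_cycle_group_def by (rule C.int_pow_subgroup_generated)
    then show ?thesis
      using C.lincomb_power [OF finU cls] by simp
  qed
  have coords: "cell_coords (W U) (int d) (?lc n) = n" if "supported U n" for n
    by (rule cell_coords_lincomb [OF U that])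
  obtain c where c: "circuit S b c"
    using ex by blast
  have R: "?R = range (\<lambda>k a. k * c a)"
    using c unfolding circuit_def U_def .
  have cR: "c \<in> ?R"
    using circuit_relation [OF c] by (simp add: U_def)
  have "is_generator ?Z (?lc c)"
    unfolding is_generator_def
  proof
    show "?lc c \<in> carrier ?Z"
      using Z cR by blast
    show "carrier ?Z = range (\<lambda>k::int. ?lc c [^]\<^bsub>?Z\<^esub> k)"
      unfolding Z R pow [OF cR] by blast
  qed
  then have "is_generator ?Z (SOME c. is_generator ?Z c)" (is "is_generator ?Z ?g")
    by (rule someI)
  then have g: "?g \<in> carrier ?Z" "carrier ?Z = range (\<lambda>k::int. ?g [^]\<^bsub>?Z\<^esub> k)"
    by (auto simp: is_generator_def)
  obtain x where x: "x \<in> ?R" "?g = ?lc x"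
    using g(1) Z by blast
  have xc: "cell_coords (W U) (int d) ?g = x"
    using coords x by simp
  have "?R = (\<lambda>z. cell_coords (W U) (int d) z) ` carrier ?Z"
    unfolding Z using coords by (force simp: image_iff)
  also have "\<dots> = range (\<lambda>k. cell_coords (W U) (int d) (?lc (\<lambda>a. k * x a)))"
    unfolding g(2) unfolding x(2) pow [OF x(1)] by blast
  also have "\<dots> = range (\<lambda>k a. k * x a)"
  proof -
    have "cell_coords (W U) (int d) (?lc (\<lambda>a. k * x a)) = (\<lambda>a. k * x a)" for k
      by (rule coords) (use x in \<open>auto simp: supported_def\<close>)
    then show ?thesis by simp
  qed
  finally show ?thesis
    unfolding circuit_def xc by (simp add: U_def)
qed

lemma tree_map_cell_fundamental:
  assumes S: "basis S" and b: "b \<in> E"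
  shows "fundamental S b (tree_map_cell X d (layer d S) b)"
proof -
  have SE: "S \<subseteq> E"
    using S by (auto simp: basis_def independent_def)
  have K: "kcells (restrict_cw X (layer d S)) (int d) = S"
    unfolding layer_complex_def [symmetric] by (rule kcells_layer_complex(1) [OF SE])
  show ?thesis
  proof (cases "b \<in> S")
    case True
    then show ?thesis
      by (simp add: fundamental_def tree_map_cell_def K)
  next
    case False
    have "layer d S \<union> open_cell X b = layer d (insert b S)"
      unfolding layer_def by blast
    then have W: "restrict_cw X (layer d S \<union> open_cell X b) = W (insert b S)"
      by (simp add: layer_complex_def)
    show ?thesis
      using circuit_generator [OF SE b exists_circuit [OF S b False]] False
      by (auto simp: fundamental_def tree_map_cell_def K W Let_def)
  qed
qed

text \<open>Coordinates vanish outside the \<open>(d-1)\<close>-cells, so the equations there are void.\<close>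

lemma real_cycles_eq: "real_cycles X (int d) = real_relations"
proof -
  have out: "coords (bdry b) a = 0" if "b \<in> E" "a \<notin> F" for a b
  proof -
    have "bdry b \<in> carrier lower_chains"
      using boundary_in_cycles that by (auto simp: carrier_cell_cycle_group)
    then show ?thesis
      using coords_lower(1) [of "bdry b"] that by (simp add: supported_def)
  qed
  have "(\<Sum>b\<in>E. x b * real_of_int (coords (bdry b) a)) = 0" if "a \<notin> F" for x a
    by (rule sum.neutral) (use out that in auto)
  then show ?thesis
    unfolding real_cycles_def real_relations_def real_chains_def real_boundary_def supported_def fun_eq_iff by blast
qed

theorem tree_projection:
  assumes r: "\<And>b. b \<in> E \<Longrightarrow> r b > 0"
  shows "is_orthogonal_projection (mod_inner X (int d) r) (real_chains X (int d)) (real_cycles X (int d))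
     (\<lambda>x a. 1 / total_weight X d r * (\<Sum>T | spanning_tree X d T. tree_weight X d r T * tree_map X d T x a))"
proof -
  define w where "w S = (real (theta S))\<^sup>2 * (\<Prod>b\<in>S. inverse (r b))" for S
  define \<tau> where "\<tau> S b = tree_map_cell X d (layer d S) b" for S b
  have tw: "tree_weight X d r (layer d S) = w S" if "basis S" for S
    using that by (simp add: tree_weight_layer w_def basis_def independent_def)
  have total: "total_weight X d r = (\<Sum>S | basis S. w S)"
    unfolding total_weight_def sum_spanning_trees by (intro sum.cong) (auto simp: tw)
  have num: "(\<Sum>T | spanning_tree X d T. tree_weight X d r T * tree_map X d T x a)
      = (\<Sum>S | basis S. w S * (\<Sum>b\<in>E. x b * \<tau> S b a))" for x a
    unfolding sum_spanning_trees by (intro sum.cong) (auto simp: tw tree_map_def \<tau>_def)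
  have fund: "\<And>S b. basis S \<Longrightarrow> b \<in> E \<Longrightarrow> fundamental S b (\<tau> S b)"
    unfolding \<tau>_def by (rule tree_map_cell_fundamental)
  note proj = weighted_basis_projection [of r \<tau>, OF r fund, folded w_def]
  show ?thesis
    unfolding is_orthogonal_projection_def real_cycles_eq total num mod_inner_def std_inner_def R_map_def
    using proj by blast
qed

end

theorem theorem1:
  fixes X :: "('a, 'i) cw" and d :: nat and r :: "'i \<Rightarrow> real"
  assumes "finite_cw_complex X"
    and "connected_space (cw_space X)"
    and "has_cw_dimension X d"
    and "d \<ge> 1"
    and "\<And>b. b \<in> kcells X (int d) \<Longrightarrow> r b > 0"
  shows "is_orthogonal_projection (mod_inner X (int d) r)
           (real_chains X (int d)) (real_cycles X (int d))
           (\<lambda>x a. 1 / total_weight X d r *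
              (\<Sum>T | spanning_tree X d T. tree_weight X d r T * tree_map X d T x a))"
proof -
  interpret cw_dim X d
    by unfold_locales (use assms in auto)
  show ?thesis
    by (rule tree_projection) (rule assms(5))
qed

end
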